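(* The pseudo-Hermitian sectional curvatures of a Sasakian manifold $(M^{2m+1},\theta,J,L_\theta)$ determine the curvature tensor completely.
   Context: All objects are smooth. For a $1$-form, $2d\theta(X,Y)=X(\theta(Y))-Y(\theta(X))-\theta([X,Y])$. A CR structure on an orientable manifold $M$ of dimension $2m+1$ is a complex rank-$m$ subbundle $H^{1,0}(M)\subset T(M)\otimes\mathbb C$ with $H^{1,0}(M)\cap H^{0,1}(M)=\{0\}$, where $H^{0,1}(M)=\overline{H^{1,0}(M)}$, and $[\Gamma(H^{1,0}(M)),\Gamma(H^{1,0}(M))]\subseteq\Gamma(H^{1,0}(M))$. Put $H(M)=\mathrm{Re}(H^{1,0}(M)\oplus H^{0,1}(M))$ and $J_b(Z+\overline Z)=\sqrt{-1}(Z-\overline Z)$ for $Z\in H^{1,0}(M)$. A pseudo-Hermitian $1$-form is a nowhere vanishing real $1$-form $\theta$ with $\ker\theta=H(M)$; its Levi form is $L_\theta(X,Y)=d\theta(X,J_bY)$ on $H(M)$, here positive definite (strictly pseudoconvex case). There is a unique (Reeb) vector field $\xi$ with $\theta(\xi)=1$, $i_\xi d\theta=0$; $T(M)=H(M)\oplus\mathbb R\xi$ with projection $\pi_H:T(M)\to H(M)$, and $J$ is the endomorphism of $T(M)$ with $J|_{H(M)}=J_b$, $J\xi=0$. The Webster metric is $g_\theta=\langle\cdot,\cdot\rangle=L_\theta(\pi_H\cdot,\pi_H\cdot)+\theta\otimes\theta$. There is the decomposition $T(M)\otimes\mathbb C=H^{1,0}(M)\oplus H^{0,1}(M)\oplus\mathbb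 C\xi$ with projections $\pi_+,\pi_-,\pi_0$. The canonical connection of $(M,\theta,J,L_\theta)$ (which is the Tanaka–Webster connection) is the unique linear connection $\nabla$ preserving this decomposition, with $\nabla g_\theta=0$, whose torsion $T_\nabla(X,Y)=\nabla_XY-\nabla_YX-[X,Y]$ satisfies $\pi_+(T_\nabla(Z,\overline W))=0$ for all $Z,W\in H^{1,0}(M)$ and such that, with $\tau(X)=T_\nabla(\xi,X)$ and $\sigma=\tau\circ J+J\circ\tau$, one has $g_\theta(\sigma(X),Y)=-g_\theta(X,\sigma(Y))$ for all $X,Y$. $(M,\theta,J,L_\theta)$ is Sasakian if $L_\theta$ is positive definite and $\tau=0$. The curvature tensor is that of the canonical connection, $R(X,Y)Z=\nabla_X\nabla_YZ-\nabla_Y\nabla_XZ-\nabla_{[X,Y]}Z$. The pseudo-Hermitian sectional curvature of a $J$-invariant $2$-plane $P\subset H(M)$ is $K_\theta(P)=\langle R(e_1,e_2)e_2,e_1\rangle$ for any orthonormal basis $\{e_1,e_2\}$ of $P$. *)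

theory Defs
  imports "HOL-Analysis.Analysis"
begin

section \<open>Smooth manifolds\<close>

primrec Ck_on :: "nat \<Rightarrow> ('e::real_normed_vector \<Rightarrow> 'f::real_normed_vector) \<Rightarrow> 'e set \<Rightarrow> bool" where
  "Ck_on 0 f S \<longleftrightarrow> continuous_on S f"
| "Ck_on (Suc k) f S \<longleftrightarrow>
     (\<forall>x\<in>S. f differentiable (at x)) \<and> (\<forall>v. Ck_on k (\<lambda>x. frechet_derivative f (at x) v) S)"

(* Only used for open S. *)
definition smooth_on :: "('e::real_normed_vector \<Rightarrow> 'f::real_normed_vector) \<Rightarrow> 'e set \<Rightarrow> bool" where
  "smooth_on f S \<longleftrightarrow> (\<forall>k. Ck_on k f S)"

type_synonym ('a, 'n) chart = "'a set \<times> ('a \<Rightarrow> real ^ 'n)"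

definition is_chart :: "('a::topological_space, 'n::finite) chart \<Rightarrow> bool" where
  "is_chart c \<longleftrightarrow> open (fst c) \<and> open (snd c ` fst c) \<and>
     homeomorphism (fst c) (snd c ` fst c) (snd c) (inv_into (fst c) (snd c))"

definition transition :: "('a, 'n::finite) chart \<Rightarrow> ('a, 'n) chart \<Rightarrow> real ^ 'n \<Rightarrow> real ^ 'n" where
  "transition c d = snd d \<circ> inv_into (fst c) (snd c)"

definition overlap :: "('a, 'n::finite) chart \<Rightarrow> ('a, 'n) chart \<Rightarrow> (real ^ 'n) set" where
  "overlap c d = snd c ` (fst c \<inter> fst d)"

definition compatible :: "('a, 'n::finite) chart \<Rightarrow> ('a, 'n) chart \<Rightarrow> bool" where
  "compatible c d \<longleftrightarrow>
     smooth_on (transition c d) (overlap c d) \<and> smooth_on (transition d c) (overlap d c)"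

(* The manifold is the whole type; Hausdorff and second countable are provided by type classes. *)
definition smooth_atlas ::
    "('a::{t2_space, second_countable_topology}, 'n::finite) chart set \<Rightarrow> bool" where
  "smooth_atlas A \<longleftrightarrow>
     (\<forall>c\<in>A. is_chart c) \<and> (\<Union>c\<in>A. fst c) = UNIV \<and> (\<forall>c\<in>A. \<forall>d\<in>A. compatible c d)"

definition orientable ::
    "('a::{t2_space, second_countable_topology}, 'n::finite) chart set \<Rightarrow> bool" where
  "orientable A \<longleftrightarrow>
     (\<exists>B. smooth_atlas B \<and> (\<forall>c\<in>A. \<forall>d\<in>B. compatible c d) \<and>
          (\<forall>c\<in>B. \<forall>d\<in>B. \<forall>x\<in>overlap c d.
             det (matrix (frechet_derivative (transition c d) (at x))) > 0))"

definition smooth_fun :: "('a, 'n::finite) chart set \<Rightarrow> ('a \<Rightarrow> real) \<Rightarrow> bool" where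
  "smooth_fun A f \<longleftrightarrow> (\<forall>c\<in>A. smooth_on (f \<circ> inv_into (fst c) (snd c)) (snd c ` fst c))"


section \<open>Tangent vectors, vector fields and 1-forms\<close>

(* Tangent vectors are derivations of the algebra of smooth functions; the value 0 on non-smooth
   functions makes the representation unique.  Complex tangent vectors are kept as complex-valued
   derivations on real functions, i.e. x + i y with x, y real tangent vectors. *)
type_synonym 'a tvec = "('a \<Rightarrow> real) \<Rightarrow> real"
type_synonym 'a ctvec = "('a \<Rightarrow> real) \<Rightarrow> complex"
type_synonym 'a vfield = "'a \<Rightarrow> 'a tvec"
type_synonym 'a cvfield = "'a \<Rightarrow> 'a ctvec"

definition tangent_space :: "('a, 'n::finite) chart set \<Rightarrow> 'a \<Rightarrow> 'a tvec set" where
  "tangent_space A p = {v.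
     (\<forall>f. \<not> smooth_fun A f \<longrightarrow> v f = 0) \<and>
     (\<forall>f g a b. smooth_fun A f \<longrightarrow> smooth_fun A g \<longrightarrow>
        v (\<lambda>q. a * f q + b * g q) = a * v f + b * v g) \<and>
     (\<forall>f g. smooth_fun A f \<longrightarrow> smooth_fun A g \<longrightarrow>
        v (\<lambda>q. f q * g q) = v f * g p + f p * v g)}"

definition vector_field :: "('a, 'n::finite) chart set \<Rightarrow> 'a vfield \<Rightarrow> bool" where
  "vector_field A X \<longleftrightarrow>
     (\<forall>p. X p \<in> tangent_space A p) \<and> (\<forall>f. smooth_fun A f \<longrightarrow> smooth_fun A (\<lambda>p. X p f))"

definition bracket :: "'a vfield \<Rightarrow> 'a vfield \<Rightarrow> 'a vfield" where
  "bracket X Y = (\<lambda>p f. X p (\<lambda>q. Y q f) - Y p (\<lambda>q. X q f))"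

definition re_field :: "'a cvfield \<Rightarrow> 'a vfield" where
  "re_field Z = (\<lambda>p f. Re (Z p f))"

definition im_field :: "'a cvfield \<Rightarrow> 'a vfield" where
  "im_field Z = (\<lambda>p f. Im (Z p f))"

definition cvector_field :: "('a, 'n::finite) chart set \<Rightarrow> 'a cvfield \<Rightarrow> bool" where
  "cvector_field A Z \<longleftrightarrow> vector_field A (re_field Z) \<and> vector_field A (im_field Z)"

(* Complex-bilinear extension of an operation on real vector fields. *)
definition cext :: "('a vfield \<Rightarrow> 'a vfield \<Rightarrow> 'a vfield) \<Rightarrow> 'a cvfield \<Rightarrow> 'a cvfield \<Rightarrow> 'a cvfield" where
  "cext B Z W = (\<lambda>p f. Complex
     (B (re_field Z) (re_field W) p f - B (im_field Z) (im_field W) p f)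
     (B (re_field Z) (im_field W) p f + B (im_field Z) (re_field W) p f))"

definition ctsection :: "('a, 'n::finite) chart set \<Rightarrow> ('a \<Rightarrow> 'a ctvec set) \<Rightarrow> 'a cvfield \<Rightarrow> bool" where
  "ctsection A E Z \<longleftrightarrow> cvector_field A Z \<and> (\<forall>p. Z p \<in> E p)"

definition cconj :: "'a ctvec \<Rightarrow> 'a ctvec" where
  "cconj w = (\<lambda>f. cnj (w f))"

(* Local frames are taken from global fields: a local frame near p can be cut off by a bump
   function without changing it near p. *)
definition complex_subbundle ::
    "nat \<Rightarrow> ('a::topological_space, 'n::finite) chart set \<Rightarrow> ('a \<Rightarrow> 'a ctvec set) \<Rightarrow> bool" where
  "complex_subbundle m A E \<longleftrightarrow>
     (\<forall>p. \<exists>U Z. open U \<and> p \<in> U \<and> (\<forall>i<m. cvector_field A (Z i)) \<and>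
        (\<forall>q\<in>U. E q = {\<lambda>f. \<Sum>i<m. c i * Z i q f | c. True} \<and>
          (\<forall>c. (\<forall>f. (\<Sum>i<m. c i * Z i q f) = 0) \<longrightarrow> (\<forall>i<m. c i = 0))))"

definition one_form :: "('a, 'n::finite) chart set \<Rightarrow> ('a \<Rightarrow> 'a tvec \<Rightarrow> real) \<Rightarrow> bool" where
  "one_form A \<theta> \<longleftrightarrow>
     (\<forall>p. \<forall>x\<in>tangent_space A p. \<forall>y\<in>tangent_space A p. \<forall>a b.
        \<theta> p (\<lambda>f. a * x f + b * y f) = a * \<theta> p x + b * \<theta> p y) \<and>
     (\<forall>X. vector_field A X \<longrightarrow> smooth_fun A (\<lambda>p. \<theta> p (X p)))"

definition dform :: "('a \<Rightarrow> 'a tvec \<Rightarrow> real) \<Rightarrow> 'a vfield \<Rightarrow> 'a vfield \<Rightarrow> 'a \<Rightarrow> real" where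
  "dform \<theta> X Y p =
     (X p (\<lambda>q. \<theta> q (Y q)) - Y p (\<lambda>q. \<theta> q (X q)) - \<theta> p (bracket X Y p)) / 2"

(* Used to evaluate tensors given on vector fields at tangent vectors; by tensoriality the value
   does not depend on the extension. *)
definition ext_field :: "('a, 'n::finite) chart set \<Rightarrow> 'a \<Rightarrow> 'a tvec \<Rightarrow> 'a vfield" where
  "ext_field A p x = (SOME X. vector_field A X \<and> X p = x)"


section \<open>CR structures and pseudo-Hermitian forms\<close>

record ('a, 'n) psh =
  charts :: "('a, 'n) chart set"
  H10 :: "'a \<Rightarrow> 'a ctvec set"
  theta :: "'a \<Rightarrow> 'a tvec \<Rightarrow> real"

abbreviation tangent :: "('a, 'n::finite) psh \<Rightarrow> 'a \<Rightarrow> 'a tvec set" where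
  "tangent M p \<equiv> tangent_space (charts M) p"

abbreviation field_on :: "('a, 'n::finite) psh \<Rightarrow> 'a vfield \<Rightarrow> bool" where
  "field_on M X \<equiv> vector_field (charts M) X"

definition H01 :: "('a, 'n::finite) psh \<Rightarrow> 'a \<Rightarrow> 'a ctvec set" where
  "H01 M p = cconj ` H10 M p"

definition cr_manifold ::
    "nat \<Rightarrow> ('a::{t2_space, second_countable_topology}, 'n::finite) psh \<Rightarrow> bool" where
  "cr_manifold m M \<longleftrightarrow>
     CARD('n) = 2 * m + 1 \<and> smooth_atlas (charts M) \<and> orientable (charts M) \<and>
     complex_subbundle m (charts M) (H10 M) \<and>
     (\<forall>p. H10 M p \<inter> H01 M p = {\<lambda>f. 0}) \<and>
     (\<forall>Z W. ctsection (charts M) (H10 M) Z \<longrightarrow> ctsection (charts M) (H10 M) W \<longrightarrow>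
        ctsection (charts M) (H10 M) (cext bracket Z W))"

definition Hor :: "('a, 'n::finite) psh \<Rightarrow> 'a \<Rightarrow> 'a tvec set" where
  "Hor M p = {\<lambda>f. Re (z f + w f) | z w. z \<in> H10 M p \<and> w \<in> H01 M p}"

definition Jb :: "('a, 'n::finite) psh \<Rightarrow> 'a \<Rightarrow> 'a tvec \<Rightarrow> 'a tvec" where
  "Jb M p x = (THE y. \<exists>z\<in>H10 M p. \<forall>f.
     complex_of_real (x f) = z f + cconj z f \<and> complex_of_real (y f) = \<i> * (z f - cconj z f))"

definition dtheta :: "('a, 'n::finite) psh \<Rightarrow> 'a \<Rightarrow> 'a tvec \<Rightarrow> 'a tvec \<Rightarrow> real" where
  "dtheta M p x y = dform (theta M) (ext_field (charts M) p x) (ext_field (charts M) p y) p"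

definition levi :: "('a, 'n::finite) psh \<Rightarrow> 'a \<Rightarrow> 'a tvec \<Rightarrow> 'a tvec \<Rightarrow> real" where
  "levi M p x y = dtheta M p x (Jb M p y)"

definition pseudohermitian_form :: "('a, 'n::finite) psh \<Rightarrow> bool" where
  "pseudohermitian_form M \<longleftrightarrow>
     one_form (charts M) (theta M) \<and>
     (\<forall>p. \<exists>x\<in>tangent M p. theta M p x \<noteq> 0) \<and>
     (\<forall>p. {x \<in> tangent M p. theta M p x = 0} = Hor M p)"

definition levi_positive :: "('a, 'n::finite) psh \<Rightarrow> bool" where
  "levi_positive M \<longleftrightarrow> (\<forall>p. \<forall>x\<in>Hor M p. x \<noteq> (\<lambda>f. 0) \<longrightarrow> levi M p x x > 0)"

definition reeb_field :: "('a, 'n::finite) psh \<Rightarrow> 'a vfield \<Rightarrow> bool" where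
  "reeb_field M \<xi> \<longleftrightarrow>
     field_on M \<xi> \<and> (\<forall>p. theta M p (\<xi> p) = 1) \<and>
     (\<forall>X p. field_on M X \<longrightarrow> dform (theta M) \<xi> X p = 0)"

(* The projection onto Hor = ker theta along the Reeb field. *)
definition proj_H :: "('a, 'n::finite) psh \<Rightarrow> 'a vfield \<Rightarrow> 'a \<Rightarrow> 'a tvec \<Rightarrow> 'a tvec" where
  "proj_H M \<xi> p x = (\<lambda>f. x f - theta M p x * \<xi> p f)"

definition Jend :: "('a, 'n::finite) psh \<Rightarrow> 'a vfield \<Rightarrow> 'a \<Rightarrow> 'a tvec \<Rightarrow> 'a tvec" where
  "Jend M \<xi> p x = Jb M p (proj_H M \<xi> p x)"

definition webster :: "('a, 'n::finite) psh \<Rightarrow> 'a vfield \<Rightarrow> 'a \<Rightarrow> 'a tvec \<Rightarrow> 'a tvec \<Rightarrow> real" where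
  "webster M \<xi> p x y =
     levi M p (proj_H M \<xi> p x) (proj_H M \<xi> p y) + theta M p x * theta M p y"


section \<open>The canonical connection and Sasakian manifolds\<close>

type_synonym 'a connection = "'a vfield \<Rightarrow> 'a vfield \<Rightarrow> 'a vfield"

definition linear_connection :: "('a, 'n::finite) chart set \<Rightarrow> 'a connection \<Rightarrow> bool" where
  "linear_connection A D \<longleftrightarrow>
     (\<forall>X Y. vector_field A X \<longrightarrow> vector_field A Y \<longrightarrow> vector_field A (D X Y)) \<and>
     (\<forall>X X' Y f g. vector_field A X \<longrightarrow> vector_field A X' \<longrightarrow> vector_field A Y \<longrightarrow>
        smooth_fun A f \<longrightarrow> smooth_fun A g \<longrightarrow>
        D (\<lambda>p h. f p * X p h + g p * X' p h) Y = (\<lambda>p h. f p * D X Y p h + g p * D X' Y p h)) \<and>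
     (\<forall>X Y Y'. vector_field A X \<longrightarrow> vector_field A Y \<longrightarrow> vector_field A Y' \<longrightarrow>
        D X (\<lambda>p h. Y p h + Y' p h) = (\<lambda>p h. D X Y p h + D X Y' p h)) \<and>
     (\<forall>X Y f. vector_field A X \<longrightarrow> vector_field A Y \<longrightarrow> smooth_fun A f \<longrightarrow>
        D X (\<lambda>p h. f p * Y p h) = (\<lambda>p h. X p f * Y p h + f p * D X Y p h))"

definition torsion :: "'a connection \<Rightarrow> 'a connection" where
  "torsion D X Y = (\<lambda>p f. D X Y p f - D Y X p f - bracket X Y p f)"

definition Creeb :: "'a vfield \<Rightarrow> 'a \<Rightarrow> 'a ctvec set" where
  "Creeb \<xi> p = {\<lambda>f. c * complex_of_real (\<xi> p f) | c. True}"

definition preserves ::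
    "('a, 'n::finite) chart set \<Rightarrow> 'a connection \<Rightarrow> ('a \<Rightarrow> 'a ctvec set) \<Rightarrow> bool" where
  "preserves A D E \<longleftrightarrow>
     (\<forall>Z W. cvector_field A Z \<longrightarrow> ctsection A E W \<longrightarrow> ctsection A E (cext D Z W))"

definition proj_plus :: "('a, 'n::finite) psh \<Rightarrow> 'a vfield \<Rightarrow> 'a \<Rightarrow> 'a ctvec \<Rightarrow> 'a ctvec" where
  "proj_plus M \<xi> p u = (THE z. z \<in> H10 M p \<and>
     (\<exists>w\<in>H01 M p. \<exists>r\<in>Creeb \<xi> p. u = (\<lambda>f. z f + w f + r f)))"

definition parallel_metric ::
    "('a, 'n::finite) chart set \<Rightarrow> 'a connection \<Rightarrow> ('a \<Rightarrow> 'a tvec \<Rightarrow> 'a tvec \<Rightarrow> real) \<Rightarrow> bool" where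
  "parallel_metric A D g \<longleftrightarrow>
     (\<forall>X Y Z p. vector_field A X \<longrightarrow> vector_field A Y \<longrightarrow> vector_field A Z \<longrightarrow>
        X p (\<lambda>q. g q (Y q) (Z q)) = g p (D X Y p) (Z p) + g p (Y p) (D X Z p))"

definition tau :: "'a vfield \<Rightarrow> 'a connection \<Rightarrow> 'a vfield \<Rightarrow> 'a vfield" where
  "tau \<xi> D X = torsion D \<xi> X"

definition sigma_tau :: "('a, 'n::finite) psh \<Rightarrow> 'a vfield \<Rightarrow> 'a connection \<Rightarrow> 'a vfield \<Rightarrow> 'a vfield" where
  "sigma_tau M \<xi> D X = (\<lambda>p f. tau \<xi> D (\<lambda>q. Jend M \<xi> q (X q)) p f + Jend M \<xi> p (tau \<xi> D X p) f)"

definition canonical_connection :: "('a, 'n::finite) psh \<Rightarrow> 'a vfield \<Rightarrow> 'a connection \<Rightarrow> bool" where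
  "canonical_connection M \<xi> D \<longleftrightarrow>
     linear_connection (charts M) D \<and>
     preserves (charts M) D (H10 M) \<and> preserves (charts M) D (H01 M) \<and>
     preserves (charts M) D (Creeb \<xi>) \<and>
     parallel_metric (charts M) D (webster M \<xi>) \<and>
     (\<forall>Z W p. ctsection (charts M) (H10 M) Z \<longrightarrow> ctsection (charts M) (H10 M) W \<longrightarrow>
        proj_plus M \<xi> p (cext (torsion D) Z (\<lambda>q. cconj (W q)) p) = (\<lambda>f. 0)) \<and>
     (\<forall>X Y p. field_on M X \<longrightarrow> field_on M Y \<longrightarrow>
        webster M \<xi> p (sigma_tau M \<xi> D X p) (Y p) = - webster M \<xi> p (X p) (sigma_tau M \<xi> D Y p))"

(* The Reeb field and the canonical connection, both uniquely determined by M, are carried along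
   as parameters constrained by their characterizing properties. *)
definition sasakian ::
    "nat \<Rightarrow> ('a::{t2_space, second_countable_topology}, 'n::finite) psh \<Rightarrow>
     'a vfield \<Rightarrow> 'a connection \<Rightarrow> bool" where
  "sasakian m M \<xi> D \<longleftrightarrow>
     cr_manifold m M \<and> pseudohermitian_form M \<and> levi_positive M \<and>
     reeb_field M \<xi> \<and> canonical_connection M \<xi> D \<and>
     (\<forall>X p. field_on M X \<longrightarrow> tau \<xi> D X p = (\<lambda>f. 0))"


section \<open>Curvature\<close>

definition curvature :: "'a connection \<Rightarrow> 'a vfield \<Rightarrow> 'a vfield \<Rightarrow> 'a vfield \<Rightarrow> 'a vfield" where
  "curvature D X Y Z =
     (\<lambda>p f. D X (D Y Z) p f - D Y (D X Z) p f - D (bracket X Y) Z p f)"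

definition curv ::
    "('a, 'n::finite) psh \<Rightarrow> 'a connection \<Rightarrow> 'a \<Rightarrow> 'a tvec \<Rightarrow> 'a tvec \<Rightarrow> 'a tvec \<Rightarrow> 'a tvec" where
  "curv M D p x y z =
     curvature D (ext_field (charts M) p x) (ext_field (charts M) p y) (ext_field (charts M) p z) p"

definition J_plane :: "('a, 'n::finite) psh \<Rightarrow> 'a \<Rightarrow> 'a tvec set \<Rightarrow> bool" where
  "J_plane M p P \<longleftrightarrow> P \<subseteq> Hor M p \<and> Jb M p ` P \<subseteq> P \<and>
     (\<exists>x y. P = {\<lambda>f. a * x f + b * y f | a b. True} \<and>
        (\<forall>a b. (\<lambda>f. a * x f + b * y f) = (\<lambda>f. 0) \<longrightarrow> a = 0 \<and> b = 0))"

definition orthonormal_basis ::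
    "('a, 'n::finite) psh \<Rightarrow> 'a vfield \<Rightarrow> 'a \<Rightarrow> 'a tvec set \<Rightarrow> 'a tvec \<Rightarrow> 'a tvec \<Rightarrow> bool" where
  "orthonormal_basis M \<xi> p P e1 e2 \<longleftrightarrow>
     P = {\<lambda>f. a * e1 f + b * e2 f | a b. True} \<and>
     webster M \<xi> p e1 e1 = 1 \<and> webster M \<xi> p e2 e2 = 1 \<and> webster M \<xi> p e1 e2 = 0"

definition psh_sect_curv ::
    "('a, 'n::finite) psh \<Rightarrow> 'a vfield \<Rightarrow> 'a connection \<Rightarrow> 'a \<Rightarrow> 'a tvec set \<Rightarrow> real" where
  "psh_sect_curv M \<xi> D p P = (THE k. \<forall>e1 e2. orthonormal_basis M \<xi> p P e1 e2 \<longrightarrow>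
     k = webster M \<xi> p (curv M D p e1 e2 e2) e1)"


section \<open>Pointwise isomorphisms\<close>

(* Linear isomorphisms T_p M -> T_p' M' carrying (theta, J, L_theta) at p to that at p'. *)
definition psh_iso_at ::
    "('a, 'n::finite) psh \<Rightarrow> 'a vfield \<Rightarrow> 'a \<Rightarrow> ('b, 'n) psh \<Rightarrow> 'b vfield \<Rightarrow> 'b \<Rightarrow>
     ('a tvec \<Rightarrow> 'b tvec) \<Rightarrow> bool" where
  "psh_iso_at M \<xi> p M' \<xi>' p' \<Phi> \<longleftrightarrow>
     bij_betw \<Phi> (tangent M p) (tangent M' p') \<and>
     (\<forall>x\<in>tangent M p. \<forall>y\<in>tangent M p. \<forall>a b.
        \<Phi> (\<lambda>f. a * x f + b * y f) = (\<lambda>f. a * \<Phi> x f + b * \<Phi> y f)) \<and>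
     (\<forall>x\<in>tangent M p. theta M' p' (\<Phi> x) = theta M p x) \<and>
     (\<forall>x\<in>tangent M p. Jend M' \<xi>' p' (\<Phi> x) = \<Phi> (Jend M \<xi> p x)) \<and>
     (\<forall>x\<in>Hor M p. \<forall>y\<in>Hor M p. levi M' p' (\<Phi> x) (\<Phi> y) = levi M p x y)"

end

theory Submission
  imports Defs "HOL-Library.Function_Algebras"
begin

text \<open>
  On the contact distribution \<open>H\<close> the curvature tensor of a Sasakian manifold has all the symmetries of a
  Kaehler curvature tensor, and it vanishes as soon as one argument is the Reeb vector. A tensor with
  the symmetries of a Kaehler curvature tensor is determined by its values \<open>R(x, Jx, Jx, x)\<close>, by
  polarization; for a unit vector \<open>x\<close> of \<open>H\<close> this value is the pseudo-Hermitian sectional curvature of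
  the plane spanned by \<open>x\<close> and \<open>Jx\<close>. So the difference between the curvature tensor at \<open>p\<close> and the
  pullback along \<open>\<Phi>\<close> of the one at \<open>p'\<close> is zero (lemma \<open>curvature_determined\<close>).

  The symmetries come from the torsion. The canonical connection \<open>D\<close> satisfies \<open>D \<xi> = 0\<close> and commutes
  with \<open>J\<close>, and in the Sasakian case its torsion is \<open>T(X, Y) = 2 d\<theta>(X, Y) \<xi>\<close> (lemma \<open>torsion_eq\<close>).
  Hence the cyclic sum of \<open>R(X, Y) Z\<close> is the Jacobi sum plus a multiple of \<open>\<xi>\<close> that is zero because
  \<open>d\<theta>\<close> is closed: the first Bianchi identity holds without a torsion term (lemma \<open>Rf_bianchi\<close>).
  Since the metric is parallel, \<open>\<langle>R(x, y) z, u\<rangle>\<close> is also skew in the last pair, so it is symmetric under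
  exchange of the pairs, and \<open>R(x, y) \<xi> = 0\<close> forces \<open>R(\<xi>, x) = 0\<close>.

  The torsion formula says that the horizontal part \<open>TH\<close> of the torsion vanishes on horizontal fields.
  The condition on the mixed components gives \<open>TH(JX, Y) = TH(X, JY)\<close>, and together with the
  integrability of the CR structure it makes \<open>TH\<close> complex bilinear. As \<open>d\<theta>\<close> is closed and parallel, the
  cyclic sum of \<open>d\<theta>(TH(X, Y), Z)\<close> is zero; comparing this identity with \<open>J\<close> inserted in different
  arguments gives \<open>TH = 0\<close> (lemma \<open>TH_zero\<close>).

  All of this is a computation with global vector fields, and it has to be known that the results depend
  only on values at a point. Instead of cut-off functions the proof uses Cramer's rule: if the global
  fields \<open>E\<^sub>j\<close> form a basis at \<open>p\<close> and \<open>d = det (E\<^sub>j f\<^sub>k)\<close> for suitable functions \<open>f\<^sub>k\<close>, then \<open>d\<^sup>2 X\<close> is on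
  the whole manifold a combination of the \<open>E\<^sub>j\<close> with smooth coefficients, which vanish at \<open>p\<close> if \<open>X\<close> does
  (lemmas \<open>frame_expansion\<close> and \<open>tensor_at\<close>).
\<close>


section \<open>Pointwise real vector space structure on functions\<close>

text \<open>
  Tangent vectors and vector fields are functions; with the pointwise operations they become elements of a real vector
  space, so that span and linear independence are available for them.
\<close>

instantiation "fun" :: (type, real_vector) real_vector
begin

definition scaleR_fun_def: "scaleR a f = (\<lambda>x. a *\<^sub>R f x)"

instance
  by standard (auto simp: fun_eq_iff scaleR_fun_def algebra_simps)

end

lemma scaleR_fun_apply [simp]: "(a *\<^sub>R f) x = a *\<^sub>R f x"
  by (simp add: scaleR_fun_def)

lemma sum_fun_apply [simp]: "(\<Sum>i\<in>I. f i) x = (\<Sum>i\<in>I. f i x)"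
  by (induction I rule: infinite_finite_induct) auto


section \<open>The algebra of smooth functions\<close>

text \<open>
  On an open set the derivative at a point is determined by nearby values, all of which are taken in the set.
\<close>

lemma Ck_on_cong:
  assumes "open S" "\<And>x. x \<in> S \<Longrightarrow> f x = g x"
  shows "Ck_on k f S \<longleftrightarrow> Ck_on k g S"
  using assms(2)
proof (induction k arbitrary: f g)
  case 0
  then show ?case by (auto cong: continuous_on_cong)
next
  case (Suc k)
  have diff: "f differentiable (at x) \<longleftrightarrow> g differentiable (at x)" if "x \<in> S" for x
    using has_derivative_transform_within_open[OF _ assms(1) that] Suc.prems
    unfolding differentiable_def by metis
  have der: "frechet_derivative f (at x) v = frechet_derivative g (at x) v"
    if "x \<in> S" "f differentiable (at x)" for x v
    using frechet_derivative_transform_within_open[OF that(2) assms(1) that(1)] Suc.prems by metis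
  show ?case
  proof (cases "\<forall>x\<in>S. f differentiable (at x)")
    case True
    then show ?thesis
      using diff Suc.IH[of "\<lambda>x. frechet_derivative f (at x) _" "\<lambda>x. frechet_derivative g (at x) _"] der
      by auto
  next
    case False
    then show ?thesis using diff by auto
  qed
qed

lemma Ck_on_SucD: "Ck_on (Suc k) f S \<Longrightarrow> Ck_on k f S"
proof (induction k arbitrary: f)
  case 0
  then show ?case
    by (auto intro!: differentiable_imp_continuous_on differentiable_at_imp_differentiable_on)
next
  case (Suc k)
  have f: "\<forall>x\<in>S. f differentiable (at x)" "\<And>v. Ck_on (Suc k) (\<lambda>x. frechet_derivative f (at x) v) S"
    using Suc.prems by (subst (asm) Ck_on.simps(2), blast)+
  show ?case
    using f(1) Suc.IH[OF f(2)] by simp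
qed

lemma Ck_on_subset: "Ck_on k f S \<Longrightarrow> T \<subseteq> S \<Longrightarrow> Ck_on k f T"
  by (induction k arbitrary: f) (auto intro: continuous_on_subset)

lemma Ck_on_const: "Ck_on k (\<lambda>x. c) S"
  by (induction k arbitrary: c) auto

text \<open>
  Derivatives computed by the usual rules may replace the chosen \<open>frechet_derivative\<close>.
\<close>

lemma Ck_on_SucI:
  assumes "open S" "\<And>x. x \<in> S \<Longrightarrow> (f has_derivative f' x) (at x)"
    and "\<And>v. Ck_on k (\<lambda>x. f' x v) S"
  shows "Ck_on (Suc k) f S"
proof -
  have "f' x v = frechet_derivative f (at x) v" if "x \<in> S" for x v
    using frechet_derivative_at[OF assms(2)[OF that]] by simp
  then have "Ck_on k (\<lambda>x. frechet_derivative f (at x) v) S" for v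
    using assms(3)[of v] Ck_on_cong[OF assms(1), of "\<lambda>x. f' x v" "\<lambda>x. frechet_derivative f (at x) v"]
    by simp
  then show ?thesis using assms(2) by (auto simp: differentiable_def)
qed

lemma Ck_on_SucE:
  assumes "Ck_on (Suc k) f S"
  shows "\<And>x. x \<in> S \<Longrightarrow> (f has_derivative frechet_derivative f (at x)) (at x)"
    and "\<And>v. Ck_on k (\<lambda>x. frechet_derivative f (at x) v) S"
  using assms frechet_derivative_works by auto

lemma Ck_on_add:
  assumes "open S" "Ck_on k f S" "Ck_on k g S"
  shows "Ck_on k (\<lambda>x. f x + g x) S"
  using assms(2,3)
proof (induction k arbitrary: f g)
  case 0
  then show ?case by (auto intro: continuous_intros)
next
  case (Suc k)
  note f = Ck_on_SucE[OF Suc.prems(1)] and g = Ck_on_SucE[OF Suc.prems(2)]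
  show ?case
    by (rule Ck_on_SucI[OF assms(1) has_derivative_add[OF f(1) g(1)] Suc.IH[OF f(2) g(2)]])
qed

lemma Ck_on_mult:
  fixes f g :: "'e::real_normed_vector \<Rightarrow> real"
  assumes "open S" "Ck_on k f S" "Ck_on k g S"
  shows "Ck_on k (\<lambda>x. f x * g x) S"
  using assms(2,3)
proof (induction k arbitrary: f g)
  case 0
  then show ?case by (auto intro: continuous_intros)
next
  case (Suc k)
  note f = Ck_on_SucE[OF Suc.prems(1)] and g = Ck_on_SucE[OF Suc.prems(2)]
  show ?case
    by (rule Ck_on_SucI[OF assms(1) has_derivative_mult[OF f(1) g(1)]
          Ck_on_add[OF assms(1) Suc.IH[OF Ck_on_SucD[OF Suc.prems(1)] g(2)]
            Suc.IH[OF f(2) Ck_on_SucD[OF Suc.prems(2)]]]])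
qed

lemma Ck_on_inverse:
  fixes f :: "'e::real_normed_vector \<Rightarrow> real"
  assumes "open S" "Ck_on k f S" "\<And>x. x \<in> S \<Longrightarrow> f x \<noteq> 0"
  shows "Ck_on k (\<lambda>x. inverse (f x)) S"
  using assms(2,3)
proof (induction k arbitrary: f)
  case 0
  then show ?case by (auto intro: continuous_intros)
next
  case (Suc k)
  note f = Ck_on_SucE[OF Suc.prems(1)]
  have inv: "Ck_on k (\<lambda>x. inverse (f x)) S"
    using Suc.IH[OF Ck_on_SucD[OF Suc.prems(1)] Suc.prems(2)] .
  show ?case
  proof (rule Ck_on_SucI[OF assms(1)])
    show "((\<lambda>x. inverse (f x)) has_derivative
        (\<lambda>v. (-1) * (inverse (f x) * frechet_derivative f (at x) v * inverse (f x)))) (at x)"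
      if "x \<in> S" for x
      using Deriv.has_derivative_inverse[OF Suc.prems(2)[OF that] f(1)[OF that]] by simp
    show "Ck_on k (\<lambda>x. (-1) * (inverse (f x) * frechet_derivative f (at x) v * inverse (f x))) S" for v
      by (intro Ck_on_mult Ck_on_const assms(1) inv f(2))
  qed
qed

lemma Ck_on_local:
  assumes "\<And>x. x \<in> S \<Longrightarrow> \<exists>T. open T \<and> x \<in> T \<and> T \<subseteq> S \<and> Ck_on k f T"
  shows "Ck_on k f S"
  using assms
proof (induction k arbitrary: f)
  case 0
  have "continuous (at x within S) f" if "x \<in> S" for x
  proof -
    obtain T where "open T" "x \<in> T" "continuous_on T f"
      using 0[OF \<open>x \<in> S\<close>] by auto
    then show ?thesis
      using continuous_on_eq_continuous_at continuous_at_imp_continuous_at_within by blast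
  qed
  then show ?case by (simp add: continuous_on_eq_continuous_within)
next
  case (Suc k)
  have "f differentiable (at x)" if "x \<in> S" for x
    using Suc.prems[OF that] by auto
  moreover have "Ck_on k (\<lambda>x. frechet_derivative f (at x) v) S" for v
  proof (rule Suc.IH)
    fix x assume "x \<in> S"
    then show "\<exists>T. open T \<and> x \<in> T \<and> T \<subseteq> S \<and> Ck_on k (\<lambda>x. frechet_derivative f (at x) v) T"
      using Suc.prems[of x] by (metis Ck_on.simps(2))
  qed
  ultimately show ?case by simp
qed

locale smooth_manifold =
  fixes A :: "('a::{t2_space, second_countable_topology}, 'n::finite) chart set"
  assumes atlas: "smooth_atlas A"
begin

lemma chart_inverse:
  assumes "c \<in> A"
  shows "open (snd c ` fst c)" "open (fst c)"
    "continuous_on (snd c ` fst c) (inv_into (fst c) (snd c))"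
    "continuous_on (fst c) (snd c)"
    "\<And>q. q \<in> fst c \<Longrightarrow> inv_into (fst c) (snd c) (snd c q) = q"
  using atlas assms unfolding smooth_atlas_def is_chart_def homeomorphism_def by auto

lemma smooth_const: "smooth_fun A (\<lambda>q. r)"
  unfolding smooth_fun_def smooth_on_def by (simp add: comp_def Ck_on_const)

lemma smooth_add: "smooth_fun A f \<Longrightarrow> smooth_fun A g \<Longrightarrow> smooth_fun A (\<lambda>q. f q + g q)"
  using chart_inverse(1) unfolding smooth_fun_def smooth_on_def by (auto simp: comp_def intro!: Ck_on_add)

lemma smooth_mult: "smooth_fun A f \<Longrightarrow> smooth_fun A g \<Longrightarrow> smooth_fun A (\<lambda>q. f q * g q)"
  using chart_inverse(1) unfolding smooth_fun_def smooth_on_def by (auto simp: comp_def intro!: Ck_on_mult)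

lemma smooth_minus: "smooth_fun A f \<Longrightarrow> smooth_fun A (\<lambda>q. - f q)"
  using smooth_mult[OF smooth_const[of "-1"]] by simp

lemma smooth_diff: "smooth_fun A f \<Longrightarrow> smooth_fun A g \<Longrightarrow> smooth_fun A (\<lambda>q. f q - g q)"
  using smooth_add[OF _ smooth_minus] by simp

lemma smooth_sum:
  "(\<And>i. i \<in> I \<Longrightarrow> smooth_fun A (f i)) \<Longrightarrow> smooth_fun A (\<lambda>q. \<Sum>i\<in>I. f i q)"
  by (induction I rule: infinite_finite_induct) (auto intro: smooth_const smooth_add)

lemma smooth_prod:
  "(\<And>i. i \<in> I \<Longrightarrow> smooth_fun A (f i)) \<Longrightarrow> smooth_fun A (\<lambda>q. \<Prod>i\<in>I. f i q)"
  by (induction I rule: infinite_finite_induct) (auto intro: smooth_const smooth_mult)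

lemmas smooth_intros = smooth_const smooth_add smooth_mult smooth_minus smooth_diff smooth_sum
  smooth_prod

lemma smooth_det:
  fixes G :: "'a \<Rightarrow> real ^ 'k ^ 'k"
  assumes "\<And>i j. smooth_fun A (\<lambda>q. G q $ i $ j)"
  shows "smooth_fun A (\<lambda>q. det (G q))"
  unfolding det_def by (intro smooth_intros assms)

text \<open>
  This applies to functions that are known through an expansion in a frame: its coefficients are, by Cramer, quotients
  of smooth functions near each point.
\<close>

lemma smooth_locally_quotient:
  assumes "\<And>p. \<exists>U u v. open U \<and> p \<in> U \<and> smooth_fun A u \<and> smooth_fun A v \<and> v p \<noteq> 0 \<and>
    (\<forall>q\<in>U. v q * f q = u q)"
  shows "smooth_fun A f"
  unfolding smooth_fun_def smooth_on_def
proof (intro ballI allI Ck_on_local)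
  fix c k x
  assume c: "c \<in> A" and "x \<in> snd c ` fst c"
  then obtain p where p: "p \<in> fst c" "x = snd c p" by blast
  let ?i = "inv_into (fst c) (snd c)" and ?S = "snd c ` fst c"
  obtain U u v where U: "open U" "p \<in> U" "smooth_fun A u" "smooth_fun A v" "v p \<noteq> 0"
    "\<And>q. q \<in> U \<Longrightarrow> v q * f q = u q"
    using assms by metis
  have uv: "Ck_on k (v \<circ> ?i) ?S" "Ck_on k (u \<circ> ?i) ?S" for k
    using U(3,4) c unfolding smooth_fun_def smooth_on_def by auto
  have "continuous_on ?S (v \<circ> ?i)" using uv(1)[of 0] by simp
  then have op1: "open ((v \<circ> ?i) -` (- {0}) \<inter> ?S)"
    using chart_inverse(1)[OF c] continuous_on_open_vimage by blast
  have op2: "open (?i -` U \<inter> ?S)"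
    using chart_inverse(1,3)[OF c] U(1) continuous_on_open_vimage by blast
  define T where "T = ((v \<circ> ?i) -` (- {0}) \<inter> ?S) \<inter> (?i -` U \<inter> ?S)"
  have T: "open T" "x \<in> T" "T \<subseteq> ?S"
    unfolding T_def using op1 op2 p chart_inverse(5)[OF c p(1)] U by auto
  have nz: "(v \<circ> ?i) y \<noteq> 0" if "y \<in> T" for y
    using that unfolding T_def by auto
  have "Ck_on k (\<lambda>y. (u \<circ> ?i) y * inverse ((v \<circ> ?i) y)) T"
    by (intro Ck_on_mult Ck_on_inverse T(1) nz Ck_on_subset[OF uv(1) T(3)] Ck_on_subset[OF uv(2) T(3)])
  moreover have "(u \<circ> ?i) y * inverse ((v \<circ> ?i) y) = (f \<circ> ?i) y" if "y \<in> T" for y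
    using nz[OF that] U(6)[of "?i y"] that by (simp add: T_def field_simps)
  ultimately have "Ck_on k (f \<circ> ?i) T"
    using Ck_on_cong[OF T(1), of "\<lambda>y. (u \<circ> ?i) y * inverse ((v \<circ> ?i) y)" "f \<circ> ?i"] by simp
  then show "\<exists>T. open T \<and> x \<in> T \<and> T \<subseteq> ?S \<and> Ck_on k (f \<circ> ?i) T"
    using T by blast
qed

end


section \<open>Tangent vectors and vector fields\<close>

definition fmul :: "('a \<Rightarrow> real) \<Rightarrow> 'a vfield \<Rightarrow> 'a vfield" (infixr "\<odot>" 75)
  where "f \<odot> X = (\<lambda>p. f p *\<^sub>R X p)"

lemma fmul_apply [simp]: "(f \<odot> X) p = f p *\<^sub>R X p"
  by (simp add: fmul_def)

context smooth_manifold
begin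

abbreviation "Sm \<equiv> smooth_fun A"
abbreviation "VF \<equiv> vector_field A"
abbreviation "TS \<equiv> tangent_space A"

lemma tan_nonsmooth: "v \<in> TS p \<Longrightarrow> \<not> Sm f \<Longrightarrow> v f = 0"
  unfolding tangent_space_def by blast

lemma tan_lin: "v \<in> TS p \<Longrightarrow> Sm f \<Longrightarrow> Sm g \<Longrightarrow> v (\<lambda>q. a * f q + b * g q) = a * v f + b * v g"
  unfolding tangent_space_def by blast

lemma tan_mult: "v \<in> TS p \<Longrightarrow> Sm f \<Longrightarrow> Sm g \<Longrightarrow> v (\<lambda>q. f q * g q) = v f * g p + f p * v g"
  unfolding tangent_space_def by blast

lemma tan_add: "v \<in> TS p \<Longrightarrow> Sm f \<Longrightarrow> Sm g \<Longrightarrow> v (\<lambda>q. f q + g q) = v f + v g"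
  using tan_lin[of v p f g 1 1] by simp

lemma tan_diff: "v \<in> TS p \<Longrightarrow> Sm f \<Longrightarrow> Sm g \<Longrightarrow> v (\<lambda>q. f q - g q) = v f - v g"
  using tan_lin[of v p f g 1 "-1"] by simp

lemma tan_zero: "v \<in> TS p \<Longrightarrow> v (\<lambda>q. 0) = 0"
  using tan_lin[of v p "\<lambda>q. 0" "\<lambda>q. 0" 0 0] smooth_const by simp

lemma tan_const:
  assumes v: "v \<in> TS p"
  shows "v (\<lambda>q. c) = 0"
proof -
  have "v (\<lambda>q. 1) = 0"
    using tan_mult[OF v smooth_const[of 1] smooth_const[of 1]] by simp
  then show ?thesis
    using tan_lin[OF v smooth_const[of 1] smooth_const[of 1], of c 0] by simp
qed

lemma tan_cmul: "v \<in> TS p \<Longrightarrow> Sm f \<Longrightarrow> v (\<lambda>q. c * f q) = c * v f"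
  using tan_lin[of v p f f c 0] by simp

lemma tan_minus: "v \<in> TS p \<Longrightarrow> Sm f \<Longrightarrow> v (\<lambda>q. - f q) = - v f"
  using tan_cmul[of v p f "-1"] by simp

lemma subspace_tangent: "subspace (TS p)"
proof (rule subspaceI)
  show "0 \<in> TS p" unfolding tangent_space_def by simp
next
  fix x y assume xy: "x \<in> TS p" "y \<in> TS p"
  show "x + y \<in> TS p"
    unfolding tangent_space_def
    using tan_nonsmooth[OF xy(1)] tan_nonsmooth[OF xy(2)] tan_lin[OF xy(1)] tan_lin[OF xy(2)]
      tan_mult[OF xy(1)] tan_mult[OF xy(2)]
    by (auto simp: algebra_simps)
next
  fix c :: real and x assume x: "x \<in> TS p"
  show "c *\<^sub>R x \<in> TS p"
    unfolding tangent_space_def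
    using tan_nonsmooth[OF x] tan_lin[OF x] tan_mult[OF x]
    by (auto simp: algebra_simps)
qed

lemmas tan_closed = subspace_0[OF subspace_tangent] subspace_add[OF subspace_tangent]
  subspace_diff[OF subspace_tangent] subspace_neg[OF subspace_tangent]
  subspace_scale[OF subspace_tangent] subspace_sum[OF subspace_tangent]

lemma vf_at: "VF X \<Longrightarrow> X p \<in> TS p"
  unfolding vector_field_def by blast

lemma vf_smooth:
  assumes "VF X" shows "Sm (\<lambda>p. X p f)"
proof (cases "Sm f")
  case True
  then show ?thesis using assms unfolding vector_field_def by blast
next
  case False
  then have "(\<lambda>p. X p f) = (\<lambda>p. 0)" using tan_nonsmooth[OF vf_at[OF assms]] by auto
  then show ?thesis using smooth_const by metis
qed

lemma vf_zero: "VF 0"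
  unfolding vector_field_def using tan_closed(1) smooth_const[of 0] by simp

lemma vf_add: "VF X \<Longrightarrow> VF Y \<Longrightarrow> VF (X + Y)"
  unfolding vector_field_def[of A "X + Y"] using tan_closed(2)[OF vf_at vf_at] smooth_add[OF vf_smooth vf_smooth] by simp

lemma vf_diff: "VF X \<Longrightarrow> VF Y \<Longrightarrow> VF (X - Y)"
  unfolding vector_field_def[of A "X - Y"] using tan_closed(3)[OF vf_at vf_at] smooth_diff[OF vf_smooth vf_smooth] by simp

lemma vf_minus: "VF X \<Longrightarrow> VF (- X)"
  unfolding vector_field_def[of A "- X"] using tan_closed(4)[OF vf_at] smooth_minus[OF vf_smooth] by simp

lemma vf_fmul: "Sm f \<Longrightarrow> VF X \<Longrightarrow> VF (f \<odot> X)"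
  unfolding vector_field_def[of A "f \<odot> X"] using tan_closed(5)[OF vf_at] smooth_mult[OF _ vf_smooth] by simp

lemma vf_scaleR: "VF X \<Longrightarrow> VF (c *\<^sub>R X)"
  using vf_fmul[OF smooth_const[of c], of X] by (simp add: fmul_def scaleR_fun_def)

lemma vf_sum: "(\<And>i. i \<in> I \<Longrightarrow> VF (X i)) \<Longrightarrow> VF (\<Sum>i\<in>I. X i)"
  by (induction I rule: infinite_finite_induct) (auto intro: vf_zero vf_add)

lemma vf_bracket:
  assumes X: "VF X" and Y: "VF Y"
  shows "VF (bracket X Y)"
  unfolding vector_field_def
proof (intro conjI allI impI)
  fix f
  show "Sm (\<lambda>p. bracket X Y p f)"
    unfolding bracket_def by (intro smooth_diff vf_smooth X Y)
next
  fix p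
  note Xl = tan_lin[OF vf_at[OF X]] and Yl = tan_lin[OF vf_at[OF Y]]
  note Xm = tan_mult[OF vf_at[OF X]] and Ym = tan_mult[OF vf_at[OF Y]]
  note sX = vf_smooth[OF X] and sY = vf_smooth[OF Y]
  show "bracket X Y p \<in> TS p"
    unfolding tangent_space_def mem_Collect_eq
  proof (intro conjI allI impI)
    fix f assume "\<not> Sm f"
    then have "(\<lambda>q. Y q f) = (\<lambda>q. 0)" "(\<lambda>q. X q f) = (\<lambda>q. 0)"
      using tan_nonsmooth[OF vf_at[OF X]] tan_nonsmooth[OF vf_at[OF Y]] by auto
    then show "bracket X Y p f = 0"
      by (simp add: bracket_def tan_zero[OF vf_at[OF X]] tan_zero[OF vf_at[OF Y]])
  next
    fix f g and a b :: real assume fg: "Sm f" "Sm g"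
    show "bracket X Y p (\<lambda>q. a * f q + b * g q) = a * bracket X Y p f + b * bracket X Y p g"
      unfolding bracket_def
      by (simp add: Xl[OF fg] Yl[OF fg] Xl[OF sY sY] Yl[OF sX sX] algebra_simps)
  next
    fix f g assume fg: "Sm f" "Sm g"
    have 1: "X p (\<lambda>q. Y q f * g q + f q * Y q g)
        = X p (\<lambda>q. Y q f) * g p + Y p f * X p g + X p f * Y p g + f p * X p (\<lambda>q. Y q g)"
      using tan_add[OF vf_at[OF X] smooth_mult[OF sY fg(2)] smooth_mult[OF fg(1) sY]]
      by (simp add: Xm[OF sY fg(2)] Xm[OF fg(1) sY])
    have 2: "Y p (\<lambda>q. X q f * g q + f q * X q g)
        = Y p (\<lambda>q. X q f) * g p + X p f * Y p g + Y p f * X p g + f p * Y p (\<lambda>q. X q g)"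
      using tan_add[OF vf_at[OF Y] smooth_mult[OF sX fg(2)] smooth_mult[OF fg(1) sX]]
      by (simp add: Ym[OF sX fg(2)] Ym[OF fg(1) sX])
    show "bracket X Y p (\<lambda>q. f q * g q) = bracket X Y p f * g p + f p * bracket X Y p g"
      unfolding bracket_def by (simp add: Xm[OF fg] Ym[OF fg] 1 2) (simp add: algebra_simps)
  qed
qed

lemmas vf_intros = vf_zero vf_add vf_diff vf_minus vf_fmul vf_scaleR vf_sum vf_bracket

lemma bracket_commute: "bracket X Y = - bracket Y X"
  by (simp add: bracket_def fun_eq_iff)

lemma bracket_add_right:
  assumes X: "VF X" and Y: "VF Y" and Y': "VF Y'"
  shows "bracket X (Y + Y') = bracket X Y + bracket X Y'"
  by (simp add: bracket_def fun_eq_iff tan_add[OF vf_at[OF X] vf_smooth[OF Y] vf_smooth[OF Y']])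

lemma bracket_add_left:
  assumes X: "VF X" and X': "VF X'" and Y: "VF Y"
  shows "bracket (X + X') Y = bracket X Y + bracket X' Y"
  using bracket_add_right[OF Y X X'] by (simp add: bracket_commute[of _ Y])

lemma bracket_fmul_right:
  assumes X: "VF X" and Y: "VF Y" and f: "Sm f"
  shows "bracket X (f \<odot> Y) = f \<odot> bracket X Y + (\<lambda>p. X p f) \<odot> Y"
  by (simp add: bracket_def fun_eq_iff tan_mult[OF vf_at[OF X] f vf_smooth[OF Y]] algebra_simps)

lemma bracket_fmul_left:
  assumes X: "VF X" and Y: "VF Y" and f: "Sm f"
  shows "bracket (f \<odot> X) Y = f \<odot> bracket X Y - (\<lambda>p. Y p f) \<odot> X"
  using bracket_fmul_right[OF Y X f] by (simp add: bracket_commute[of _ Y] fmul_def fun_eq_iff)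

text \<open>
  Written out at a function, each of the six triple products occurs twice with opposite signs.
\<close>

lemma bracket_jacobi:
  assumes X: "VF X" and Y: "VF Y" and Z: "VF Z"
  shows "bracket X (bracket Y Z) + bracket Y (bracket Z X) + bracket Z (bracket X Y) = 0"
  by (simp add: bracket_def fun_eq_iff tan_diff[OF vf_at[OF X] vf_smooth[OF Y] vf_smooth[OF Z]]
      tan_diff[OF vf_at[OF X] vf_smooth[OF Z] vf_smooth[OF Y]]
      tan_diff[OF vf_at[OF Y] vf_smooth[OF Z] vf_smooth[OF X]]
      tan_diff[OF vf_at[OF Y] vf_smooth[OF X] vf_smooth[OF Z]]
      tan_diff[OF vf_at[OF Z] vf_smooth[OF X] vf_smooth[OF Y]]
      tan_diff[OF vf_at[OF Z] vf_smooth[OF Y] vf_smooth[OF X]])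

end


section \<open>Global frames and tensoriality\<close>

lemma family_span:
  fixes w :: "'k::finite \<Rightarrow> 'v::real_vector"
  assumes "\<exists>a. y = (\<Sum>j\<in>UNIV. a j *\<^sub>R w j)"
  shows "y \<in> span (range w)"
  using assms by (elim exE) (simp add: span_sum span_scale span_base)

text \<open>
  By exchange, an independent family cannot be enlarged inside the span of a family with the same index set.
\<close>

lemma independent_family_spans:
  fixes v w :: "'k::finite \<Rightarrow> 'v::real_vector"
  assumes ind: "\<And>a. (\<Sum>j\<in>UNIV. a j *\<^sub>R v j) = 0 \<Longrightarrow> \<forall>j. a j = 0"
    and v: "\<And>i. \<exists>a. v i = (\<Sum>j\<in>UNIV. a j *\<^sub>R w j)"
    and x: "\<exists>a. x = (\<Sum>j\<in>UNIV. a j *\<^sub>R w j)"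
  shows "\<exists>a. x = (\<Sum>j\<in>UNIV. a j *\<^sub>R v j)"
proof (rule ccontr)
  assume nx: "\<nexists>a. x = (\<Sum>j\<in>UNIV. a j *\<^sub>R v j)"
  have inj: "inj v"
  proof (rule injI)
    fix i j assume eq: "v i = v j"
    have "(\<Sum>k\<in>UNIV. (of_bool (k = i) - of_bool (k = j)) *\<^sub>R v k) = v i - v j"
      by (simp add: scaleR_diff_left sum_subtractf of_bool_def if_distrib[where f="\<lambda>c. c *\<^sub>R _"] cong: if_cong)
    also have "v i - v j = 0" using eq by simp
    finally have "\<forall>k. of_bool (k = i) - of_bool (k = j) = (0::real)" by (rule ind)
    then have "of_bool (i = i) - of_bool (i = j) = (0::real)" by (rule spec)
    then show "i = j" by (simp split: if_splits)
  qed
  have xns: "x \<notin> span (range v)"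
  proof
    assume "x \<in> span (range v)"
    then obtain u where "x = (\<Sum>w\<in>range v. u w *\<^sub>R w)"
      using span_finite[of "range v"] by auto
    then have "x = (\<Sum>j\<in>UNIV. u (v j) *\<^sub>R v j)"
      using sum.reindex[OF inj, of "\<lambda>w. u w *\<^sub>R w"] by simp
    then have "\<exists>a. x = (\<Sum>j\<in>UNIV. a j *\<^sub>R v j)" by (rule exI[of _ "\<lambda>j. u (v j)"])
    then show False using nx by contradiction
  qed
  have indv: "independent (range v)"
  proof (rule independent_if_scalars_zero)
    fix u w assume s: "(\<Sum>w\<in>range v. u w *\<^sub>R w) = 0" and w: "w \<in> range v"
    have "(\<Sum>j\<in>UNIV. u (v j) *\<^sub>R v j) = 0"
      using s sum.reindex[OF inj, of "\<lambda>w. u w *\<^sub>R w"] by simp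
    then have "\<forall>j. u (v j) = 0" by (rule ind)
    then show "u w = 0" using w by auto
  qed simp
  have xnr: "x \<notin> range v" using xns span_base[of x "range v"] by blast
  have indx: "independent (insert x (range v))" by (rule independent_insertI[OF xns indv])
  have "insert x (range v) \<subseteq> span (range w)"
    using family_span[OF x] family_span[OF v] by blast
  then have "card (insert x (range v)) \<le> card (range w)"
    using independent_span_bound[OF _ indx, of "range w"] by simp
  also have "\<dots> \<le> CARD('k)" by (rule card_image_le) simp
  finally show False using xnr card_image[OF inj] by simp
qed

text \<open>
  The fields are global, but they have to form a basis of the tangent space only at the one point.
\<close>

definition tangent_frame ::
    "('a, 'n::finite) chart set \<Rightarrow> 'a \<Rightarrow> ('n \<Rightarrow> 'a vfield) \<Rightarrow> bool" where
  "tangent_frame A p E \<longleftrightarrow> (\<forall>j. vector_field A (E j)) \<and>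
      (\<forall>a. (\<Sum>j\<in>UNIV. a j *\<^sub>R E j p) = 0 \<longrightarrow> (\<forall>j. a j = 0)) \<and>
      (\<forall>x\<in>tangent_space A p. \<exists>a. x = (\<Sum>j\<in>UNIV. a j *\<^sub>R E j p))"

lemma tangent_frameD:
  assumes "tangent_frame A p E"
  shows "vector_field A (E j)"
    and "(\<Sum>j\<in>UNIV. a j *\<^sub>R E j p) = 0 \<Longrightarrow> \<forall>j. a j = 0"
    and "x \<in> tangent_space A p \<Longrightarrow> \<exists>a. x = (\<Sum>j\<in>UNIV. a j *\<^sub>R E j p)"
  using assms unfolding tangent_frame_def by simp_all

locale framed_manifold = smooth_manifold A
  for A :: "('a::{t2_space, second_countable_topology}, 'n::finite) chart set" +
  assumes frame_exists: "\<exists>E. tangent_frame A p E"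
begin

lemma field_through:
  assumes "x \<in> TS p"
  obtains X where "VF X" "X p = x"
proof -
  obtain E where "tangent_frame A p E" using frame_exists[of p] by blast
  note E = tangent_frameD[OF this]
  obtain a where a: "x = (\<Sum>j\<in>UNIV. a j *\<^sub>R E j p)" using E(3)[OF assms] by blast
  show ?thesis
    by (rule that[of "\<Sum>j\<in>UNIV. a j *\<^sub>R E j"]) (auto simp: a intro!: vf_intros E(1))
qed

lemma ext_field:
  assumes "x \<in> TS p"
  shows "VF (ext_field A p x)" "ext_field A p x p = x"
  using someI_ex[of "\<lambda>X. VF X \<and> X p = x"] field_through[OF assms]
  unfolding ext_field_def by blast+

text \<open>
  Some frame spans the tangent space by as many vectors as the index type has elements.
\<close>

lemma independent_spans_tangent:
  fixes v :: "'n \<Rightarrow> 'a tvec"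
  assumes v: "\<And>j. v j \<in> TS p" and ind: "\<And>a. (\<Sum>j\<in>UNIV. a j *\<^sub>R v j) = 0 \<Longrightarrow> \<forall>j. a j = 0"
    and x: "x \<in> TS p"
  obtains a where "x = (\<Sum>j\<in>UNIV. a j *\<^sub>R v j)"
proof -
  obtain E where "tangent_frame A p E" using frame_exists[of p] by blast
  note E = tangent_frameD[OF this]
  have "\<exists>a. x = (\<Sum>j\<in>UNIV. a j *\<^sub>R v j)"
    by (rule independent_family_spans[of v "\<lambda>j. E j p", OF ind E(3)[OF v] E(3)[OF x]])
  then show ?thesis using that by (elim exE) simp
qed

text \<open>
  The vectors \<open>(v\<^sub>1 f, \<dots>, v\<^sub>n f)\<close> for smooth \<open>f\<close> form a subspace
  of \<open>\<real>\<^sup>n\<close>; a nonzero vector orthogonal to it would be the coefficients of a linear relation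
  between the \<open>v\<^sub>j\<close>.
\<close>

lemma dual_functions:
  fixes v :: "'n \<Rightarrow> 'a tvec"
  assumes v: "\<And>j. v j \<in> TS p" and ind: "\<And>a. (\<Sum>j\<in>UNIV. a j *\<^sub>R v j) = 0 \<Longrightarrow> \<forall>j. a j = 0"
  obtains f :: "'n \<Rightarrow> 'a \<Rightarrow> real" where "\<And>k. Sm (f k)" "\<And>j k. v j (f k) = of_bool (j = k)"
proof -
  define S where "S = (\<lambda>f. (\<chi> j. v j f) :: real ^ 'n) ` {f. Sm f}"
  have "subspace S"
  proof (rule subspaceI)
    show "0 \<in> S" unfolding S_def
      by (rule image_eqI[of _ _ "\<lambda>q. 0"]) (simp_all add: vec_eq_iff tan_zero[OF v] smooth_const)
  next
    fix x y assume "x \<in> S" "y \<in> S"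
    then obtain f g where fg: "Sm f" "Sm g" "x = (\<chi> j. v j f)" "y = (\<chi> j. v j g)"
      unfolding S_def by blast
    show "x + y \<in> S" unfolding S_def
      by (rule image_eqI[of _ _ "\<lambda>q. f q + g q"])
        (simp_all add: vec_eq_iff tan_add[OF v] fg smooth_add)
  next
    fix c :: real and x assume "x \<in> S"
    then obtain f where f: "Sm f" "x = (\<chi> j. v j f)" unfolding S_def by blast
    show "c *\<^sub>R x \<in> S" unfolding S_def
      by (rule image_eqI[of _ _ "\<lambda>q. c * f q"])
        (simp_all add: vec_eq_iff tan_cmul[OF v] f smooth_mult[OF smooth_const])
  qed
  have "S = UNIV"
  proof (rule ccontr)
    assume "S \<noteq> UNIV"
    then have "span S \<noteq> UNIV" using \<open>subspace S\<close> by (metis span_eq_iff)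
    then obtain a where a: "a \<noteq> 0" "span S \<subseteq> {x. a \<bullet> x = 0}"
      using span_not_univ_subset_hyperplane by blast
    have "(\<Sum>j\<in>UNIV. a $ j *\<^sub>R v j) f = 0" for f
    proof (cases "Sm f")
      case True
      then have "a \<bullet> (\<chi> j. v j f) = 0" using a(2) span_superset[of S] unfolding S_def by blast
      then show ?thesis by (simp add: inner_vec_def)
    next
      case False
      then show ?thesis using tan_nonsmooth[OF v] by simp
    qed
    then have "(\<Sum>j\<in>UNIV. a $ j *\<^sub>R v j) = 0" by (intro ext) (simp only: zero_fun_apply)
    then have "\<forall>j. a $ j = 0" by (rule ind)
    then show False using a(1) by (simp add: vec_eq_iff)
  qed
  then have "\<exists>f. Sm f \<and> axis k 1 = (\<chi> j. v j f)" for k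
    unfolding S_def by blast
  then obtain f where f: "\<And>k. Sm (f k)" "\<And>k. axis k 1 = (\<chi> j. v j (f k))"
    by metis
  show ?thesis
  proof (rule that[OF f(1)])
    fix j k show "v j (f k) = of_bool (j = k)"
      using f(2)[of k] by (simp add: vec_eq_iff axis_def split: if_splits) metis
  qed
qed

text \<open>
  Let \<open>f\<^sub>k\<close> be dual to the frame at \<open>p\<close> and
  \<open>\<Delta> = det (E\<^sub>j f\<^sub>k)\<close>. Where \<open>\<Delta> \<noteq> 0\<close> the
  \<open>E\<^sub>j\<close> are independent, hence a basis, and Cramer's rule applied to the equations
  \<open>X f\<^sub>k = \<Sum>\<^sub>j a\<^sub>j (E\<^sub>j f\<^sub>k)\<close> expresses
  \<open>\<Delta> a\<^sub>j\<close> as a determinant that is smooth everywhere. One more factor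
  \<open>\<Delta>\<close> makes the expansion valid also where \<open>\<Delta> = 0\<close>, because both sides are
  then zero. So \<open>d = \<Delta>\<^sup>2\<close>.
\<close>

lemma frame_expansion:
  assumes "tangent_frame A p E"
  obtains d :: "'a \<Rightarrow> real" and c :: "'a vfield \<Rightarrow> 'n \<Rightarrow> 'a \<Rightarrow> real"
  where "Sm d" "d p = 1" "\<And>X j. VF X \<Longrightarrow> Sm (c X j)"
    "\<And>X. VF X \<Longrightarrow> d \<odot> X = (\<Sum>j\<in>UNIV. c X j \<odot> E j)"
    "\<And>X j. VF X \<Longrightarrow> X p = 0 \<Longrightarrow> c X j p = 0"
proof -
  note E = tangent_frameD(1)[OF assms] and ind = tangent_frameD(2)[OF assms]
  obtain f where f: "\<And>k::'n. Sm (f k)" "\<And>j k. E j p (f k) = of_bool (j = k)"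
    by (rule dual_functions[of "\<lambda>j. E j p" p]) (use vf_at[OF E] ind in blast)+
  define G :: "'a \<Rightarrow> real ^ 'n ^ 'n" where "G q = (\<chi> k j. E j q (f k))" for q
  define N :: "'a vfield \<Rightarrow> 'n \<Rightarrow> 'a \<Rightarrow> real ^ 'n ^ 'n"
    where "N X l q = (\<chi> k j. if j = l then X q (f k) else E j q (f k))" for X l q
  define d where "d q = det (G q)" for q
  define c where "c X l q = det (N X l q)" for X l q
  have Gp: "G p = mat 1" unfolding G_def mat_def by (auto simp: vec_eq_iff f)
  have dp: "d p = 1" by (simp add: d_def Gp)
  have smd: "Sm d" unfolding d_def
    by (rule smooth_det) (simp add: G_def vf_smooth E)
  have smc: "Sm (c X l)" if "VF X" for X l unfolding c_def
  proof (rule smooth_det)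
    show "Sm (\<lambda>q. N X l q $ k $ j)" for k j
      by (cases "j = l") (simp_all add: N_def vf_smooth E that)
  qed
  have exp: "d q *\<^sub>R X q = (\<Sum>j\<in>UNIV. c X j q *\<^sub>R E j q)" if X: "VF X" and dq: "d q \<noteq> 0" for X q
  proof -
    have mv: "(G q *v b) $ k = (\<Sum>j\<in>UNIV. b $ j *\<^sub>R E j q) (f k)" for b k
      by (simp add: G_def matrix_vector_mult_def mult.commute)
    have indq: "\<forall>j. a j = 0" if "(\<Sum>j\<in>UNIV. a j *\<^sub>R E j q) = 0" for a
    proof -
      have "G q *v (\<chi> j. a j) = 0"
        using mv[of "\<chi> j. a j"] that by (simp add: vec_eq_iff)
      then have "(\<chi> j. a j) = 0"
        using cramer[of "G q" "\<chi> j. a j" 0] cramer[of "G q" 0 0] dq unfolding d_def by simp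
      then show ?thesis by (simp add: vec_eq_iff)
    qed
    obtain a where a: "X q = (\<Sum>j\<in>UNIV. a j *\<^sub>R E j q)"
      by (rule independent_spans_tangent[of "\<lambda>j. E j q" q "X q", OF vf_at[OF E] indq vf_at[OF X]])
    have "G q *v (\<chi> j. a j) = (\<chi> k. X q (f k))"
      using mv[of "\<chi> j. a j"] a by (simp add: vec_eq_iff)
    then have "(\<chi> j. a j) = (\<chi> l. det (\<chi> k j. if j = l then (\<chi> k. X q (f k)) $ k else G q $ k $ j) / det (G q))"
      using cramer[of "G q"] dq unfolding d_def by blast
    then have "a l = c X l q / d q" for l
      unfolding c_def d_def N_def G_def by (simp add: vec_eq_iff cong: if_cong)
    then have "d q * a l = c X l q" for l using dq by simp
    then show ?thesis by (simp add: a scaleR_sum_right)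
  qed
  \<comment> \<open>At \<open>p\<close> the column replaced according to Cramer consists of the \<open>X p (f\<^sub>k)\<close>.\<close>
  have c0: "c X l p = 0" if "VF X" "X p = 0" for X l
  proof -
    have "row k (transpose (N X l p)) = 0" if "k = l" for k
      using \<open>X p = 0\<close> that by (simp add: row_def transpose_def N_def vec_eq_iff)
    then have "det (transpose (N X l p)) = 0" by (meson det_zero_row(1))
    then show ?thesis unfolding c_def by (simp add: det_transpose)
  qed
  show ?thesis
  proof (rule that[of "\<lambda>q. d q * d q" "\<lambda>X j q. d q * c X j q"])
    fix X assume X: "VF X"
    show "(\<lambda>q. d q * d q) \<odot> X = (\<Sum>j\<in>UNIV. (\<lambda>q. d q * c X j q) \<odot> E j)"
    proof
      fix q
      show "((\<lambda>q. d q * d q) \<odot> X) q = (\<Sum>j\<in>UNIV. (\<lambda>q. d q * c X j q) \<odot> E j) q"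
        using exp[OF X, of q] by (cases "d q = 0") (simp_all flip: scaleR_scaleR scaleR_sum_right)
    qed
  qed (auto intro!: smooth_mult smd smc simp: c0 dp)
qed

text \<open>
  A functional that is linear over the smooth functions takes the same value on fields that agree at \<open>p\<close>:
  multiply the difference \<open>Z\<close> of the fields by \<open>d\<close>, which is \<open>1\<close> at
  \<open>p\<close>, and expand \<open>d Z\<close> in a frame with coefficients vanishing at \<open>p\<close>.
\<close>

lemma tensor_at:
  fixes B :: "'a vfield \<Rightarrow> real"
  assumes add: "\<And>X Y. VF X \<Longrightarrow> VF Y \<Longrightarrow> B (X + Y) = B X + B Y"
    and mul: "\<And>f X. Sm f \<Longrightarrow> VF X \<Longrightarrow> B (f \<odot> X) = f p * B X"
    and X: "VF X" and Y: "VF Y" and eq: "X p = Y p"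
  shows "B X = B Y"
proof -
  obtain E where fr: "tangent_frame A p E" using frame_exists[of p] by blast
  note E = tangent_frameD(1)[OF fr]
  obtain d c where dc: "Sm d" "d p = 1" "\<And>X j. VF X \<Longrightarrow> Sm (c X j)"
    "\<And>X. VF X \<Longrightarrow> d \<odot> X = (\<Sum>j\<in>UNIV. c X j \<odot> E j)"
    "\<And>X j. VF X \<Longrightarrow> X p = 0 \<Longrightarrow> c X j p = 0"
    by (rule frame_expansion[OF fr]) blast
  have B0: "B 0 = 0" using add[OF vf_zero vf_zero] by simp
  have sum: "B (\<Sum>j\<in>I. c X j \<odot> E j) = (\<Sum>j\<in>I. c X j p * B (E j))" if "VF X" for I and X
  proof (induction I rule: infinite_finite_induct)
    case (insert i I)
    note vf = vf_fmul[OF dc(3)[OF that] E]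
    show ?case
      by (simp only: sum.insert[OF insert(1,2)] add[OF vf vf_sum[OF vf]] mul[OF dc(3)[OF that] E]
          insert.IH)
  qed (simp_all only: sum.infinite sum.empty B0 not_False_eq_True)
  have Z: "VF (X - Y)" by (intro vf_intros X Y)
  have "B (X - Y) = B (d \<odot> (X - Y))" using mul[OF dc(1) Z] dc(2) by simp
  also have "\<dots> = (\<Sum>j\<in>UNIV. c (X - Y) j p * B (E j))"
    unfolding dc(4)[OF Z] by (rule sum[OF Z])
  also have "\<dots> = 0" using dc(5)[OF Z] eq by simp
  finally show ?thesis using add[OF Z Y] by simp
qed

end


section \<open>The CR structure at a point\<close>

definition re_part :: "'a ctvec \<Rightarrow> 'a tvec" where "re_part z = (\<lambda>f. Re (z f))"
definition im_part :: "'a ctvec \<Rightarrow> 'a tvec" where "im_part z = (\<lambda>f. Im (z f))"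

lemma part_apply [simp]: "re_part z f = Re (z f)" "im_part z f = Im (z f)"
  by (simp_all add: re_part_def im_part_def)

lemma sum_lessThan_thirds:
  fixes f :: "nat \<Rightarrow> 'v::comm_monoid_add"
  shows "(\<Sum>k<2 * m + 1. f k) = (\<Sum>k<m. f k) + (\<Sum>k<m. f (m + k)) + f (2 * m)"
proof -
  have "(\<Sum>k<m + m. f k) = (\<Sum>k<m. f k) + (\<Sum>k<m. f (m + k))"
    by (simp add: sum.nat_group[symmetric] sum.atLeastLessThan_concat[symmetric, of 0 m "m + m"]
        lessThan_atLeast0 sum.shift_bounds_nat_ivl[of f 0 m m, simplified] add.commute)
  then show ?thesis by (simp add: mult_2)
qed

locale sasaki =
  fixes m :: nat
    and M :: "('a::{t2_space, second_countable_topology}, 'n::finite) psh"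
    and \<xi> :: "'a vfield" and D :: "'a connection"
  assumes sasakian: "sasakian m M \<xi> D"
begin

lemma cr: "cr_manifold m M" and contact: "pseudohermitian_form M" and levi_pos: "levi_positive M"
  and reeb: "reeb_field M \<xi>" and canonical: "canonical_connection M \<xi> D"
  and tau0: "vector_field (charts M) X \<Longrightarrow> tau \<xi> D X p = (\<lambda>f. 0)"
  using sasakian unfolding sasakian_def by auto

sublocale smooth_manifold "charts M"
  using cr unfolding cr_manifold_def by unfold_locales blast

abbreviation "th \<equiv> theta M"

lemma th_lin: "x \<in> TS p \<Longrightarrow> y \<in> TS p \<Longrightarrow> th p (\<lambda>f. a * x f + b * y f) = a * th p x + b * th p y"
  using contact unfolding pseudohermitian_form_def one_form_def by blast

lemma th_add: "x \<in> TS p \<Longrightarrow> y \<in> TS p \<Longrightarrow> th p (x + y) = th p x + th p y"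
  using th_lin[of x p y 1 1] by (simp add: plus_fun_def)

lemma th_scale: "x \<in> TS p \<Longrightarrow> th p (a *\<^sub>R x) = a * th p x"
  using th_lin[of x p x a 0] by (simp add: scaleR_fun_def)

lemma th_zero: "th p 0 = 0"
  using th_scale[OF tan_closed(1), of p 0] by simp

lemma th_minus: "x \<in> TS p \<Longrightarrow> th p (- x) = - th p x"
  using th_scale[of x p "-1"] by simp

lemma th_diff: "x \<in> TS p \<Longrightarrow> y \<in> TS p \<Longrightarrow> th p (x - y) = th p x - th p y"
  using th_add[of x p "- y"] th_minus[of y p] tan_closed(4) by simp

lemma th_smooth: "VF X \<Longrightarrow> Sm (\<lambda>p. th p (X p))"
  using contact unfolding pseudohermitian_form_def one_form_def by blast

lemma vf_xi: "VF \<xi>" and th_xi: "th p (\<xi> p) = 1"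
  using reeb unfolding reeb_field_def by auto

lemma xi_tan: "\<xi> p \<in> TS p" using vf_at[OF vf_xi] .

lemma Hor_iff: "x \<in> Hor M p \<longleftrightarrow> x \<in> TS p \<and> th p x = 0"
  using contact unfolding pseudohermitian_form_def by blast

definition CR_frame :: "'a set \<Rightarrow> (nat \<Rightarrow> 'a cvfield) \<Rightarrow> bool" where
  "CR_frame U Z \<longleftrightarrow> open U \<and> (\<forall>i<m. cvector_field (charts M) (Z i)) \<and>
     (\<forall>q\<in>U. H10 M q = {\<lambda>f. \<Sum>i<m. c i * Z i q f | c. True} \<and>
       (\<forall>c. (\<forall>f. (\<Sum>i<m. c i * Z i q f) = 0) \<longrightarrow> (\<forall>i<m. c i = 0)))"

lemma CR_frame_exists: "\<exists>U Z. p \<in> U \<and> CR_frame U Z"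
proof -
  have "complex_subbundle m (charts M) (H10 M)"
    using cr unfolding cr_manifold_def by blast
  then have "\<exists>U Z. open U \<and> p \<in> U \<and> (\<forall>i<m. cvector_field (charts M) (Z i)) \<and>
        (\<forall>q\<in>U. H10 M q = {\<lambda>f. \<Sum>i<m. c i * Z i q f | c. True} \<and>
          (\<forall>c. (\<forall>f. (\<Sum>i<m. c i * Z i q f) = 0) \<longrightarrow> (\<forall>i<m. c i = 0)))"
    unfolding complex_subbundle_def by (rule spec)
  then show ?thesis unfolding CR_frame_def by (elim exE conjE) (intro exI conjI, assumption+)
qed

lemma CR_frameD:
  assumes "CR_frame U Z"
  shows "open U" "i < m \<Longrightarrow> cvector_field (charts M) (Z i)"
    "q \<in> U \<Longrightarrow> H10 M q = {\<lambda>f. \<Sum>i<m. c i * Z i q f | c. True}"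
    "q \<in> U \<Longrightarrow> (\<And>f. (\<Sum>i<m. c i * Z i q f) = 0) \<Longrightarrow> i < m \<Longrightarrow> c i = 0"
  using assms unfolding CR_frame_def by simp_all

lemma H10_comb:
  assumes "CR_frame U Z" "p \<in> U"
  shows "(\<lambda>f. \<Sum>i<m. c i * Z i p f) \<in> H10 M p"
  unfolding CR_frameD(3)[OF assms] mem_Collect_eq by (rule exI[of _ c]) simp

lemma H10_lin:
  assumes "z \<in> H10 M p" "w \<in> H10 M p"
  shows "(\<lambda>f. a * z f + b * w f) \<in> H10 M p"
proof -
  obtain U Z where U: "p \<in> U" "CR_frame U Z" using CR_frame_exists[of p] by blast
  obtain c d where "z = (\<lambda>f. \<Sum>i<m. c i * Z i p f)" "w = (\<lambda>f. \<Sum>i<m. d i * Z i p f)"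
    using assms unfolding CR_frameD(3)[OF U(2,1)] by auto
  then have "(\<lambda>f. a * z f + b * w f) = (\<lambda>f. \<Sum>i<m. (a * c i + b * d i) * Z i p f)"
    by (simp add: fun_eq_iff sum_distrib_left sum.distrib algebra_simps)
  then show ?thesis using H10_comb[OF U(2,1)] by simp
qed

lemma H10_scale: "z \<in> H10 M p \<Longrightarrow> (\<lambda>f. a * z f) \<in> H10 M p"
  using H10_lin[of z p z a 0] by simp

lemma H10_cap: "H10 M p \<inter> H01 M p = {\<lambda>f. 0}"
  using cr unfolding cr_manifold_def by blast

lemma H10_zero: "(\<lambda>f. 0) \<in> H10 M p"
  using H10_cap by blast

text \<open>
  An element of \<open>H10\<close> with zero real part is minus its own conjugate, hence lies also in
  \<open>H01\<close>.
\<close>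

lemma H10_real_part_inj:
  assumes z: "z \<in> H10 M p" and w: "w \<in> H10 M p" and eq: "re_part z = re_part w"
  shows "z = w"
proof -
  let ?u = "\<lambda>f. 1 * z f + (-1) * w f"
  have u: "?u \<in> H10 M p" by (rule H10_lin[OF z w])
  have "?u = cconj (\<lambda>f. (-1) * ?u f)"
    using eq by (auto simp: cconj_def fun_eq_iff complex_eq_iff)
  then have "?u \<in> H01 M p"
    unfolding H01_def using H10_scale[OF u, of "-1"] by (rule image_eqI)
  with u have "?u = (\<lambda>f. 0)" using H10_cap by blast
  then show ?thesis by (simp add: fun_eq_iff)
qed

text \<open>
  The real part of \<open>cconj w\<close> is that of \<open>w\<close>, so \<open>H10\<close> alone already yields all
  of \<open>Hor\<close>; conversely \<open>re_part z\<close> is the sum of \<open>z / 2\<close> and its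
  conjugate.
\<close>

lemma Hor_eq: "Hor M p = re_part ` H10 M p"
proof (intro equalityI subsetI)
  fix x assume "x \<in> Hor M p"
  then obtain z w where zw: "z \<in> H10 M p" "w \<in> H10 M p" "x = (\<lambda>f. Re (z f + cconj w f))"
    unfolding Hor_def H01_def by blast
  have "x = re_part (\<lambda>f. 1 * z f + 1 * w f)"
    using zw(3) by (simp add: fun_eq_iff cconj_def)
  then show "x \<in> re_part ` H10 M p" using H10_lin[OF zw(1,2)] by (rule image_eqI)
next
  fix x assume "x \<in> re_part ` H10 M p"
  then obtain z where z: "z \<in> H10 M p" "x = re_part z" by blast
  have "x = (\<lambda>f. Re ((\<lambda>f. 1/2 * z f) f + cconj (\<lambda>f. 1/2 * z f) f))"
    using z(2) by (simp add: fun_eq_iff cconj_def)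
  moreover have "(\<lambda>f. 1/2 * z f) \<in> H10 M p" by (rule H10_scale[OF z(1)])
  ultimately show "x \<in> Hor M p"
    unfolding Hor_def H01_def mem_Collect_eq by (intro exI conjI) (assumption, assumption, rule imageI)
qed

text \<open>
  The vector \<open>re_part z\<close> is \<open>z' + cconj z'\<close> for
  \<open>z' = z / 2\<close>, and \<open>\<i> (z' - cconj z')\<close> is then
  \<open>- im_part z\<close>.
\<close>

lemma Jb_re_part:
  assumes z: "z \<in> H10 M p"
  shows "Jb M p (re_part z) = - im_part z"
  unfolding Jb_def
proof (rule the_equality)
  let ?z = "\<lambda>f. 1/2 * z f"
  show "\<exists>z'\<in>H10 M p. \<forall>f. complex_of_real (re_part z f) = z' f + cconj z' f \<and>
      complex_of_real ((- im_part z) f) = \<i> * (z' f - cconj z' f)"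
    by (rule bexI[of _ ?z], simp add: cconj_def complex_eq_iff) (rule H10_scale[OF z])
next
  fix y assume "\<exists>z'\<in>H10 M p. \<forall>f. complex_of_real (re_part z f) = z' f + cconj z' f \<and>
      complex_of_real (y f) = \<i> * (z' f - cconj z' f)"
  then obtain w where w: "w \<in> H10 M p" "\<And>f. complex_of_real (re_part z f) = w f + cconj w f"
    "\<And>f. complex_of_real (y f) = \<i> * (w f - cconj w f)" by blast
  have "re_part (\<lambda>f. 2 * w f) = re_part z"
    using w(2) by (simp add: fun_eq_iff cconj_def complex_eq_iff)
  then have "(\<lambda>f. 2 * w f) = z"
    by (rule H10_real_part_inj[OF H10_scale[OF w(1)] z])
  then show "y = - im_part z"
    using w(3) by (auto simp: fun_eq_iff cconj_def complex_eq_iff)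
qed

lemma Jb_im_part:
  assumes z: "z \<in> H10 M p"
  shows "im_part z \<in> Hor M p" "Jb M p (im_part z) = re_part z"
proof -
  have "im_part z = re_part (\<lambda>f. (-\<i>) * z f)" by (simp add: fun_eq_iff)
  moreover have "re_part z = - im_part (\<lambda>f. (-\<i>) * z f)" by (simp add: fun_eq_iff)
  ultimately show "im_part z \<in> Hor M p" "Jb M p (im_part z) = re_part z"
    using H10_scale[OF z, of "-\<i>"] Jb_re_part by (simp_all add: Hor_eq)
qed

text \<open>
  In other words, \<open>H10\<close> consists of the vectors \<open>x - \<i> Jx\<close> with \<open>x\<close>
  horizontal. Conditions on sections of \<open>H10\<close> become conditions on real horizontal fields in this way.
\<close>

lemma H10_iff: "z \<in> H10 M p \<longleftrightarrow> re_part z \<in> Hor M p \<and> im_part z = - Jb M p (re_part z)"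
proof
  assume "z \<in> H10 M p"
  then show "re_part z \<in> Hor M p \<and> im_part z = - Jb M p (re_part z)"
    by (simp add: Hor_eq Jb_re_part)
next
  assume R: "re_part z \<in> Hor M p \<and> im_part z = - Jb M p (re_part z)"
  then obtain w where w: "w \<in> H10 M p" "re_part z = re_part w" unfolding Hor_eq by blast
  then have "im_part z = im_part w" using R by (simp add: Jb_re_part)
  then have "z = w" using w(2) by (simp add: fun_eq_iff complex_eq_iff)
  then show "z \<in> H10 M p" using w(1) by simp
qed

lemma Hor_closed:
  "0 \<in> Hor M p" "x \<in> Hor M p \<Longrightarrow> y \<in> Hor M p \<Longrightarrow> x + y \<in> Hor M p"
  "x \<in> Hor M p \<Longrightarrow> a *\<^sub>R x \<in> Hor M p" "x \<in> Hor M p \<Longrightarrow> - x \<in> Hor M p"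
  "x \<in> Hor M p \<Longrightarrow> y \<in> Hor M p \<Longrightarrow> x - y \<in> Hor M p"
  unfolding Hor_iff using tan_closed th_add th_scale th_zero th_minus th_diff by auto

lemma Jb_Hor:
  assumes "x \<in> Hor M p"
  shows "Jb M p x \<in> Hor M p" "Jb M p (Jb M p x) = - x"
proof -
  obtain z where z: "z \<in> H10 M p" "x = re_part z" using assms unfolding Hor_eq by blast
  let ?w = "\<lambda>f. \<i> * z f"
  have w: "?w \<in> H10 M p" by (rule H10_scale[OF z(1)])
  have 1: "- im_part z = re_part ?w" "im_part ?w = re_part z" by (simp_all add: fun_eq_iff)
  show "Jb M p x \<in> Hor M p" "Jb M p (Jb M p x) = - x"
    using w by (simp_all only: z(2) Jb_re_part[OF z(1)] Jb_re_part[OF w] 1) (simp add: Hor_eq)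
qed

lemma Jb_lin:
  assumes "x \<in> Hor M p" "y \<in> Hor M p"
  shows "Jb M p (a *\<^sub>R x + b *\<^sub>R y) = a *\<^sub>R Jb M p x + b *\<^sub>R Jb M p y"
proof -
  obtain z w where zw: "z \<in> H10 M p" "x = re_part z" "w \<in> H10 M p" "y = re_part w"
    using assms unfolding Hor_eq by blast
  let ?u = "\<lambda>f. complex_of_real a * z f + complex_of_real b * w f"
  have u: "?u \<in> H10 M p" by (rule H10_lin[OF zw(1,3)])
  have "a *\<^sub>R x + b *\<^sub>R y = re_part ?u" using zw by (simp add: fun_eq_iff)
  then have "Jb M p (a *\<^sub>R x + b *\<^sub>R y) = - im_part ?u" using Jb_re_part[OF u] by simp
  also have "\<dots> = a *\<^sub>R (- im_part z) + b *\<^sub>R (- im_part w)" by (simp add: fun_eq_iff)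
  finally show ?thesis using zw Jb_re_part by simp
qed

subsection \<open>The endomorphism J on tangent vectors\<close>

abbreviation "hor \<equiv> proj_H M \<xi>"
abbreviation "J \<equiv> Jend M \<xi>"

lemma hor_eq: "hor p x = x - th p x *\<^sub>R \<xi> p"
  by (simp add: proj_H_def fun_eq_iff)

lemma hor_Hor: "x \<in> TS p \<Longrightarrow> hor p x \<in> Hor M p"
  unfolding hor_eq Hor_iff using xi_tan by (simp add: tan_closed th_diff th_scale th_xi)

lemma Hor_tan: "x \<in> Hor M p \<Longrightarrow> x \<in> TS p" and Hor_th: "x \<in> Hor M p \<Longrightarrow> th p x = 0"
  by (auto simp: Hor_iff)

lemma hor_id: "x \<in> Hor M p \<Longrightarrow> hor p x = x"
  by (simp add: hor_eq Hor_th)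

lemma hor_lin: "x \<in> TS p \<Longrightarrow> y \<in> TS p \<Longrightarrow> hor p (a *\<^sub>R x + b *\<^sub>R y) = a *\<^sub>R hor p x + b *\<^sub>R hor p y"
  by (simp add: hor_eq th_add th_scale tan_closed algebra_simps)

lemma J_Jb: "x \<in> Hor M p \<Longrightarrow> J p x = Jb M p x"
  by (simp add: Jend_def hor_id)

lemma J_Hor: "x \<in> TS p \<Longrightarrow> J p x \<in> Hor M p"
  unfolding Jend_def by (rule Jb_Hor[OF hor_Hor])

lemma J_tan: "x \<in> TS p \<Longrightarrow> J p x \<in> TS p" and th_J: "x \<in> TS p \<Longrightarrow> th p (J p x) = 0"
  using J_Hor by (auto simp: Hor_iff)

lemma J_J: "x \<in> TS p \<Longrightarrow> J p (J p x) = th p x *\<^sub>R \<xi> p - x"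
  using J_Jb[OF J_Hor] Jb_Hor(2)[OF hor_Hor] by (simp add: Jend_def hor_eq)

lemma J_lin:
  "x \<in> TS p \<Longrightarrow> y \<in> TS p \<Longrightarrow> J p (a *\<^sub>R x + b *\<^sub>R y) = a *\<^sub>R J p x + b *\<^sub>R J p y"
  unfolding Jend_def by (simp only: hor_lin Jb_lin hor_Hor)

lemma J_add: "x \<in> TS p \<Longrightarrow> y \<in> TS p \<Longrightarrow> J p (x + y) = J p x + J p y"
  using J_lin[of x p y 1 1] by simp

lemma J_scale: "x \<in> TS p \<Longrightarrow> J p (a *\<^sub>R x) = a *\<^sub>R J p x"
  using J_lin[of x p x a 0] by simp

lemma J_zero: "J p 0 = 0"
  using J_scale[OF tan_closed(1), of p 0] by simp

lemma J_minus: "x \<in> TS p \<Longrightarrow> J p (- x) = - J p x"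
  using J_scale[of x p "-1"] by simp

lemma J_diff: "x \<in> TS p \<Longrightarrow> y \<in> TS p \<Longrightarrow> J p (x - y) = J p x - J p y"
  using J_lin[of x p y 1 "-1"] by simp

lemma J_sum: "(\<And>i. i \<in> I \<Longrightarrow> x i \<in> TS p) \<Longrightarrow> J p (\<Sum>i\<in>I. x i) = (\<Sum>i\<in>I. J p (x i))"
proof (induction I rule: infinite_finite_induct)
  case (insert i I)
  have x: "x i \<in> TS p" "\<And>j. j \<in> I \<Longrightarrow> x j \<in> TS p" using insert.prems by auto
  have "(\<Sum>i\<in>I. x i) \<in> TS p" using x(2) by (rule tan_closed)
  then show ?case using J_add[OF x(1)] insert.IH[OF x(2)] by (simp only: sum.insert[OF insert(1,2)])
qed (simp_all only: sum.infinite sum.empty J_zero not_False_eq_True)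

lemma J_xi: "J p (\<xi> p) = 0"
proof -
  have "hor p (\<xi> p) = 0" by (simp add: hor_eq th_xi)
  then have "J p (\<xi> p) = Jb M p 0" by (simp add: Jend_def)
  also have "\<dots> = 0" using J_Jb[OF Hor_closed(1)] J_zero by simp
  finally show ?thesis .
qed


subsection \<open>Adapted frames and smoothness of J\<close>

lemma cvector_fieldD:
  assumes "cvector_field (charts M) Z"
  shows "VF (re_field Z)" "VF (im_field Z)"
  using assms by (auto simp: cvector_field_def)

lemma re_field_eq: "re_field Z q = re_part (Z q)" and im_field_eq: "im_field Z q = im_part (Z q)"
  by (simp_all add: re_field_def im_field_def fun_eq_iff)

text \<open>
  On the open set \<open>U\<close> the endomorphism \<open>J\<close> maps the frame fields to other global fields; this
  is what makes \<open>J\<close> smooth.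
\<close>

definition adapted_frame ::
    "'a \<Rightarrow> 'a set \<Rightarrow> ('n \<Rightarrow> 'a vfield) \<Rightarrow> ('n \<Rightarrow> 'a vfield) \<Rightarrow> bool" where
  "adapted_frame p U E F \<longleftrightarrow> open U \<and> p \<in> U \<and> tangent_frame (charts M) p E \<and>
     (\<forall>j. VF (F j)) \<and> (\<forall>q\<in>U. \<forall>j. J q (E j q) = F j q)"

text \<open>
  If the \<open>Z\<^sub>i\<close> are a local frame of \<open>H10\<close>, then \<open>J\<close> sends
  \<open>Re Z\<^sub>i\<close> to \<open>- Im Z\<^sub>i\<close>, \<open>Im Z\<^sub>i\<close> to
  \<open>Re Z\<^sub>i\<close> and \<open>\<xi>\<close> to \<open>0\<close>. These \<open>2m + 1\<close> fields,
  numbered in this order and transported to the index type by \<open>h\<close>, are the frame.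
\<close>

lemma adapted_frame_exists: "\<exists>U E F. adapted_frame p U E F"
proof -
  obtain U Z where pU: "p \<in> U" and Z: "CR_frame U Z" using CR_frame_exists[of p] by blast
  note ZD = CR_frameD[OF Z]
  define E' where "E' k = (if k < m then re_field (Z k)
    else if k < 2 * m then im_field (Z (k - m)) else \<xi>)" for k
  define F' where "F' k = (if k < m then - im_field (Z k)
    else if k < 2 * m then re_field (Z (k - m)) else 0)" for k
  have VE: "VF (E' k)" and VF': "VF (F' k)" for k
    using cvector_fieldD[OF ZD(2)] vf_xi unfolding E'_def F'_def by (auto intro: vf_intros)
  have Zin: "Z k q \<in> H10 M q" if "k < m" "q \<in> U" for k q
  proof -
    have "Z k q = (\<lambda>f. \<Sum>i<m. of_bool (i = k) * Z i q f)"
      using that by (simp add: of_bool_def if_distrib[where f="\<lambda>c. c * _"] cong: if_cong)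
    then show ?thesis using H10_comb[OF Z that(2), of "\<lambda>i. of_bool (i = k)"] by (simp only:)
  qed
  have JE: "J q (E' k q) = F' k q" if "q \<in> U" for q k
  proof -
    consider "k < m" | "\<not> k < m" "k < 2 * m" "k - m < m" | "\<not> k < m" "\<not> k < 2 * m" by linarith
    then show ?thesis
    proof cases
      case 1
      then have "re_part (Z k q) \<in> Hor M q" using Zin[OF 1 that] by (simp add: Hor_eq)
      then show ?thesis using 1 Jb_re_part[OF Zin[OF 1 that]]
        by (simp add: E'_def F'_def re_field_eq J_Jb im_field_eq)
    next
      case 2
      then show ?thesis using Jb_im_part[OF Zin[OF 2(3) that]]
        by (simp add: E'_def F'_def re_field_eq J_Jb im_field_eq)
    next
      case 3
      then show ?thesis by (simp add: E'_def F'_def J_xi)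
    qed
  qed
  \<comment> \<open>A real combination of the \<open>Re Z\<^sub>k\<close> and \<open>Im Z\<^sub>k\<close> is the real part of the combination of the \<open>Z\<^sub>k\<close> with the conjugate coefficients; injectivity of the real part then gives independence.\<close>
  have comb: "(\<Sum>k<2 * m + 1. b k *\<^sub>R E' k p) =
      re_part (\<lambda>f. \<Sum>k<m. Complex (b k) (- b (m + k)) * Z k p f) + b (2 * m) *\<^sub>R \<xi> p" for b
    unfolding sum_lessThan_thirds
    by (simp add: fun_eq_iff E'_def re_field_eq im_field_eq sum.distrib)
  have comb_H10: "(\<lambda>f. \<Sum>k<m. c k * Z k p f) \<in> H10 M p" for c
    by (rule H10_comb[OF Z pU])
  have card: "CARD('n) = 2 * m + 1" using cr unfolding cr_manifold_def by blast
  obtain h where h: "bij_betw h (UNIV :: 'n set) {..<2 * m + 1}"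
    using ex_bij_betw_finite_nat[of "UNIV :: 'n set"] by (auto simp: card lessThan_atLeast0)
  define E where "E j = E' (h j)" for j
  have reindex: "(\<Sum>j\<in>UNIV. b (h j) *\<^sub>R E j p) = (\<Sum>k<2 * m + 1. b k *\<^sub>R E' k p)" for b
    unfolding E_def by (rule sum.reindex_bij_betw[OF h])
  have hlt: "h j < 2 * m + 1" for j using h by (auto simp: bij_betw_def)
  have frame: "tangent_frame (charts M) p E"
    unfolding tangent_frame_def
  proof (intro conjI allI ballI impI)
    show "VF (E j)" for j unfolding E_def by (rule VE)
  next
    fix a j assume s: "(\<Sum>j\<in>UNIV. a j *\<^sub>R E j p) = 0"
    define b where "b k = a (inv_into UNIV h k)" for k
    have bh: "b (h j) = a j" for j
      using h by (simp add: b_def bij_betw_def)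
    let ?z = "\<lambda>f. \<Sum>k<m. Complex (b k) (- b (m + k)) * Z k p f"
    have z: "?z \<in> H10 M p" by (rule comb_H10)
    then have zH: "re_part ?z \<in> Hor M p" by (simp add: Hor_eq)
    have s2: "re_part ?z + b (2 * m) *\<^sub>R \<xi> p = 0"
      using s reindex[of b] comb[of b] by (simp only: bh)
    have "b (2 * m) = th p (re_part ?z + b (2 * m) *\<^sub>R \<xi> p)"
      by (simp only: th_add[OF Hor_tan[OF zH] tan_closed(5)[OF xi_tan]] Hor_th[OF zH] th_scale[OF xi_tan] th_xi)
    then have b2: "b (2 * m) = 0" unfolding s2 th_zero .
    then have "re_part ?z = re_part (\<lambda>f. 0)" using s2 by (simp add: fun_eq_iff)
    then have "?z = (\<lambda>f. 0)" by (rule H10_real_part_inj[OF z H10_zero])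
    then have "Complex (b k) (- b (m + k)) = 0" if "k < m" for k
      using ZD(4)[OF pU _ that, of "\<lambda>k. Complex (b k) (- b (m + k))"] by (simp add: fun_eq_iff)
    then have b1: "b k = 0" "b (m + k) = 0" if "k < m" for k
      using that by (auto simp: complex_eq_iff)
    have "b (h j) = 0"
    proof -
      consider "h j < m" | "h j = m + (h j - m)" "h j - m < m" | "h j = 2 * m"
        using hlt[of j] by linarith
      then show ?thesis using b1 b2 by cases metis+
    qed
    then show "a j = 0" by (simp only: bh)
  next
    fix x assume x: "x \<in> TS p"
    have "hor p x \<in> Hor M p" using hor_Hor[OF x] .
    then obtain z where z: "z \<in> H10 M p" "hor p x = re_part z" unfolding Hor_eq by blast
    then obtain c where c: "z = (\<lambda>f. \<Sum>k<m. c k * Z k p f)" unfolding ZD(3)[OF pU] by blast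
    define b where "b k = (if k < m then Re (c k) else if k < 2 * m then - Im (c (k - m)) else th p x)" for k
    have "(\<lambda>f. \<Sum>k<m. Complex (b k) (- b (m + k)) * Z k p f) = z"
      unfolding c by (intro ext sum.cong refl) (simp add: b_def)
    then have "x = (\<Sum>k<2 * m + 1. b k *\<^sub>R E' k p)"
      unfolding comb using z(2) by (simp add: hor_eq b_def flip: z(2))
    then have "x = (\<Sum>j\<in>UNIV. b (h j) *\<^sub>R E j p)" by (simp only: reindex)
    then show "\<exists>a. x = (\<Sum>j\<in>UNIV. a j *\<^sub>R E j p)" by (rule exI[of _ "\<lambda>j. b (h j)"])
  qed
  show ?thesis
    unfolding adapted_frame_def
    by (intro exI[of _ U] exI[of _ E] exI[of _ "\<lambda>j. F' (h j)"]) (simp add: ZD(1) pU frame VF' JE E_def)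
qed

sublocale framed_manifold "charts M"
proof unfold_locales
  fix p
  show "\<exists>E. tangent_frame (charts M) p E"
    using adapted_frame_exists[of p] unfolding adapted_frame_def by blast
qed

definition JF :: "'a vfield \<Rightarrow> 'a vfield" where "JF X = (\<lambda>q. J q (X q))"

lemma JF_apply: "JF X q = J q (X q)"
  by (simp add: JF_def)

text \<open>
  Near \<open>p\<close>, if \<open>d X = \<Sum>\<^sub>j c\<^sub>j E\<^sub>j\<close> in an adapted frame,
  then \<open>JX = \<Sum>\<^sub>j (c\<^sub>j / d) F\<^sub>j\<close>.
\<close>

lemma vf_JF:
  assumes X: "VF X"
  shows "VF (JF X)"
  unfolding vector_field_def
proof (intro conjI allI impI)
  show "JF X q \<in> TS q" for q unfolding JF_apply by (rule J_tan[OF vf_at[OF X]])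
next
  fix h assume h: "Sm h"
  show "Sm (\<lambda>q. JF X q h)"
  proof (rule smooth_locally_quotient)
    fix p
    obtain U E F where "adapted_frame p U E F" using adapted_frame_exists[of p] by blast
    then have U: "open U" "p \<in> U" "tangent_frame (charts M) p E" "\<And>j. VF (F j)"
      "\<And>q j. q \<in> U \<Longrightarrow> J q (E j q) = F j q"
      unfolding adapted_frame_def by simp_all
    note E = tangent_frameD(1)[OF U(3)]
    obtain d c where "Sm d" "d p = 1" "\<And>X j. VF X \<Longrightarrow> Sm (c X j)"
      "\<And>X. VF X \<Longrightarrow> d \<odot> X = (\<Sum>j\<in>UNIV. c X j \<odot> E j)"
      "\<And>X j. VF X \<Longrightarrow> X p = 0 \<Longrightarrow> c X j p = 0"
      by (rule frame_expansion[OF U(3)]) blast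
    note dc = this
    have eq: "d q * JF X q h = (\<Sum>j\<in>UNIV. c X j q * F j q h)" if q: "q \<in> U" for q
    proof -
      have "d q *\<^sub>R JF X q = J q ((d \<odot> X) q)"
        by (simp only: JF_apply fmul_apply J_scale[OF vf_at[OF X]])
      also have "(d \<odot> X) q = (\<Sum>j\<in>UNIV. c X j q *\<^sub>R E j q)"
        unfolding dc(4)[OF X] by (simp only: sum_fun_apply fmul_apply)
      also have "J q \<dots> = (\<Sum>j\<in>UNIV. J q (c X j q *\<^sub>R E j q))"
        by (rule J_sum) (intro tan_closed vf_at E)
      also have "\<dots> = (\<Sum>j\<in>UNIV. c X j q *\<^sub>R F j q)"
        by (simp only: J_scale[OF vf_at[OF E]] U(5)[OF q])
      finally have "(d q *\<^sub>R JF X q) h = (\<Sum>j\<in>UNIV. c X j q *\<^sub>R F j q) h" by (rule fun_cong)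
      then show ?thesis by simp
    qed
    have sm: "Sm (\<lambda>q. \<Sum>j\<in>UNIV. c X j q * F j q h)"
      by (intro smooth_sum smooth_mult dc(3)[OF X] vf_smooth U(4))
    show "\<exists>U u v. open U \<and> p \<in> U \<and> Sm u \<and> Sm v \<and> v p \<noteq> 0 \<and>
        (\<forall>q\<in>U. v q * JF X q h = u q)"
      by (rule exI[of _ U], rule exI[of _ "\<lambda>q. \<Sum>j\<in>UNIV. c X j q * F j q h"], rule exI[of _ d])
        (simp add: U(1,2) dc(1,2) sm eq)
  qed
qed


section \<open>The exterior derivative of the contact form and the Webster metric\<close>

text \<open>
  The exterior derivative of \<open>\<theta>\<close> is used in two forms: \<open>om\<close> on vector fields and, by
  tensoriality, \<open>Om\<close> on tangent vectors.
\<close>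

abbreviation om :: "'a vfield \<Rightarrow> 'a vfield \<Rightarrow> 'a \<Rightarrow> real" where "om \<equiv> dform th"

lemma om_smooth: "VF X \<Longrightarrow> VF Y \<Longrightarrow> Sm (om X Y)"
proof -
  assume X: "VF X" and Y: "VF Y"
  have "Sm (\<lambda>p. 1/2 * (X p (\<lambda>q. th q (Y q)) - Y p (\<lambda>q. th q (X q)) - th p (bracket X Y p)))"
    by (intro smooth_mult smooth_diff smooth_const vf_smooth th_smooth vf_bracket X Y)
  then show ?thesis by (simp add: dform_def[abs_def])
qed

lemma om_commute: "VF X \<Longrightarrow> VF Y \<Longrightarrow> om X Y p = - om Y X p"
  using th_minus[OF vf_at[OF vf_bracket], of Y X p] bracket_commute[of X Y]
  by (simp add: dform_def field_simps)

lemma om_add_left: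
  assumes X: "VF X" and X': "VF X'" and Y: "VF Y"
  shows "om (X + X') Y p = om X Y p + om X' Y p"
proof -
  have t: "(\<lambda>q. th q ((X + X') q)) = (\<lambda>q. th q (X q) + th q (X' q))"
    using th_add[OF vf_at[OF X] vf_at[OF X']] by (simp add: plus_fun_def)
  have "bracket (X + X') Y p = bracket X Y p + bracket X' Y p"
    unfolding bracket_add_left[OF X X' Y] by simp
  then show ?thesis
    unfolding dform_def t tan_add[OF vf_at[OF Y] th_smooth[OF X] th_smooth[OF X']]
    using th_add[OF vf_at[OF vf_bracket[OF X Y]] vf_at[OF vf_bracket[OF X' Y]], of p]
    by (simp add: field_simps)
qed

lemma om_fmul_left:
  assumes X: "VF X" and Y: "VF Y" and f: "Sm f"
  shows "om (f \<odot> X) Y p = f p * om X Y p"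
proof -
  have t: "(\<lambda>q. th q ((f \<odot> X) q)) = (\<lambda>q. f q * th q (X q))"
    by (simp only: fmul_apply th_scale[OF vf_at[OF X]])
  have "bracket (f \<odot> X) Y p = f p *\<^sub>R bracket X Y p - Y p f *\<^sub>R X p"
    unfolding bracket_fmul_left[OF X Y f] by simp
  then have "th p (bracket (f \<odot> X) Y p) = f p * th p (bracket X Y p) - Y p f * th p (X p)"
    by (simp only: th_diff[OF tan_closed(5) tan_closed(5)] th_scale vf_at X vf_bracket[OF X Y])
  then show ?thesis
    unfolding dform_def t tan_mult[OF vf_at[OF Y] f th_smooth[OF X]]
    by (simp add: field_simps)
qed

lemma om_add_right:
  "VF X \<Longrightarrow> VF Y \<Longrightarrow> VF Y' \<Longrightarrow> om X (Y + Y') p = om X Y p + om X Y' p"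
  using om_add_left[of Y Y' X p] om_commute[of X] vf_add by simp

lemma om_fmul_right:
  "VF X \<Longrightarrow> VF Y \<Longrightarrow> Sm f \<Longrightarrow> om X (f \<odot> Y) p = f p * om X Y p"
  using om_fmul_left[of Y X f p] om_commute[of X] vf_fmul by simp

lemma om_local:
  assumes "VF X" "VF X'" "VF Y" "VF Y'" "X p = X' p" "Y p = Y' p"
  shows "om X Y p = om X' Y' p"
proof -
  have "om X Y p = om X' Y p"
    by (rule tensor_at[of "\<lambda>X. om X Y p"])
      (use assms in \<open>auto simp: om_add_left om_fmul_left\<close>)
  also have "\<dots> = om X' Y' p"
    by (rule tensor_at[of "\<lambda>Y. om X' Y p"])
      (use assms in \<open>auto simp: om_add_right om_fmul_right\<close>)
  finally show ?thesis .
qed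

abbreviation "Om \<equiv> dtheta M"

lemma Om_fields: "VF X \<Longrightarrow> VF Y \<Longrightarrow> Om p (X p) (Y p) = om X Y p"
  unfolding dtheta_def using ext_field[OF vf_at]
  by (intro om_local) auto

lemma Om_lin_left:
  assumes x: "x \<in> TS p" and x': "x' \<in> TS p" and y: "y \<in> TS p"
  shows "Om p (a *\<^sub>R x + b *\<^sub>R x') y = a * Om p x y + b * Om p x' y"
proof -
  obtain X where X: "VF X" "X p = x" by (rule field_through[OF x])
  obtain X' where X': "VF X'" "X' p = x'" by (rule field_through[OF x'])
  obtain Y where Y: "VF Y" "Y p = y" by (rule field_through[OF y])
  let ?aX = "(\<lambda>q. a) \<odot> X" and ?bX = "(\<lambda>q. b) \<odot> X'"
  have v: "VF ?aX" "VF ?bX" "VF (?aX + ?bX)" by (intro vf_intros smooth_const X X')+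
  have "Om p ((?aX + ?bX) p) (Y p) = a * om X Y p + b * om X' Y p"
    unfolding Om_fields[OF v(3) Y(1)] om_add_left[OF v(1,2) Y(1)]
    by (simp add: om_fmul_left X X' Y smooth_const)
  then show ?thesis
    using Om_fields[OF X(1) Y(1), of p] Om_fields[OF X'(1) Y(1), of p] by (simp add: X X' Y)
qed

lemma Om_commute:
  assumes x: "x \<in> TS p" and y: "y \<in> TS p"
  shows "Om p x y = - Om p y x"
  using om_commute[OF ext_field(1)[OF x] ext_field(1)[OF y]] unfolding dtheta_def .

lemma Om_xi: 
  assumes x: "x \<in> TS p" shows "Om p (\<xi> p) x = 0" "Om p x (\<xi> p) = 0"
proof -
  obtain X where X: "VF X" "X p = x" by (rule field_through[OF x])
  have "om \<xi> X p = 0" using reeb X(1) unfolding reeb_field_def by blast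
  then show "Om p (\<xi> p) x = 0" using Om_fields[OF vf_xi X(1)] X(2) by metis
  then show "Om p x (\<xi> p) = 0" using Om_commute[OF x xi_tan] by simp
qed

lemma Om_lin_right:
  assumes x: "x \<in> TS p" and y: "y \<in> TS p" and y': "y' \<in> TS p"
  shows "Om p x (a *\<^sub>R y + b *\<^sub>R y') = a * Om p x y + b * Om p x y'"
proof -
  have "Om p x (a *\<^sub>R y + b *\<^sub>R y') = - Om p (a *\<^sub>R y + b *\<^sub>R y') x"
    by (rule Om_commute) (intro tan_closed assms)+
  then show ?thesis
    using Om_lin_left[OF y y' x, of a b] Om_commute[OF x y] Om_commute[OF x y'] by simp
qed

lemma Om_simps:
  assumes x: "x \<in> TS p" and y: "y \<in> TS p" and z: "z \<in> TS p"
  shows "Om p (x + y) z = Om p x z + Om p y z" "Om p (x - y) z = Om p x z - Om p y z"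
    "Om p x (y + z) = Om p x y + Om p x z" "Om p x (y - z) = Om p x y - Om p x z"
  using Om_lin_left[OF x y z, of 1 1] Om_lin_left[OF x y z, of 1 "-1"]
    Om_lin_right[OF x y z, of 1 1] Om_lin_right[OF x y z, of 1 "-1"] by simp_all

lemma Om_simps2:
  assumes x: "x \<in> TS p" and y: "y \<in> TS p"
  shows "Om p (a *\<^sub>R x) y = a * Om p x y" "Om p (- x) y = - Om p x y"
    "Om p x (a *\<^sub>R y) = a * Om p x y" "Om p x (- y) = - Om p x y"
    "Om p 0 y = 0" "Om p x 0 = 0"
  using Om_lin_left[OF x x y, of _ 0] Om_lin_left[OF x x y, of "-1" 0]
    Om_lin_right[OF x y y, of _ 0] Om_lin_right[OF x y y, of "-1" 0]
    Om_lin_left[OF x x y, of 0 0] Om_lin_right[OF x y y, of 0 0] by simp_all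

subsection \<open>Integrability of the CR structure\<close>

definition cfield :: "'a vfield \<Rightarrow> 'a vfield \<Rightarrow> 'a cvfield" where
  "cfield X Y = (\<lambda>q f. Complex (X q f) (Y q f))"

lemma cfield_parts [simp]:
  "re_field (cfield X Y) = X" "im_field (cfield X Y) = Y"
  "re_part (cfield X Y q) = X q" "im_part (cfield X Y q) = Y q"
  by (simp_all add: cfield_def re_field_def im_field_def fun_eq_iff)

lemma cext_cfield:
  "cext B (cfield X Y) (cfield X' Y') = cfield (B X X' - B Y Y') (B X Y' + B Y X')"
  by (simp add: cext_def) (simp add: cfield_def fun_eq_iff)

definition hor_field :: "'a vfield \<Rightarrow> bool" where
  "hor_field X \<longleftrightarrow> VF X \<and> (\<forall>q. th q (X q) = 0)"

lemma hor_field_VF: "hor_field X \<Longrightarrow> VF X" and hor_field_th: "hor_field X \<Longrightarrow> th q (X q) = 0"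
  by (auto simp: hor_field_def)

lemma hor_field_Hor: "hor_field X \<longleftrightarrow> VF X \<and> (\<forall>q. X q \<in> Hor M q)"
  using vf_at by (auto simp: hor_field_def Hor_iff)

lemma hor_field_JF: "VF X \<Longrightarrow> hor_field (JF X)"
  by (simp add: hor_field_def vf_JF th_J vf_at JF_apply)

lemma JF_JF: "hor_field X \<Longrightarrow> JF (JF X) = - X"
  by (simp add: fun_eq_iff JF_apply J_J[OF vf_at[OF hor_field_VF]] hor_field_th)

lemma JF_minus: "VF X \<Longrightarrow> JF (- X) = - JF X"
  by (rule ext) (simp only: JF_apply uminus_apply J_minus[OF vf_at])

lemma H10_section_iff:
  "ctsection (charts M) (H10 M) (cfield X Y) \<longleftrightarrow> hor_field X \<and> Y = - JF X"
proof -
  have "(\<forall>q. cfield X Y q \<in> H10 M q) \<longleftrightarrow> (\<forall>q. X q \<in> Hor M q) \<and> Y = - JF X"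
  proof -
    have "cfield X Y q \<in> H10 M q \<longleftrightarrow> X q \<in> Hor M q \<and> Y q = (- JF X) q" for q
      unfolding H10_iff cfield_parts using J_Jb[of "X q" q] by (auto simp: JF_apply)
    then show ?thesis by (auto simp only: fun_eq_iff[of Y])
  qed
  then show ?thesis
    unfolding ctsection_def cvector_field_def cfield_parts hor_field_Hor
    by (auto intro: vf_intros vf_JF)
qed

text \<open>
  Real and imaginary part of the bracket of \<open>X - \<i> JX\<close> and \<open>Y - \<i> JY\<close>,
  which is again a section of \<open>H10\<close>.
\<close>

lemma integrability:
  assumes X: "hor_field X" and Y: "hor_field Y"
  shows "hor_field (bracket X Y - bracket (JF X) (JF Y))"
    and "JF (bracket X Y - bracket (JF X) (JF Y)) = bracket X (JF Y) + bracket (JF X) Y"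
proof -
  have "ctsection (charts M) (H10 M) (cext bracket (cfield X (- JF X)) (cfield Y (- JF Y)))"
    using cr X Y unfolding cr_manifold_def by (auto simp: H10_section_iff)
  then have R: "hor_field (bracket X Y - bracket (- JF X) (- JF Y))"
    "bracket X (- JF Y) + bracket (- JF X) Y = - JF (bracket X Y - bracket (- JF X) (- JF Y))"
    unfolding cext_cfield H10_section_iff by blast+
  have mr: "bracket V (- W) = - bracket V W" if "VF V" "VF W" for V W
    using bracket_fmul_right[OF that smooth_const[of "-1"]] tan_const[OF vf_at[OF that(1)], of _ "-1"]
    by (simp add: fmul_def fun_eq_iff bracket_def)
  have ml: "bracket (- V) W = - bracket V W" if "VF V" "VF W" for V W
    using mr[OF that(2,1)] by (simp add: bracket_commute[of _ W])
  note v = hor_field_VF[OF X] hor_field_VF[OF Y] vf_JF[OF hor_field_VF[OF X]] vf_JF[OF hor_field_VF[OF Y]]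
  have 1: "bracket (- JF X) (- JF Y) = bracket (JF X) (JF Y)"
    using ml[OF v(3) vf_minus[OF v(4)]] mr[OF v(3,4)] by simp
  show "hor_field (bracket X Y - bracket (JF X) (JF Y))" using R(1) unfolding 1 .
  have "- (bracket X (JF Y) + bracket (JF X) Y) = - JF (bracket X Y - bracket (JF X) (JF Y))"
    using R(2) unfolding 1 mr[OF v(1,4)] ml[OF v(3,2)] by simp
  then show "JF (bracket X Y - bracket (JF X) (JF Y)) = bracket X (JF Y) + bracket (JF X) Y"
    by (metis neg_equal_iff_equal)
qed

lemma th_bracket:
  assumes X: "hor_field X" and Y: "hor_field Y"
  shows "th q (bracket X Y q) = - 2 * om X Y q"
  using tan_zero[OF vf_at[OF hor_field_VF[OF X]]] tan_zero[OF vf_at[OF hor_field_VF[OF Y]]]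
  by (simp add: dform_def hor_field_th X Y)

text \<open>
  On horizontal fields \<open>2 d\<theta>(X, Y) = - \<theta>([X, Y])\<close>, and
  \<open>[X, Y] - [JX, JY]\<close> is horizontal by integrability.
\<close>

lemma om_J:
  assumes X: "hor_field X" and Y: "hor_field Y"
  shows "om (JF X) (JF Y) p = om X Y p"
proof -
  note JX = hor_field_JF[OF hor_field_VF[OF X]] and JY = hor_field_JF[OF hor_field_VF[OF Y]]
  have "th p (bracket X Y p - bracket (JF X) (JF Y) p) = 0"
    using hor_field_th[OF integrability(1)[OF X Y], of p] by simp
  then have "th p (bracket X Y p) = th p (bracket (JF X) (JF Y) p)"
    using th_diff[OF vf_at[OF vf_bracket] vf_at[OF vf_bracket]] X Y JX JY by (simp add: hor_field_VF)
  then show ?thesis using th_bracket[OF X Y, of p] th_bracket[OF JX JY, of p] by simp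
qed

text \<open>
  Any extension \<open>X\<close> of \<open>x\<close> can be replaced by its horizontal part, which is
  \<open>- J (J X)\<close>.
\<close>

lemma horizontal_extension:
  assumes x: "x \<in> Hor M p"
  obtains X where "hor_field X" "X p = x"
proof -
  obtain X where X: "VF X" "X p = x" by (rule field_through[OF Hor_tan[OF x]])
  have JX: "VF (JF X)" by (rule vf_JF[OF X(1)])
  have 1: "hor_field (- JF (JF X))" using hor_field_JF[OF vf_minus[OF JX]] by (simp only: JF_minus[OF JX])
  have "(- JF (JF X)) p = x"
    using J_J[OF Hor_tan[OF x]] Hor_th[OF x] by (simp add: JF_apply X(2))
  with 1 show ?thesis by (rule that)
qed

lemma Om_J:
  assumes x: "x \<in> TS p" and y: "y \<in> TS p"
  shows "Om p (J p x) (J p y) = Om p x y"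
proof -
  obtain X where X: "hor_field X" "X p = hor p x" by (rule horizontal_extension[OF hor_Hor[OF x]])
  obtain Y where Y: "hor_field Y" "Y p = hor p y" by (rule horizontal_extension[OF hor_Hor[OF y]])
  have "J p (hor p z) = J p z" if "z \<in> TS p" for z
    using J_Jb[OF hor_Hor[OF that]] by (simp add: Jend_def)
  then have "Om p (J p x) (J p y) = Om p (JF X p) (JF Y p)" using X Y x y by (simp add: JF_apply)
  also have "\<dots> = Om p (hor p x) (hor p y)"
    using om_J[OF X(1) Y(1), of p] Om_fields[of X Y p] Om_fields[of "JF X" "JF Y" p] X Y
    by (simp add: hor_field_VF vf_JF)
  also have "\<dots> = Om p x y"
    unfolding hor_eq using x y xi_tan
    by (simp add: Om_simps Om_simps2 tan_closed Om_xi)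
  finally show ?thesis .
qed

subsection \<open>The metric\<close>

abbreviation "g \<equiv> webster M \<xi>"

lemma g_eq:
  assumes x: "x \<in> TS p" and y: "y \<in> TS p"
  shows "g p x y = Om p x (J p y) + th p x * th p y"
proof -
  have "levi M p (hor p x) (hor p y) = Om p (x - th p x *\<^sub>R \<xi> p) (J p y)"
    by (simp add: levi_def Jend_def hor_eq)
  also have "\<dots> = Om p x (J p y)"
    using x y xi_tan J_tan[OF y] by (simp add: Om_simps Om_simps2 tan_closed Om_xi)
  finally show ?thesis by (simp add: webster_def)
qed

lemma g_sym:
  assumes x: "x \<in> TS p" and y: "y \<in> TS p"
  shows "g p x y = g p y x"
proof -
  have "Om p x (J p y) = Om p (J p x) (J p (J p y))" by (simp add: Om_J x y J_tan)
  also have "\<dots> = - Om p (J p x) y"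
    using x y xi_tan J_tan[OF x] by (simp add: J_J Om_simps Om_simps2 tan_closed Om_xi)
  also have "\<dots> = Om p y (J p x)" using Om_commute[OF y J_tan[OF x]] by simp
  finally show ?thesis by (simp add: g_eq x y)
qed

lemma g_lin_left:
  "x \<in> TS p \<Longrightarrow> x' \<in> TS p \<Longrightarrow> y \<in> TS p \<Longrightarrow> g p (a *\<^sub>R x + b *\<^sub>R x') y = a * g p x y + b * g p x' y"
  by (simp add: g_eq tan_closed J_tan Om_lin_left th_add th_scale algebra_simps)

lemma g_lin_right:
  "x \<in> TS p \<Longrightarrow> y \<in> TS p \<Longrightarrow> y' \<in> TS p \<Longrightarrow> g p x (a *\<^sub>R y + b *\<^sub>R y') = a * g p x y + b * g p x y'"
  using g_lin_left[of y p y' x a b] g_sym tan_closed(2,5) by metis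

lemma g_xi: "x \<in> TS p \<Longrightarrow> g p x (\<xi> p) = th p x"
  using xi_tan by (simp add: g_eq J_xi th_xi Om_simps2)

lemma g_J: "x \<in> Hor M p \<Longrightarrow> y \<in> Hor M p \<Longrightarrow> g p (J p x) (J p y) = g p x y"
  by (simp add: g_eq Hor_tan J_tan Om_J th_J Hor_th)

lemma g_x_Jx: "x \<in> Hor M p \<Longrightarrow> g p x (J p x) = 0"
proof -
  assume x: "x \<in> Hor M p"
  have "g p x (J p x) = g p (J p x) (J p (J p x))" using g_J[OF x J_Hor[OF Hor_tan[OF x]]] by simp
  also have "\<dots> = - g p (J p x) x"
    using g_lin_right[of "J p x" p x x "-1" 0] x
    by (simp add: J_J Hor_th Hor_tan J_tan)
  finally show ?thesis using g_sym[of x p "J p x"] x by (simp add: Hor_tan J_tan)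
qed

lemma g_definite:
  assumes x: "x \<in> TS p" and z: "g p x x = 0"
  shows "x = 0"
proof -
  have "hor p x = 0"
  proof (rule ccontr)
    assume "hor p x \<noteq> 0"
    then have "levi M p (hor p x) (hor p x) > 0"
      using levi_pos hor_Hor[OF x] unfolding levi_positive_def by (simp add: zero_fun_def)
    then show False using z unfolding webster_def by (smt (verit) zero_le_square)
  qed
  then have "levi M p (hor p x) (hor p x) = 0"
    using J_Jb[OF Hor_closed(1)] J_zero[of p] Om_simps2(5)[OF tan_closed(1) tan_closed(1), of p]
    by (simp add: levi_def)
  then have "th p x = 0" using z unfolding webster_def by simp
  then show ?thesis using \<open>hor p x = 0\<close> by (simp add: hor_eq)
qed

lemma g_smooth:
  assumes X: "VF X" and Y: "VF Y"
  shows "Sm (\<lambda>q. g q (X q) (Y q))"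
proof -
  have "(\<lambda>q. g q (X q) (Y q)) = (\<lambda>q. om X (JF Y) q + th q (X q) * th q (Y q))"
    using Om_fields[OF X vf_JF[OF Y]] by (simp add: fun_eq_iff g_eq vf_at X Y JF_apply)
  then show ?thesis by (simp only:) (intro smooth_add smooth_mult th_smooth om_smooth vf_JF X Y)
qed


section \<open>The canonical connection\<close>

lemma lin: "linear_connection (charts M) D"
  using canonical unfolding canonical_connection_def by blast

lemma vf_D: "VF X \<Longrightarrow> VF Y \<Longrightarrow> VF (D X Y)"
  using lin unfolding linear_connection_def by blast

lemma D_lin_left:
  assumes "VF X" "VF X'" "VF Y" "Sm f" "Sm h"
  shows "D (f \<odot> X + h \<odot> X') Y = f \<odot> D X Y + h \<odot> D X' Y"
proof -
  have "D (\<lambda>p k. f p * X p k + h p * X' p k) Y = (\<lambda>p k. f p * D X Y p k + h p * D X' Y p k)"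
    using lin assms unfolding linear_connection_def by blast
  moreover have "f \<odot> V + h \<odot> V' = (\<lambda>p k. f p * V p k + h p * V' p k)" for V V'
    by (simp add: fun_eq_iff)
  ultimately show ?thesis by (simp only:)
qed

lemma fmul_zero: "(\<lambda>_. 0) \<odot> X = 0"
  by (simp add: fun_eq_iff)

lemma D_add_left: "VF X \<Longrightarrow> VF X' \<Longrightarrow> VF Y \<Longrightarrow> D (X + X') Y = D X Y + D X' Y"
  using D_lin_left[of X X' Y "\<lambda>_. 1" "\<lambda>_. 1"] by (simp add: smooth_const fmul_def)

lemma D_diff_left: "VF X \<Longrightarrow> VF X' \<Longrightarrow> VF Y \<Longrightarrow> D (X - X') Y = D X Y - D X' Y"
  using D_add_left[of "X - X'" X' Y] vf_diff by (simp add: algebra_simps)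

lemma D_fmul_left: "VF X \<Longrightarrow> VF Y \<Longrightarrow> Sm f \<Longrightarrow> D (f \<odot> X) Y = f \<odot> D X Y"
  using D_lin_left[of X X Y f "\<lambda>_. 0"] by (simp only: smooth_const fmul_zero add_0_right)

lemma D_add_right:
  assumes "VF X" "VF Y" "VF Y'"
  shows "D X (Y + Y') = D X Y + D X Y'"
proof -
  have "D X (\<lambda>p h. Y p h + Y' p h) = (\<lambda>p h. D X Y p h + D X Y' p h)"
    using lin assms unfolding linear_connection_def by blast
  then show ?thesis by (simp add: plus_fun_def)
qed

lemma D_fmul_right:
  assumes "VF X" "VF Y" "Sm f"
  shows "D X (f \<odot> Y) = (\<lambda>p. X p f) \<odot> Y + f \<odot> D X Y"
proof -
  have "D X (\<lambda>p h. f p * Y p h) = (\<lambda>p h. X p f * Y p h + f p * D X Y p h)"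
    using lin assms unfolding linear_connection_def by blast
  then show ?thesis by (simp add: plus_fun_def fmul_def scaleR_fun_def)
qed

lemma D_zero_left: "VF Y \<Longrightarrow> D 0 Y = 0"
  using D_add_left[of 0 0 Y] vf_zero by simp

lemma D_zero_right: "VF X \<Longrightarrow> D X 0 = 0"
  using D_add_right[of X 0 0] vf_zero by simp

lemma D_diff_right: "VF X \<Longrightarrow> VF Y \<Longrightarrow> VF Y' \<Longrightarrow> D X (Y - Y') = D X Y - D X Y'"
  using D_add_right[of X "Y - Y'" Y'] vf_diff by (simp add: algebra_simps)

lemma D_minus_right: "VF X \<Longrightarrow> VF Y \<Longrightarrow> D X (- Y) = - D X Y"
  using D_diff_right[of X 0 Y] D_zero_right[of X] vf_zero by simp

lemma D_minus_left: "VF X \<Longrightarrow> VF Y \<Longrightarrow> D (- X) Y = - D X Y"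
  using D_diff_left[of 0 X Y] D_zero_left[of Y] vf_zero by simp

lemma D_metric:
  "VF X \<Longrightarrow> VF Y \<Longrightarrow> VF Z \<Longrightarrow>
    X p (\<lambda>q. g q (Y q) (Z q)) = g p (D X Y p) (Z p) + g p (Y p) (D X Z p)"
  using canonical unfolding canonical_connection_def parallel_metric_def by blast

text \<open>
  Apply \<open>D\<close> to the section \<open>Y - \<i> JY\<close> of \<open>H10\<close>, which it preserves.
\<close>

lemma D_H10:
  assumes X: "VF X" and Y: "hor_field Y"
  shows "hor_field (D X Y)" "D X (JF Y) = JF (D X Y)"
proof -
  have "preserves (charts M) D (H10 M)"
    using canonical unfolding canonical_connection_def by blast
  moreover have "cvector_field (charts M) (cfield X 0)"
    unfolding cvector_field_def cfield_parts using X vf_zero by blast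
  moreover have "ctsection (charts M) (H10 M) (cfield Y (- JF Y))"
    using Y by (simp only: H10_section_iff)
  ultimately have "ctsection (charts M) (H10 M) (cext D (cfield X 0) (cfield Y (- JF Y)))"
    unfolding preserves_def by blast
  then have R: "hor_field (D X Y - D 0 (- JF Y))" "D X (- JF Y) + D 0 Y = - JF (D X Y - D 0 (- JF Y))"
    unfolding cext_cfield H10_section_iff by blast+
  note v = hor_field_VF[OF Y] vf_JF[OF hor_field_VF[OF Y]]
  show "hor_field (D X Y)" using R(1) D_zero_left[OF vf_minus[OF v(2)]] by simp
  have "- D X (JF Y) = - JF (D X Y)"
    using R(2) D_zero_left[OF vf_minus[OF v(2)]] D_zero_left[OF v(1)] D_minus_right[OF X v(2)]
    by simp
  then show "D X (JF Y) = JF (D X Y)" by (simp only: neg_equal_iff_equal)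
qed

text \<open>
  Preservation of \<open>\<complex> \<xi>\<close> makes \<open>D X \<xi>\<close> a multiple of
  \<open>\<xi>\<close>, and the multiple is zero because \<open>\<xi>\<close> has constant length.
\<close>

lemma D_xi:
  assumes X: "VF X"
  shows "D X \<xi> = 0"
proof -
  have "preserves (charts M) D (Creeb \<xi>)"
    using canonical unfolding canonical_connection_def by blast
  moreover have "cvector_field (charts M) (cfield X 0)"
    unfolding cvector_field_def cfield_parts using X vf_zero by blast
  moreover have "ctsection (charts M) (Creeb \<xi>) (cfield \<xi> 0)"
    unfolding ctsection_def cvector_field_def cfield_parts Creeb_def
    using vf_xi vf_zero by (auto simp: cfield_def complex_eq_iff intro!: exI[of _ 1])
  ultimately have "ctsection (charts M) (Creeb \<xi>) (cext D (cfield X 0) (cfield \<xi> 0))"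
    unfolding preserves_def by blast
  then have C: "cfield (D X \<xi> - D 0 0) (D X 0 + D 0 \<xi>) q \<in> Creeb \<xi> q" for q
    unfolding cext_cfield ctsection_def by blast
  have par: "\<exists>c. D X \<xi> q = c *\<^sub>R \<xi> q" for q
  proof -
    obtain c where "cfield (D X \<xi> - D 0 0) (D X 0 + D 0 \<xi>) q = (\<lambda>f. c * complex_of_real (\<xi> q f))"
      using C[of q] unfolding Creeb_def by blast
    from arg_cong[OF this, of re_part]
    have "(D X \<xi> - D 0 0) q = re_part (\<lambda>f. c * complex_of_real (\<xi> q f))"
      by (simp only: cfield_parts)
    also have "\<dots> = Re c *\<^sub>R \<xi> q" by (simp add: fun_eq_iff)
    finally show ?thesis unfolding D_zero_left[OF vf_zero] by auto
  qed
  show ?thesis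
  proof
    fix q
    obtain c where c: "D X \<xi> q = c *\<^sub>R \<xi> q" using par by blast
    have "(\<lambda>q. g q (\<xi> q) (\<xi> q)) = (\<lambda>q. 1)" by (simp add: g_xi xi_tan th_xi)
    then have "0 = g q (D X \<xi> q) (\<xi> q) + g q (\<xi> q) (D X \<xi> q)"
      using D_metric[OF X vf_xi vf_xi, of q] tan_const[OF vf_at[OF X], of q 1] by simp
    also have "\<dots> = 2 * c"
      using g_lin_left[OF xi_tan xi_tan xi_tan, of q c 0] g_lin_right[OF xi_tan xi_tan xi_tan, of q c 0]
      by (simp add: c g_xi xi_tan th_xi)
    finally show "D X \<xi> q = 0 q" using c by simp
  qed
qed

lemma th_D:
  assumes X: "VF X" and Y: "VF Y"
  shows "th q (D X Y q) = X q (\<lambda>q. th q (Y q))"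
proof -
  have "g q (Y q) (D X \<xi> q) = 0"
    using D_xi[OF X] g_lin_right[OF vf_at[OF Y] xi_tan xi_tan, of q 0 0] by simp
  then show ?thesis
    using D_metric[OF X Y vf_xi, of q] g_xi[OF vf_at[OF Y]] g_xi[OF vf_at[OF vf_D[OF X Y]]] by simp
qed

definition hor_part :: "'a vfield \<Rightarrow> 'a vfield" where "hor_part X = X - (\<lambda>q. th q (X q)) \<odot> \<xi>"

lemma hor_part_apply: "hor_part X q = hor q (X q)"
  by (simp add: hor_part_def hor_eq)

lemma hor_field_hor_part: "VF X \<Longrightarrow> hor_field (hor_part X)"
  using hor_Hor[OF vf_at] by (simp add: hor_field_Hor hor_part_apply) (simp add: hor_part_def vf_diff vf_fmul th_smooth vf_xi)

lemma hor_part_decomp: "X = hor_part X + (\<lambda>q. th q (X q)) \<odot> \<xi>"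
  by (simp add: hor_part_def)

lemma J_hor: "x \<in> TS p \<Longrightarrow> J p (hor p x) = J p x"
  using J_Jb[OF hor_Hor] by (simp add: Jend_def)

text \<open>
  On horizontal fields this is \<open>D_H10\<close>; the component along \<open>\<xi>\<close> is killed by
  \<open>J\<close> before and after differentiation.
\<close>

lemma D_JF:
  assumes X: "VF X" and Y: "VF Y"
  shows "D X (JF Y) = JF (D X Y)"
proof -
  have eq: "JF Y = JF (hor_part Y)"
    by (rule ext) (simp only: JF_apply hor_part_apply J_hor[OF vf_at[OF Y]])
  have "D X Y = D X (hor_part Y) + D X ((\<lambda>q. th q (Y q)) \<odot> \<xi>)"
    using D_add_right[OF X hor_field_VF[OF hor_field_hor_part[OF Y]] vf_fmul[OF th_smooth[OF Y] vf_xi]] hor_part_decomp[of Y]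
    by simp
  also have "D X ((\<lambda>q. th q (Y q)) \<odot> \<xi>) = (\<lambda>p. X p (\<lambda>q. th q (Y q))) \<odot> \<xi>"
    using D_fmul_right[OF X vf_xi th_smooth[OF Y]] D_xi[OF X] by (simp add: fun_eq_iff)
  finally have d: "D X Y = D X (hor_part Y) + (\<lambda>p. X p (\<lambda>q. th q (Y q))) \<odot> \<xi>" .
  have "JF (D X Y) = JF (D X (hor_part Y))"
  proof
    fix q
    have h: "D X (hor_part Y) q \<in> TS q" by (intro vf_at vf_D X hor_field_VF hor_field_hor_part Y)
    have "D X Y q = D X (hor_part Y) q + X q (\<lambda>q. th q (Y q)) *\<^sub>R \<xi> q"
      using d by (simp only: plus_fun_apply fmul_apply)
    then show "JF (D X Y) q = JF (D X (hor_part Y)) q"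
      by (simp add: JF_apply J_add h tan_closed xi_tan J_scale J_xi)
  qed
  then show ?thesis using D_H10(2)[OF X hor_field_hor_part[OF Y]] eq by simp
qed

text \<open>
  The metric and \<open>J\<close> are parallel, and
  \<open>d\<theta>(Y, Z) = - \<langle>Y, JZ\<rangle>\<close>.
\<close>

lemma om_parallel:
  assumes X: "VF X" and Y: "VF Y" and Z: "VF Z"
  shows "X p (om Y Z) = om (D X Y) Z p + om Y (D X Z) p"
proof -
  have gJ: "g q (V q) (JF W q) = - om V W q" if V: "VF V" and W: "VF W" for V W q
  proof -
    have "g q (V q) (JF W q) = Om q (V q) (th q (W q) *\<^sub>R \<xi> q - W q)"
      using vf_at[OF V] vf_at[OF W] by (simp add: g_eq JF_apply J_tan th_J J_J)
    also have "\<dots> = - Om q (V q) (W q)"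
      using vf_at[OF V] vf_at[OF W] xi_tan by (simp add: Om_simps Om_simps2 tan_closed Om_xi)
    finally show ?thesis using Om_fields[OF V W] by simp
  qed
  note JZ = vf_JF[OF Z]
  have "X p (\<lambda>q. - om Y Z q) = - om (D X Y) Z p - om Y (D X Z) p"
    using D_metric[OF X Y JZ, of p] D_JF[OF X Z] gJ[OF Y Z] gJ[OF vf_D[OF X Y] Z] gJ[OF Y vf_D[OF X Z]]
    by simp
  then show ?thesis using tan_minus[OF vf_at[OF X] om_smooth[OF Y Z], of p] by simp
qed

text \<open>
  This is \<open>d d\<theta> = 0\<close>: the second derivatives of the functions \<open>\<theta>(X)\<close>
  combine to brackets, and the remaining terms are \<open>\<theta>\<close> of the Jacobi sum.
\<close>

lemma om_closed:
  assumes X: "VF X" and Y: "VF Y" and Z: "VF Z"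
  shows "X p (om Y Z) + Y p (om Z X) + Z p (om X Y)
    = om (bracket X Y) Z p + om (bracket Y Z) X p + om (bracket Z X) Y p"
proof -
  have ex: "V p (om W U) = 1/2 * (V p (\<lambda>q. W q (\<lambda>r. th r (U r))) - V p (\<lambda>q. U q (\<lambda>r. th r (W r)))
      - V p (\<lambda>q. th q (bracket W U q)))" if V: "VF V" and W: "VF W" and U: "VF U" for V W U
  proof -
    have 1: "Sm (\<lambda>q. W q (\<lambda>r. th r (U r)))" "Sm (\<lambda>q. U q (\<lambda>r. th r (W r)))" "Sm (\<lambda>q. th q (bracket W U q))"
      by (intro vf_smooth th_smooth vf_bracket W U)+
    have "om W U = (\<lambda>q. 1/2 * (W q (\<lambda>r. th r (U r)) - U q (\<lambda>r. th r (W r)) - th q (bracket W U q)))"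
      by (simp add: dform_def fun_eq_iff)
    then show ?thesis
      using tan_cmul[OF vf_at[OF V] smooth_diff[OF smooth_diff[OF 1(1,2)] 1(3)], of p "1/2"]
        tan_diff[OF vf_at[OF V] smooth_diff[OF 1(1,2)] 1(3), of p] tan_diff[OF vf_at[OF V] 1(1,2), of p]
      by simp
  qed
  note b = vf_bracket[OF X Y] vf_bracket[OF Y Z] vf_bracket[OF Z X]
  note c = vf_bracket[OF b(1) Z] vf_bracket[OF b(2) X] vf_bracket[OF b(3) Y]
  have "bracket (bracket X Y) Z p + bracket (bracket Y Z) X p + bracket (bracket Z X) Y p = 0"
  proof
    fix h
    show "(bracket (bracket X Y) Z p + bracket (bracket Y Z) X p + bracket (bracket Z X) Y p) h = 0 h"
      using fun_cong[OF fun_cong[OF bracket_jacobi[OF X Y Z], of p], of h]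
      unfolding bracket_commute[of "bracket X Y" Z] bracket_commute[of "bracket Y Z" X]
        bracket_commute[of "bracket Z X" Y] by simp
  qed
  then have "th p (bracket (bracket X Y) Z p) + th p (bracket (bracket Y Z) X p)
      + th p (bracket (bracket Z X) Y p) = 0"
    using th_add[OF tan_closed(2)[OF vf_at[OF c(1)] vf_at[OF c(2)]] vf_at[OF c(3)], of p]
      th_add[OF vf_at[OF c(1)] vf_at[OF c(2)], of p] th_zero[of p] by simp
  then show ?thesis
    unfolding ex[OF X Y Z] ex[OF Y Z X] ex[OF Z X Y]
    by (simp add: dform_def[of _ "bracket _ _"]) (simp add: bracket_def field_simps)
qed

section \<open>Torsion\<close>

abbreviation "T \<equiv> torsion D"

lemma T_eq: "T X Y = D X Y - D Y X - bracket X Y"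
  by (simp add: torsion_def fun_eq_iff)

lemma vf_T: "VF X \<Longrightarrow> VF Y \<Longrightarrow> VF (T X Y)"
  unfolding T_eq by (intro vf_intros vf_D)

lemma T_commute: "T X Y = - T Y X"
  unfolding T_eq bracket_commute[of Y X] by (simp add: algebra_simps)

lemma T_xi: "VF X \<Longrightarrow> T \<xi> X = 0"
  using tau0[of X] by (simp add: tau_def fun_eq_iff)

lemma T_add_left: "VF X \<Longrightarrow> VF X' \<Longrightarrow> VF Y \<Longrightarrow> T (X + X') Y = T X Y + T X' Y"
  by (simp add: T_eq D_add_left D_add_right bracket_add_left algebra_simps)

lemma T_fmul_left: "VF X \<Longrightarrow> VF Y \<Longrightarrow> Sm f \<Longrightarrow> T (f \<odot> X) Y = f \<odot> T X Y"
  unfolding T_eq by (simp add: D_fmul_left D_fmul_right bracket_fmul_left) (simp add: fun_eq_iff algebra_simps)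

text \<open>
  The horizontal part of the torsion: the subtracted term is its component along \<open>\<xi>\<close>, by lemma
  \<open>th_T\<close>.
\<close>

definition TH :: "'a vfield \<Rightarrow> 'a vfield \<Rightarrow> 'a vfield" where
  "TH X Y = T X Y - (\<lambda>q. 2 * om X Y q) \<odot> \<xi>"

lemma vf_TH: "VF X \<Longrightarrow> VF Y \<Longrightarrow> VF (TH X Y)"
  unfolding TH_def by (intro vf_intros vf_T vf_xi smooth_mult smooth_const om_smooth)

lemma TH_commute: "VF X \<Longrightarrow> VF Y \<Longrightarrow> TH X Y = - TH Y X"
  using T_commute[of X Y] om_commute[of X Y] by (simp add: TH_def fun_eq_iff)

lemma th_T: "VF X \<Longrightarrow> VF Y \<Longrightarrow> th q (T X Y q) = 2 * om X Y q"
proof -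
  assume X: "VF X" and Y: "VF Y"
  have "T X Y q = (D X Y q - D Y X q) - bracket X Y q" by (simp add: T_eq)
  then have "th q (T X Y q) = th q (D X Y q) - th q (D Y X q) - th q (bracket X Y q)"
    by (simp only: th_diff tan_closed vf_at vf_D vf_bracket X Y)
  then show ?thesis by (simp add: dform_def th_D X Y)
qed

lemma TH_apply: "TH X Y q = T X Y q - (2 * om X Y q) *\<^sub>R \<xi> q"
  by (simp add: TH_def)

lemma hor_field_TH: "VF X \<Longrightarrow> VF Y \<Longrightarrow> hor_field (TH X Y)"
  unfolding hor_field_def
  by (simp add: vf_TH) (simp add: TH_apply th_diff tan_closed vf_at vf_T xi_tan th_scale th_xi th_T)

lemma JF_T: "VF X \<Longrightarrow> VF Y \<Longrightarrow> J q (T X Y q) = J q (TH X Y q)"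
  by (simp add: TH_apply J_diff tan_closed vf_at vf_T xi_tan J_scale J_xi)

lemma hor_T: "VF X \<Longrightarrow> VF Y \<Longrightarrow> hor q (T X Y q) = TH X Y q"
  by (simp add: TH_apply hor_eq th_T)

lemma JF_diff: "VF X \<Longrightarrow> VF Y \<Longrightarrow> JF (X - Y) = JF X - JF Y"
  by (rule ext) (simp only: JF_apply minus_apply J_diff vf_at)

text \<open>
  The \<open>\<theta>\<close>-components of real and imaginary part give \<open>c = 0\<close>, and then
  \<open>z\<close> lies in both \<open>H10\<close> and \<open>H01\<close>.
\<close>

lemma complex_decomposition_unique:
  assumes z: "z \<in> H10 M p" and v: "v \<in> H10 M p"
    and eq: "\<And>f. z f + cconj v f + c * complex_of_real (\<xi> p f) = 0"
  shows "z = (\<lambda>f. 0)"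
proof -
  have zv: "re_part z \<in> Hor M p" "re_part v \<in> Hor M p" "im_part z \<in> Hor M p" "im_part v \<in> Hor M p"
    using z v by (auto simp: Hor_eq) (auto simp: Jb_im_part simp flip: Hor_eq)
  have "th p ((re_part z + re_part v) + Re c *\<^sub>R \<xi> p) = Re c"
    using Hor_closed(2)[OF zv(1,2)]
    by (simp only: th_add[OF Hor_tan tan_closed(5)[OF xi_tan]] Hor_th th_scale[OF xi_tan] th_xi)
  moreover have "(re_part z + re_part v) + Re c *\<^sub>R \<xi> p = 0"
    using eq by (simp add: fun_eq_iff complex_eq_iff cconj_def)
  ultimately have 1: "Re c = 0" using th_zero by simp
  have "th p ((im_part z - im_part v) + Im c *\<^sub>R \<xi> p) = Im c"
    using Hor_closed(5)[OF zv(3,4)]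
    by (simp only: th_add[OF Hor_tan tan_closed(5)[OF xi_tan]] Hor_th th_scale[OF xi_tan] th_xi)
  moreover have "(im_part z - im_part v) + Im c *\<^sub>R \<xi> p = 0"
    using eq by (simp add: fun_eq_iff complex_eq_iff cconj_def)
  ultimately have 2: "Im c = 0" using th_zero by simp
  have "z = cconj (\<lambda>f. (-1) * v f)"
    using eq 1 2 by (auto simp: fun_eq_iff complex_eq_iff cconj_def add_eq_0_iff)
  then have "z \<in> H01 M p"
    unfolding H01_def using H10_scale[OF v, of "-1"] by (rule image_eqI)
  with z show ?thesis using H10_cap by blast
qed

text \<open>
  Since \<open>x \<mapsto> (x - \<i> Jx) / 2\<close> is the projection of a real horizontal vector
  to \<open>H10\<close>, the \<open>H10\<close>-component of \<open>A + \<i> B\<close> is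
  \<open>(a - \<i> Ja) / 2\<close> with \<open>a = hor A + J B\<close>. Its
  \<open>H01\<close>-component is in the same way the conjugate of \<open>(b - \<i> Jb) / 2\<close> with
  \<open>b = hor A - J B\<close>.
\<close>

lemma proj_plus_zero:
  assumes A: "A \<in> TS p" and B: "B \<in> TS p"
    and pp: "proj_plus M \<xi> p (\<lambda>f. Complex (A f) (B f)) = (\<lambda>f. 0)"
  shows "hor p A + J p B = 0"
proof -
  let ?u = "\<lambda>f. Complex (A f) (B f)"
  define hz where "hz a = (\<lambda>f. Complex (1/2 * a f) (- (1/2 * J p a f)))" for a
  have hzH: "hz a \<in> H10 M p" if a: "a \<in> Hor M p" for a
  proof -
    have "re_part (hz a) = (1/2) *\<^sub>R a" "im_part (hz a) = - ((1/2) *\<^sub>R J p a)"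
      by (simp_all add: hz_def fun_eq_iff)
    moreover have "Jb M p ((1/2) *\<^sub>R a) = (1/2) *\<^sub>R J p a"
      using J_Jb[OF Hor_closed(3)[OF a]] J_scale[OF Hor_tan[OF a]] by metis
    ultimately show ?thesis unfolding H10_iff using Hor_closed(3)[OF a] by simp
  qed
  let ?a = "hor p A + J p B" and ?b = "hor p A - J p B"
  have a: "?a \<in> Hor M p" and b: "?b \<in> Hor M p"
    using hor_Hor[OF A] J_Hor[OF B] by (auto intro: Hor_closed)
  define c where "c = Complex (th p A) (th p B)"
  have J1: "J p ?a = J p A + (th p B *\<^sub>R \<xi> p - B)" "J p ?b = J p A - (th p B *\<^sub>R \<xi> p - B)"
    using J_add[OF Hor_tan[OF hor_Hor[OF A]] J_tan[OF B]] J_diff[OF Hor_tan[OF hor_Hor[OF A]] J_tan[OF B]]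
    by (simp_all only: J_hor[OF A] J_J[OF B])
  have dec: "?u f = hz ?a f + cconj (hz ?b) f + c * complex_of_real (\<xi> p f)" for f
    by (simp add: complex_eq_iff hz_def cconj_def c_def J1) (simp add: hor_eq field_simps)
  have "proj_plus M \<xi> p ?u = hz ?a"
    unfolding proj_plus_def
  proof (rule the_equality)
    show "hz ?a \<in> H10 M p \<and> (\<exists>w\<in>H01 M p. \<exists>r\<in>Creeb \<xi> p. ?u = (\<lambda>f. hz ?a f + w f + r f))"
    proof (intro conjI bexI)
      show "?u = (\<lambda>f. hz ?a f + cconj (hz ?b) f + c * complex_of_real (\<xi> p f))" using dec by (rule ext)
      show "(\<lambda>f. c * complex_of_real (\<xi> p f)) \<in> Creeb \<xi> p" unfolding Creeb_def by blast
      show "cconj (hz ?b) \<in> H01 M p" unfolding H01_def using hzH[OF b] by (rule imageI)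
    qed (rule hzH[OF a])
  next
    fix z assume "z \<in> H10 M p \<and> (\<exists>w\<in>H01 M p. \<exists>r\<in>Creeb \<xi> p. ?u = (\<lambda>f. z f + w f + r f))"
    then obtain v d where z: "z \<in> H10 M p" and v: "v \<in> H10 M p"
      and u: "?u = (\<lambda>f. z f + cconj v f + d * complex_of_real (\<xi> p f))"
      unfolding H01_def Creeb_def by auto
    have "(\<lambda>f. 1 * z f + (-1) * hz ?a f) = (\<lambda>f. 0)"
    proof (rule complex_decomposition_unique)
      show "(\<lambda>f. 1 * z f + (-1) * hz ?a f) \<in> H10 M p" by (rule H10_lin[OF z hzH[OF a]])
      show "(\<lambda>f. 1 * v f + (-1) * hz ?b f) \<in> H10 M p" by (rule H10_lin[OF v hzH[OF b]])
      show "(1 * z f + (-1) * hz ?a f) + cconj (\<lambda>f. 1 * v f + (-1) * hz ?b f) f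
          + (d - c) * complex_of_real (\<xi> p f) = 0" for f
        using fun_cong[OF u, of f] dec[of f] by (simp add: cconj_def algebra_simps)
    qed
    then show "z = hz ?a" by (simp add: fun_eq_iff)
  qed
  then have "hz ?a = (\<lambda>f. 0)" using pp by simp
  then show ?thesis
    by (simp add: hz_def fun_eq_iff complex_eq_iff)
qed

text \<open>
  The real form of the condition on \<open>T(Z, cconj W)\<close> for \<open>Z = X - \<i> JX\<close>
  and \<open>W = Y - \<i> JY\<close>: real and imaginary part of this vector are
  \<open>T(X, Y) + T(JX, JY)\<close> and \<open>T(X, JY) - T(JX, Y)\<close>.
\<close>

lemma TH_mixed:
  assumes X: "hor_field X" and Y: "hor_field Y"
  shows "TH X Y + TH (JF X) (JF Y) + (JF (TH X (JF Y)) - JF (TH (JF X) Y)) = 0"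
proof
  fix q
  note v = hor_field_VF[OF X] hor_field_VF[OF Y] vf_JF[OF hor_field_VF[OF X]] vf_JF[OF hor_field_VF[OF Y]]
  let ?A = "T X Y + T (JF X) (JF Y)" and ?B = "T X (JF Y) - T (JF X) Y"
  have sX: "ctsection (charts M) (H10 M) (cfield X (- JF X))"
    and sY: "ctsection (charts M) (H10 M) (cfield Y (- JF Y))"
    using X Y by (simp_all only: H10_section_iff)
  have "(\<lambda>q. cconj (cfield Y (- JF Y) q)) = cfield Y (JF Y)"
    by (simp add: cconj_def cfield_def fun_eq_iff complex_eq_iff)
  moreover have "T (- JF X) W = - T (JF X) W" if "VF W" for W
  proof -
    have "- JF X = (\<lambda>_. -1) \<odot> JF X" by (simp add: fun_eq_iff)
    then have "T (- JF X) W = (\<lambda>_. -1) \<odot> T (JF X) W"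
      by (simp only: T_fmul_left[OF v(3) that smooth_const])
    then show ?thesis by (simp add: fun_eq_iff)
  qed
  ultimately have "cext T (cfield X (- JF X)) (\<lambda>q. cconj (cfield Y (- JF Y) q)) = cfield ?A ?B"
    using v by (simp add: cext_cfield)
  moreover have "proj_plus M \<xi> q (cext T (cfield X (- JF X)) (\<lambda>q. cconj (cfield Y (- JF Y) q)) q) = (\<lambda>f. 0)"
    using canonical sX sY unfolding canonical_connection_def by blast
  ultimately have "proj_plus M \<xi> q (cfield ?A ?B q) = (\<lambda>f. 0)" by (simp only:)
  then have "proj_plus M \<xi> q (\<lambda>f. Complex (?A q f) (?B q f)) = (\<lambda>f. 0)" by (simp only: cfield_def)
  then have "hor q (?A q) + J q (?B q) = 0"
    by (intro proj_plus_zero vf_at vf_intros vf_T v)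
  moreover have "hor q (?A q) = TH X Y q + TH (JF X) (JF Y) q"
    using hor_lin[of "T X Y q" q "T (JF X) (JF Y) q" 1 1] v by (simp add: vf_at vf_T hor_T)
  moreover have "J q (?B q) = JF (TH X (JF Y)) q - JF (TH (JF X) Y) q"
    using v by (simp add: J_diff vf_at vf_T JF_T JF_apply)
  ultimately show "(TH X Y + TH (JF X) (JF Y) + (JF (TH X (JF Y)) - JF (TH (JF X) Y))) q = 0 q" by simp
qed

lemma om_minus: "VF X \<Longrightarrow> VF Y \<Longrightarrow> om (- X) Y q = - om X Y q" "VF X \<Longrightarrow> VF Y \<Longrightarrow> om X (- Y) q = - om X Y q"
  using Om_fields[of "- X" Y q] Om_fields[of X Y q] Om_fields[of X "- Y" q]
    Om_simps2(2,4)[OF vf_at[of X q] vf_at[of Y q]] vf_minus by simp_all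

lemma om_JF_right:
  assumes X: "hor_field X" and Y: "hor_field Y"
  shows "om (JF X) Y q = - om X (JF Y) q"
  using om_J[OF X hor_field_JF[OF hor_field_VF[OF Y]], of q] om_minus(2)[OF vf_JF[OF hor_field_VF[OF X]] hor_field_VF[OF Y], of q]
  by (simp add: JF_JF[OF Y])

text \<open>
  In \<open>TH(X, Y) - TH(JX, JY)\<close> the terms along \<open>\<xi>\<close> cancel; \<open>J\<close>
  passes through the covariant derivatives, and integrability says what it does to the brackets.
\<close>

lemma TH_integrable:
  assumes X: "hor_field X" and Y: "hor_field Y"
  shows "JF (TH X Y - TH (JF X) (JF Y)) = TH X (JF Y) + TH (JF X) Y"
proof -
  note v = hor_field_VF[OF X] hor_field_VF[OF Y] vf_JF[OF hor_field_VF[OF X]] vf_JF[OF hor_field_VF[OF Y]]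
  let ?W = "bracket X Y - bracket (JF X) (JF Y)"
  have W: "VF ?W" by (intro vf_intros v)
  have "TH X Y - TH (JF X) (JF Y) = (D X Y - D Y X) - (D (JF X) (JF Y) - D (JF Y) (JF X)) - ?W"
    by (simp add: TH_def T_eq fun_eq_iff om_J[OF X Y])
  then have "JF (TH X Y - TH (JF X) (JF Y)) =
      (JF (D X Y) - JF (D Y X)) - (JF (D (JF X) (JF Y)) - JF (D (JF Y) (JF X))) - JF ?W"
    by (simp only: JF_diff vf_diff vf_D v W)
  also have "\<dots> = (D X (JF Y) - D Y (JF X)) - (D (JF X) (- Y) - D (JF Y) (- X))
      - (bracket X (JF Y) + bracket (JF X) Y)"
    by (simp only: D_JF[symmetric] v JF_JF[OF X] JF_JF[OF Y] integrability(2)[OF X Y])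
  also have "\<dots> = TH X (JF Y) + TH (JF X) Y"
    by (simp only: D_minus_right v) (simp add: TH_def T_eq fun_eq_iff om_JF_right[OF X Y])
  finally show ?thesis .
qed

text \<open>
  Interchanging \<open>X\<close> and \<open>Y\<close> in \<open>TH_mixed\<close> changes the sign of the first two terms
  only, so \<open>TH(X, JY) = TH(JX, Y)\<close> and \<open>TH(JX, JY) = - TH(X, Y)\<close>.
  With this, \<open>TH_integrable\<close> becomes \<open>2 J (TH(X, Y)) = 2 TH(JX, Y)\<close>.
\<close>

lemma TH_JF:
  assumes X: "hor_field X" and Y: "hor_field Y"
  shows "TH (JF X) Y = JF (TH X Y)" "TH X (JF Y) = JF (TH X Y)"
proof -
  note v = hor_field_VF[OF X] hor_field_VF[OF Y] vf_JF[OF hor_field_VF[OF X]] vf_JF[OF hor_field_VF[OF Y]]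
  note h = hor_field_TH[OF v(1,2)] hor_field_TH[OF v(1,4)] hor_field_TH[OF v(3,2)] hor_field_TH[OF v(3,4)]
  note vh = h[THEN hor_field_VF]
  have m2: "JF (TH X (JF Y)) = JF (TH (JF X) Y)"
  proof (intro ext)
    fix q f
    have "TH Y X + TH (JF Y) (JF X) + (JF (TH Y (JF X)) - JF (TH (JF Y) X)) = 0"
      by (rule TH_mixed[OF Y X])
    then have "- TH X Y - TH (JF X) (JF Y) + (- JF (TH (JF X) Y) + JF (TH X (JF Y))) = 0"
      using v vh by (simp add: TH_commute[of Y] TH_commute[of "JF Y"] JF_minus)
    from fun_cong[OF fun_cong[OF this, of q], of f] fun_cong[OF fun_cong[OF TH_mixed[OF X Y], of q], of f]
    show "JF (TH X (JF Y)) q f = JF (TH (JF X) Y) q f" by simp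
  qed
  have m1: "TH X Y + TH (JF X) (JF Y) = 0" using TH_mixed[OF X Y] m2 by simp
  have "JF (JF (TH X (JF Y))) = JF (JF (TH (JF X) Y))" using m2 by simp
  then have m3: "TH X (JF Y) = TH (JF X) Y" by (simp only: JF_JF h neg_equal_iff_equal)
  have "JF (TH X Y) - JF (TH (JF X) (JF Y)) = TH X (JF Y) + TH (JF X) Y"
    using TH_integrable[OF X Y] JF_diff[OF vh(1,4)] by simp
  moreover have "TH (JF X) (JF Y) = - TH X Y" using m1 by (simp add: add_eq_0_iff)
  ultimately have "JF (TH X Y) + JF (TH X Y) = TH (JF X) Y + TH (JF X) Y"
    using m3 by (simp add: JF_minus[OF vh(1)])
  then show "TH (JF X) Y = JF (TH X Y)" by (simp add: fun_eq_iff)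
  then show "TH X (JF Y) = JF (TH X Y)" using m3 by simp
qed

text \<open>
  Expanding \<open>d d\<theta> = 0\<close> by \<open>D (d\<theta>) = 0\<close> leaves the cyclic sum
  of \<open>d\<theta>(T(X, Y), Z)\<close>, and \<open>\<xi>\<close> is in the kernel of \<open>d\<theta>\<close>.
\<close>

lemma om_TH_cyclic:
  assumes X: "hor_field X" and Y: "hor_field Y" and Z: "hor_field Z"
  shows "om (TH X Y) Z p + om (TH Y Z) X p + om (TH Z X) Y p = 0"
proof -
  have oT: "om (TH X Y) Z p = om (D X Y) Z p - om (D Y X) Z p - om (bracket X Y) Z p"
    if X: "VF X" and Y: "VF Y" and Z: "VF Z" for X Y Z
  proof -
    have "TH X Y p = (D X Y p - D Y X p) - bracket X Y p - (2 * om X Y p) *\<^sub>R \<xi> p"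
      by (simp add: TH_apply T_eq)
    then have "Om p (TH X Y p) (Z p) = Om p (D X Y p) (Z p) - Om p (D Y X p) (Z p) - Om p (bracket X Y p) (Z p)"
      by (simp add: Om_simps Om_simps2 tan_closed vf_at vf_D vf_bracket X Y Z xi_tan Om_xi)
    then show ?thesis by (simp add: Om_fields vf_TH vf_D vf_bracket X Y Z)
  qed
  note v = hor_field_VF[OF X] hor_field_VF[OF Y] hor_field_VF[OF Z]
  show ?thesis
    using om_closed[OF v, of p] om_parallel[OF v(1,2,3), of p] om_parallel[OF v(2,3,1), of p]
      om_parallel[OF v(3,1,2), of p] oT[OF v(1,2,3)] oT[OF v(2,3,1)] oT[OF v(3,1,2)]
      om_commute[OF v(1) vf_D[OF v(2,3)], of p] om_commute[OF v(2) vf_D[OF v(3,1)], of p]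
      om_commute[OF v(3) vf_D[OF v(1,2)], of p] om_commute[OF v(1) vf_D[OF v(3,2)], of p]
      om_commute[OF v(2) vf_D[OF v(1,3)], of p] om_commute[OF v(3) vf_D[OF v(2,1)], of p]
    by linarith
qed

text \<open>
  Write \<open>\<omega>\<close> for \<open>d\<theta>\<close> and move every \<open>J\<close> to the value of
  \<open>TH\<close>. The cyclic identity for \<open>X, Y, JZ\<close> reads
  \<open>- \<omega>(J TH(X, Y), Z) + \<omega>(J TH(Y, Z), X) + \<omega>(J TH(Z, X), Y) = 0\<close>,
  the one for \<open>JX, Y, Z\<close> has the opposite signs in the first two terms. Their sum is
  \<open>2 \<omega>(J TH(Z, X), Y) = 0\<close>, and \<open>Y = TH(Z, X)\<close> gives
  \<open>\<langle>TH(Z, X), TH(Z, X)\<rangle> = 0\<close>.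
\<close>

lemma TH_zero:
  assumes Z: "hor_field Z" and X: "hor_field X"
  shows "TH Z X = 0"
proof
  fix p
  have *: "om (JF (TH Z X)) Y p = 0" if Y: "hor_field Y" for Y
  proof -
    note JX = hor_field_JF[OF hor_field_VF[OF X]] and JZ = hor_field_JF[OF hor_field_VF[OF Z]]
    note h = hor_field_TH[OF hor_field_VF[OF X] hor_field_VF[OF Y]] hor_field_TH[OF hor_field_VF[OF Y] hor_field_VF[OF Z]]
    show ?thesis
      using om_TH_cyclic[OF X Y JZ, of p] om_TH_cyclic[OF JX Y Z, of p]
        om_JF_right[OF h(1) Z, of p] om_JF_right[OF h(2) X, of p]
      by (simp add: TH_JF X Y Z)
  qed
  let ?V = "TH Z X"
  have V: "hor_field ?V" by (rule hor_field_TH[OF hor_field_VF[OF Z] hor_field_VF[OF X]])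
  have t: "?V p \<in> TS p" by (rule vf_at[OF hor_field_VF[OF V]])
  have "g p (?V p) (?V p) = om ?V (JF ?V) p"
    using Om_fields[OF hor_field_VF[OF V] vf_JF[OF hor_field_VF[OF V]]] by (simp add: g_eq t hor_field_th[OF V] JF_apply)
  also have "\<dots> = 0" using *[OF V] om_JF_right[OF V V, of p] by simp
  finally show "TH Z X p = 0 p" using g_definite[OF t] by simp
qed

text \<open>
  Both sides are tensors. On horizontal fields this is \<open>TH_zero\<close>, and both sides vanish if an argument is
  \<open>\<xi>\<close>: the left one because \<open>\<tau> = 0\<close>.
\<close>

lemma torsion_eq:
  assumes X: "VF X" and Y: "VF Y"
  shows "T X Y = (\<lambda>q. 2 * om X Y q) \<odot> \<xi>"
proof -
  note v = hor_field_VF[OF hor_field_hor_part[OF X]] hor_field_VF[OF hor_field_hor_part[OF Y]]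
  have xi: "T (f \<odot> \<xi>) W = 0" if "VF W" "Sm f" for f W
    using T_fmul_left[OF vf_xi that] T_xi[OF that(1)] by (simp add: fun_eq_iff)
  have left: "T V W = T (hor_part V) W" if V: "VF V" and W: "VF W" for V W
  proof -
    have "T V W = T (hor_part V + (\<lambda>q. th q (V q)) \<odot> \<xi>) W" by (simp only: hor_part_decomp[symmetric])
    also have "\<dots> = T (hor_part V) W + T ((\<lambda>q. th q (V q)) \<odot> \<xi>) W"
      by (rule T_add_left[OF hor_field_VF[OF hor_field_hor_part[OF V]] vf_fmul[OF th_smooth[OF V] vf_xi] W])
    finally show ?thesis using xi[OF W th_smooth[OF V]] by simp
  qed
  have "T X Y = T (hor_part X) Y" by (rule left[OF X Y])
  also have "\<dots> = - T Y (hor_part X)" by (rule T_commute)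
  also have "\<dots> = - T (hor_part Y) (hor_part X)" by (simp only: left[OF Y v(1)])
  also have "\<dots> = T (hor_part X) (hor_part Y)" by (rule T_commute[symmetric])
  also have "\<dots> = (\<lambda>q. 2 * om (hor_part X) (hor_part Y) q) \<odot> \<xi>"
    using TH_zero[OF hor_field_hor_part[OF X] hor_field_hor_part[OF Y]] by (simp add: TH_def)
  also have "(\<lambda>q. 2 * om (hor_part X) (hor_part Y) q) = (\<lambda>q. 2 * om X Y q)"
  proof
    fix q
    show "2 * om (hor_part X) (hor_part Y) q = 2 * om X Y q"
      using Om_fields[OF v, of q] Om_fields[OF X Y, of q]
      by (simp add: hor_part_apply hor_eq Om_simps Om_simps2 tan_closed vf_at X Y xi_tan Om_xi)
  qed
  finally show ?thesis .
qed

end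


section \<open>Curvature\<close>

context sasaki
begin

abbreviation "Rf \<equiv> curvature D"

lemma Rf_eq: "Rf X Y Z = D X (D Y Z) - D Y (D X Z) - D (bracket X Y) Z"
  by (simp add: curvature_def fun_eq_iff)

lemma vf_Rf: "VF X \<Longrightarrow> VF Y \<Longrightarrow> VF Z \<Longrightarrow> VF (Rf X Y Z)"
  unfolding Rf_eq by (intro vf_diff vf_D vf_bracket)

lemma Rf_commute:
  assumes X: "VF X" and Y: "VF Y" and Z: "VF Z"
  shows "Rf X Y Z = - Rf Y X Z"
proof -
  have "D (bracket X Y) Z = - D (bracket Y X) Z"
    using D_minus_left[OF vf_bracket[OF Y X] Z] bracket_commute[of X Y] by simp
  then show ?thesis by (simp add: Rf_eq)
qed

lemma Rf_add_left:
  assumes X: "VF X" and X': "VF X'" and Y: "VF Y" and Z: "VF Z"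
  shows "Rf (X + X') Y Z = Rf X Y Z + Rf X' Y Z"
  by (simp only: Rf_eq bracket_add_left D_add_left D_add_right vf_D vf_bracket assms)
    (simp add: algebra_simps)

lemma Rf_fmul_left:
  assumes X: "VF X" and Y: "VF Y" and Z: "VF Z" and f: "Sm f"
  shows "Rf (f \<odot> X) Y Z = f \<odot> Rf X Y Z"
proof -
  have Yf: "Sm (\<lambda>p. Y p f)" by (rule vf_smooth[OF Y])
  have "D (bracket (f \<odot> X) Y) Z = f \<odot> D (bracket X Y) Z - (\<lambda>p. Y p f) \<odot> D X Z"
    unfolding bracket_fmul_left[OF X Y f]
    by (simp only: D_diff_left D_fmul_left vf_fmul vf_bracket assms Yf)
  moreover have "D (f \<odot> X) (D Y Z) = f \<odot> D X (D Y Z)"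
    "D Y (D (f \<odot> X) Z) = (\<lambda>p. Y p f) \<odot> D X Z + f \<odot> D Y (D X Z)"
    by (simp_all only: D_fmul_left D_fmul_right vf_D assms)
  ultimately show ?thesis
    unfolding Rf_eq by (simp add: fun_eq_iff algebra_simps)
qed

lemma Rf_add_right:
  assumes X: "VF X" and Y: "VF Y" and Z: "VF Z" and Z': "VF Z'"
  shows "Rf X Y (Z + Z') = Rf X Y Z + Rf X Y Z'"
  by (simp only: Rf_eq D_add_right vf_D vf_bracket assms) (simp add: algebra_simps)

lemma Rf_fmul_right:
  assumes X: "VF X" and Y: "VF Y" and Z: "VF Z" and f: "Sm f"
  shows "Rf X Y (f \<odot> Z) = f \<odot> Rf X Y Z"
proof -
  have s: "Sm (\<lambda>p. Y p f)" "Sm (\<lambda>p. X p f)" by (intro vf_smooth X Y)+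
  have DD: "D V (D W (f \<odot> Z)) = (\<lambda>p. V p (\<lambda>q. W q f)) \<odot> Z + (\<lambda>p. W p f) \<odot> D V Z
      + ((\<lambda>p. V p f) \<odot> D W Z + f \<odot> D V (D W Z))" if V: "VF V" and W: "VF W" for V W
    by (simp only: D_fmul_right D_add_right vf_D vf_fmul vf_smooth V W Z f)
  have "D (bracket X Y) (f \<odot> Z) = (\<lambda>p. bracket X Y p f) \<odot> Z + f \<odot> D (bracket X Y) Z"
    by (rule D_fmul_right[OF vf_bracket[OF X Y] Z f])
  then show ?thesis
    unfolding Rf_eq DD[OF X Y] DD[OF Y X] by (simp add: fun_eq_iff bracket_def algebra_simps)
qed

text \<open>
  Differentiate \<open>\<langle>Z, W\<rangle>\<close> along \<open>X\<close> and \<open>Y\<close> in both orders; the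
  commutator is the derivative along the bracket, and the mixed terms cancel.
\<close>

lemma Rf_metric:
  assumes X: "VF X" and Y: "VF Y" and Z: "VF Z" and W: "VF W"
  shows "g p (Rf X Y Z p) (W p) = - g p (Rf X Y W p) (Z p)"
proof -
  have two: "V p (\<lambda>q. U q (\<lambda>r. g r (Z r) (W r))) =
      g p (D V (D U Z) p) (W p) + g p (D U Z p) (D V W p) +
      (g p (D V Z p) (D U W p) + g p (Z p) (D V (D U W) p))" if V: "VF V" and U: "VF U" for V U
  proof -
    have "(\<lambda>q. U q (\<lambda>r. g r (Z r) (W r))) = (\<lambda>q. g q (D U Z q) (W q) + g q (Z q) (D U W q))"
      using D_metric[OF U Z W] by (rule ext)
    then have "V p (\<lambda>q. U q (\<lambda>r. g r (Z r) (W r))) =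
        V p (\<lambda>q. g q (D U Z q) (W q)) + V p (\<lambda>q. g q (Z q) (D U W q))"
      by (simp only: tan_add[OF vf_at[OF V] g_smooth[OF vf_D[OF U Z] W] g_smooth[OF Z vf_D[OF U W]]])
    then show ?thesis
      by (simp only: D_metric[OF V vf_D[OF U Z] W] D_metric[OF V Z vf_D[OF U W]])
  qed
  have br: "X p (\<lambda>q. Y q (\<lambda>r. g r (Z r) (W r))) - Y p (\<lambda>q. X q (\<lambda>r. g r (Z r) (W r))) =
      g p (D (bracket X Y) Z p) (W p) + g p (Z p) (D (bracket X Y) W p)"
    using D_metric[OF vf_bracket[OF X Y] Z W, of p] by (simp only: bracket_def)
  have gd: "g p (Rf X Y U p) (V p) = g p (D X (D Y U) p) (V p) - g p (D Y (D X U) p) (V p)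
      - g p (D (bracket X Y) U p) (V p)" if U: "VF U" and V: "VF V" for U V
  proof -
    have d: "g p (a - b) c = g p a c - g p b c" if "a \<in> TS p" "b \<in> TS p" "c \<in> TS p" for a b c
      using g_lin_left[OF that, of 1 "-1"] by simp
    have "Rf X Y U p = (D X (D Y U) p - D Y (D X U) p) - D (bracket X Y) U p"
      by (simp add: Rf_eq)
    then show ?thesis by (simp only: d tan_closed vf_at vf_D vf_bracket X Y U V)
  qed
  have sy: "g p (Z p) (V p) = g p (V p) (Z p)" if "VF V" for V
    by (rule g_sym[OF vf_at[OF Z] vf_at[OF that]])
  show ?thesis
    using two[OF X Y] two[OF Y X] br gd[OF Z W] gd[OF W Z]
      sy[OF vf_D[OF X vf_D[OF Y W]]] sy[OF vf_D[OF Y vf_D[OF X W]]] sy[OF vf_D[OF vf_bracket[OF X Y] W]]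
    by linarith
qed

lemma Rf_JF:
  assumes X: "VF X" and Y: "VF Y" and Z: "VF Z"
  shows "Rf X Y (JF Z) = JF (Rf X Y Z)"
  by (simp only: Rf_eq D_JF JF_diff vf_diff vf_D vf_bracket assms)

lemma Rf_xi:
  assumes X: "VF X" and Y: "VF Y"
  shows "Rf X Y \<xi> = 0"
  by (simp only: Rf_eq D_xi D_zero_right vf_bracket assms diff_self)

text \<open>
  By the torsion formula
  \<open>D\<^sub>Y Z - D\<^sub>Z Y = [Y, Z] + 2 d\<theta>(Y, Z) \<xi>\<close>.
  Applying \<open>D\<^sub>X\<close> and the formula once more to \<open>X\<close> and \<open>[Y, Z]\<close> turns the
  cyclic sum into the Jacobi sum plus a multiple of \<open>\<xi>\<close>, whose coefficient is
  \<open>d d\<theta>\<close>.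
\<close>

lemma Rf_bianchi:
  assumes X: "VF X" and Y: "VF Y" and Z: "VF Z"
  shows "Rf X Y Z + Rf Y Z X + Rf Z X Y = 0"
proof (intro ext)
  fix p h
  have DT: "D V W - D W V = bracket V W + (\<lambda>q. 2 * om V W q) \<odot> \<xi>" if "VF V" "VF W" for V W
    using torsion_eq[OF that] unfolding T_eq by (simp add: algebra_simps)
  have c: "D V (D W U) - D V (D U W) - D (bracket W U) V =
      bracket V (bracket W U) + (\<lambda>q. 2 * om V (bracket W U) q) \<odot> \<xi> + (\<lambda>q. 2 * V q (om W U)) \<odot> \<xi>"
    if V: "VF V" and W: "VF W" and U: "VF U" for V W U
  proof -
    have s: "Sm (\<lambda>q. 2 * om W U q)" by (intro smooth_mult smooth_const om_smooth W U)
    have "D V (D W U) - D V (D U W) = D V (bracket W U + (\<lambda>q. 2 * om W U q) \<odot> \<xi>)"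
      by (simp only: DT[OF W U, symmetric] D_diff_right vf_D V W U)
    also have "\<dots> = D V (bracket W U) + (\<lambda>q. V q (\<lambda>r. 2 * om W U r)) \<odot> \<xi>"
      using D_add_right[OF V vf_bracket[OF W U] vf_fmul[OF s vf_xi]] D_fmul_right[OF V vf_xi s] D_xi[OF V]
      by (simp add: fun_eq_iff)
    also have "(\<lambda>q. V q (\<lambda>r. 2 * om W U r)) = (\<lambda>q. 2 * V q (om W U))"
      by (simp only: tan_cmul[OF vf_at[OF V] om_smooth[OF W U]])
    finally have 1: "D V (D W U) - D V (D U W) = D V (bracket W U) + (\<lambda>q. 2 * V q (om W U)) \<odot> \<xi>" .
    show ?thesis
      using 1 DT[OF V vf_bracket[OF W U]] by (simp add: algebra_simps)
  qed
  have j: "bracket X (bracket Y Z) p h + bracket Y (bracket Z X) p h + bracket Z (bracket X Y) p h = 0"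
    using fun_cong[OF fun_cong[OF bracket_jacobi[OF X Y Z], of p], of h] by simp
  have o: "om X (bracket Y Z) p + om Y (bracket Z X) p + om Z (bracket X Y) p
      + (X p (om Y Z) + Y p (om Z X) + Z p (om X Y)) = 0"
    using om_closed[OF X Y Z, of p] om_commute[OF X vf_bracket[OF Y Z], of p]
      om_commute[OF Y vf_bracket[OF Z X], of p] om_commute[OF Z vf_bracket[OF X Y], of p] by linarith
  have "(Rf X Y Z + Rf Y Z X + Rf Z X Y) p h =
      (D X (D Y Z) - D X (D Z Y) - D (bracket Y Z) X) p h
      + (D Y (D Z X) - D Y (D X Z) - D (bracket Z X) Y) p h
      + (D Z (D X Y) - D Z (D Y X) - D (bracket X Y) Z) p h"
    by (simp add: Rf_eq)
  also have "\<dots> = 2 * \<xi> p h * (om X (bracket Y Z) p + om Y (bracket Z X) p + om Z (bracket X Y) p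
      + (X p (om Y Z) + Y p (om Z X) + Z p (om X Y)))"
    unfolding c[OF X Y Z] c[OF Y Z X] c[OF Z X Y] using j by (simp add: algebra_simps)
  finally show "(Rf X Y Z + Rf Y Z X + Rf Z X Y) p h = 0 p h" using o by simp
qed

abbreviation "cv \<equiv> curv M D"

text \<open>
  Tensoriality: the extensions chosen in the definition of \<open>curv\<close> may be replaced by any others.
\<close>

lemma cv_fields:
  assumes X: "VF X" and Y: "VF Y" and Z: "VF Z"
  shows "cv p (X p) (Y p) (Z p) = Rf X Y Z p"
proof
  fix h
  have loc1: "Rf V Y Z p h = Rf V' Y Z p h" if "VF V" "VF V'" "VF Y" "VF Z" "V p = V' p" for V V' Y Z
    by (rule tensor_at[of "\<lambda>V. Rf V Y Z p h" p]) (simp_all add: Rf_add_left Rf_fmul_left that)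
  have loc2: "Rf Y V Z p h = Rf Y V' Z p h" if "VF V" "VF V'" "VF Y" "VF Z" "V p = V' p" for V V' Y Z
    using loc1[OF that] Rf_commute[of Y V Z] Rf_commute[of Y V' Z] that by simp
  have loc3: "Rf X Y V p h = Rf X Y V' p h" if "VF V" "VF V'" "VF X" "VF Y" "V p = V' p" for V V' X Y
    by (rule tensor_at[of "\<lambda>V. Rf X Y V p h" p]) (simp_all add: Rf_add_right Rf_fmul_right that)
  let ?e = "ext_field (charts M) p"
  note e = ext_field(1)[OF vf_at[of _ p]] and e2 = ext_field(2)[OF vf_at[of _ p]]
  have "Rf (?e (X p)) (?e (Y p)) (?e (Z p)) p h = Rf X (?e (Y p)) (?e (Z p)) p h"
    by (intro loc1 e e2 X Y Z)
  also have "\<dots> = Rf X Y (?e (Z p)) p h" by (intro loc2 e e2 X Y Z)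
  also have "\<dots> = Rf X Y Z p h" by (intro loc3 e e2 X Y Z)
  finally show "cv p (X p) (Y p) (Z p) h = Rf X Y Z p h" unfolding curv_def .
qed

lemma cv_tan:
  assumes "x \<in> TS p" "y \<in> TS p" "z \<in> TS p"
  shows "cv p x y z \<in> TS p"
  unfolding curv_def
  by (rule vf_at[OF vf_Rf[OF ext_field(1)[OF assms(1)] ext_field(1)[OF assms(2)] ext_field(1)[OF assms(3)]]])

definition Rm :: "'a \<Rightarrow> 'a tvec \<Rightarrow> 'a tvec \<Rightarrow> 'a tvec \<Rightarrow> 'a tvec \<Rightarrow> real" where
  "Rm p x y z u = g p (cv p x y z) u"

end

section \<open>Algebraic curvature tensors\<close>

text \<open>
  The carrier \<open>V\<close> is a subspace because tangent spaces and contact spaces are sets of derivations, not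
  types. Linearity in the other arguments follows from the symmetries.
\<close>

locale algebraic_curvature =
  fixes V :: "'v::real_vector set" and Q :: "'v \<Rightarrow> 'v \<Rightarrow> 'v \<Rightarrow> 'v \<Rightarrow> real"
  assumes sub: "subspace V"
    and lin1: "\<lbrakk>x \<in> V; x' \<in> V; y \<in> V; z \<in> V; u \<in> V\<rbrakk> \<Longrightarrow>
      Q (a *\<^sub>R x + b *\<^sub>R x') y z u = a * Q x y z u + b * Q x' y z u"
    and skew12: "\<lbrakk>x \<in> V; y \<in> V; z \<in> V; u \<in> V\<rbrakk> \<Longrightarrow> Q x y z u = - Q y x z u"
    and skew34: "\<lbrakk>x \<in> V; y \<in> V; z \<in> V; u \<in> V\<rbrakk> \<Longrightarrow> Q x y z u = - Q x y u z"
    and bianchi: "\<lbrakk>x \<in> V; y \<in> V; z \<in> V; u \<in> V\<rbrakk> \<Longrightarrow> Q x y z u + Q y z x u + Q z x y u = 0"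
begin

lemmas closed = subspace_0[OF sub] subspace_add[OF sub] subspace_diff[OF sub]
  subspace_neg[OF sub] subspace_scale[OF sub]

lemma pair_symmetric:
  assumes x: "x \<in> V" and y: "y \<in> V" and z: "z \<in> V" and u: "u \<in> V"
  shows "Q x y z u = Q z u x y"
proof -
  \<comment> \<open>In the sum of these four identities the terms with first pair yz, zx, xu or uy cancel by skewness
      in the second pair; what is left is twice the claim.\<close>
  note b = bianchi[OF y z x u] bianchi[OF z x u y] bianchi[OF x u y z] bianchi[OF u y z x]
  show ?thesis
    using b skew34[OF y z x u] skew34[OF z x y u] skew34[OF x u z y] skew34[OF u y x z]
      skew12[OF y x u z] skew34[OF x y u z] skew12[OF u z x y] skew34[OF z u y x]
    by linarith
qed

lemma lin2:
  assumes x: "x \<in> V" and y: "y \<in> V" and y': "y' \<in> V" and z: "z \<in> V" and u: "u \<in> V"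
  shows "Q x (a *\<^sub>R y + b *\<^sub>R y') z u = a * Q x y z u + b * Q x y' z u"
proof -
  have w: "a *\<^sub>R y + b *\<^sub>R y' \<in> V" by (intro closed y y')
  show ?thesis
    unfolding skew12[OF x w z u] skew12[OF x y z u] skew12[OF x y' z u] lin1[OF y y' x z u] by simp
qed

lemma lin3:
  assumes x: "x \<in> V" and y: "y \<in> V" and z: "z \<in> V" and z': "z' \<in> V" and u: "u \<in> V"
  shows "Q x y (a *\<^sub>R z + b *\<^sub>R z') u = a * Q x y z u + b * Q x y z' u"
proof -
  have w: "a *\<^sub>R z + b *\<^sub>R z' \<in> V" by (intro closed z z')
  show ?thesis
    unfolding pair_symmetric[OF x y w u] pair_symmetric[OF x y z u] pair_symmetric[OF x y z' u]
    by (rule lin1[OF z z' u x y])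
qed

lemma lin4:
  assumes x: "x \<in> V" and y: "y \<in> V" and z: "z \<in> V" and u: "u \<in> V" and u': "u' \<in> V"
  shows "Q x y z (a *\<^sub>R u + b *\<^sub>R u') = a * Q x y z u + b * Q x y z u'"
proof -
  have w: "a *\<^sub>R u + b *\<^sub>R u' \<in> V" by (intro closed u u')
  show ?thesis
    unfolding pair_symmetric[OF x y z w] pair_symmetric[OF x y z u] pair_symmetric[OF x y z u']
    by (rule lin2[OF z u u' x y])
qed

lemmas add_simps = lin1[where a=1 and b=1, simplified] lin2[where a=1 and b=1, simplified]
  lin3[where a=1 and b=1, simplified] lin4[where a=1 and b=1, simplified]
lemmas diff_simps = lin1[where a=1 and b="-1", simplified] lin2[where a=1 and b="-1", simplified]
  lin3[where a=1 and b="-1", simplified] lin4[where a=1 and b="-1", simplified]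

lemma minus2: "\<lbrakk>x \<in> V; y \<in> V; z \<in> V; u \<in> V\<rbrakk> \<Longrightarrow> Q x (- y) z u = - Q x y z u"
  using lin2[of x y y z u "-1" 0] by simp

lemma minus4: "\<lbrakk>x \<in> V; y \<in> V; z \<in> V; u \<in> V\<rbrakk> \<Longrightarrow> Q x y z (- u) = - Q x y z u"
  using lin4[of x y z u u "-1" 0] by simp

lemma diag: "\<lbrakk>x \<in> V; z \<in> V; u \<in> V\<rbrakk> \<Longrightarrow> Q x x z u = 0"
  using skew12[of x x z u] by simp

text \<open>
  In each of its two pairs an algebraic curvature tensor changes by the determinant of the base change.
\<close>

lemma plane_transform:
  assumes x: "x \<in> V" and y: "y \<in> V"
  shows "Q (a *\<^sub>R x + b *\<^sub>R y) (c *\<^sub>R x + d *\<^sub>R y) (c *\<^sub>R x + d *\<^sub>R y) (a *\<^sub>R x + b *\<^sub>R y)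
    = (a * d - b * c)\<^sup>2 * Q x y y x"
proof -
  have det: "Q (a *\<^sub>R x + b *\<^sub>R y) (c *\<^sub>R x + d *\<^sub>R y) z u = (a * d - b * c) * Q x y z u"
    if z: "z \<in> V" and u: "u \<in> V" for a b c d z u
    using x y z u skew12[OF y x z u] by (simp add: lin1 lin2 closed diag algebra_simps)
  let ?e = "a *\<^sub>R x + b *\<^sub>R y" and ?f = "c *\<^sub>R x + d *\<^sub>R y"
  have e: "?e \<in> V" "?f \<in> V" using x y closed by auto
  have "Q ?e ?f ?f ?e = (a * d - b * c) * Q x y ?f ?e" by (rule det[OF e(2,1)])
  also have "Q x y ?f ?e = Q ?f ?e x y" by (rule pair_symmetric[OF x y e(2,1)])
  also have "\<dots> = (c * b - d * a) * Q x y x y" by (rule det[OF x y])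
  also have "Q x y x y = - Q x y y x" by (rule skew34[OF x y x y])
  finally show ?thesis by (simp add: power2_eq_square algebra_simps)
qed

text \<open>
  Polarizing twice shows that \<open>Q\<close> changes sign when the second and fourth argument are exchanged, hence
  also for the first and third. The three terms of the Bianchi identity are then equal.
\<close>

lemma vanishes_if_sectional_vanishes:
  assumes sec: "\<And>x y. x \<in> V \<Longrightarrow> y \<in> V \<Longrightarrow> Q x y x y = 0"
    and x: "x \<in> V" and y: "y \<in> V" and z: "z \<in> V" and u: "u \<in> V"
  shows "Q x y z u = 0"
proof -
  have 1: "Q a b c b = 0" if a: "a \<in> V" and b: "b \<in> V" and c: "c \<in> V" for a b c
    using sec[OF closed(2)[OF a c] b] sec[OF a b] sec[OF c b] pair_symmetric[OF c b a b]
    by (simp add: add_simps closed a b c)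
  have swap24: "Q a b c d = - Q a d c b" if a: "a \<in> V" and b: "b \<in> V" and c: "c \<in> V" and d: "d \<in> V" for a b c d
    using 1[OF a closed(2)[OF b d] c] 1[OF a b c] 1[OF a d c]
    by (simp add: add_simps closed a b c d)
  have swap13: "Q a b c d = - Q c b a d" if a: "a \<in> V" and b: "b \<in> V" and c: "c \<in> V" and d: "d \<in> V" for a b c d
    using pair_symmetric[OF c b a d] swap24[OF a d c b] that by simp
  show ?thesis
    using bianchi[OF x y z u] skew12[OF y z x u] swap13[OF x y z u] skew12[OF z x y u] swap13[OF x z y u]
    by linarith
qed

text \<open>
  The theorem that a Kaehler curvature tensor is determined by its holomorphic sectional curvatures, in the following
  form. Polarizing \<open>Q(x, Jx, x, Jx) = 0\<close> gives
  \<open>Q(a, Ja, b, Jb) + 2 Q(a, Jb, a, Jb) = 0\<close>; by the Bianchi identity the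
  first term is \<open>Q(a, b, a, b) + Q(a, Jb, a, Jb)\<close>. So
  \<open>3 Q(a, Jb, a, Jb) + Q(a, b, a, b) = 0\<close>, and the same with
  \<open>Jb\<close> for \<open>b\<close> exchanges the two terms, so both vanish.
\<close>

lemma vanishes_if_holomorphic_sectional_vanishes:
  assumes J: "\<And>x. x \<in> V \<Longrightarrow> J x \<in> V" and JJ: "\<And>x. x \<in> V \<Longrightarrow> J (J x) = - x"
    and Jadd: "\<And>x y. x \<in> V \<Longrightarrow> y \<in> V \<Longrightarrow> J (x + y) = J x + J y"
    and Jdiff: "\<And>x y. x \<in> V \<Longrightarrow> y \<in> V \<Longrightarrow> J (x - y) = J x - J y"
    and inv: "\<And>x y z u. \<lbrakk>x \<in> V; y \<in> V; z \<in> V; u \<in> V\<rbrakk> \<Longrightarrow> Q x y (J z) (J u) = Q x y z u"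
    and hol: "\<And>x. x \<in> V \<Longrightarrow> Q x (J x) (J x) x = 0"
    and x: "x \<in> V" and y: "y \<in> V" and z: "z \<in> V" and u: "u \<in> V"
  shows "Q x y z u = 0"
proof (rule vanishes_if_sectional_vanishes[OF _ x y z u])
  have invl: "Q (J a) (J b) c d = Q a b c d" if "a \<in> V" "b \<in> V" "c \<in> V" "d \<in> V" for a b c d
    using inv[of c d a b] pair_symmetric[of "J a" "J b" c d] pair_symmetric[of a b c d] that J by simp
  have sh: "Q a (J b) c d = Q b (J a) c d" if "a \<in> V" "b \<in> V" "c \<in> V" "d \<in> V" for a b c d
    using invl[of b "J a" c d] JJ[of a] minus2[of "J b" a c d] skew12[of a "J b" c d] that J by simp
  have hol': "Q a (J a) a (J a) = 0" if "a \<in> V" for a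
    using hol[OF that] skew34[of a "J a" a "J a"] that J by simp
  have key: "3 * Q a (J b) a (J b) + Q a b a b = 0" if a: "a \<in> V" and b: "b \<in> V" for a b
  proof -
    note v = a b J[OF a] J[OF b]
    \<comment> \<open>The sum of the vanishing values at \<open>a + b\<close> and \<open>a - b\<close> keeps the terms that are of second order in \<open>b\<close>; the invariance under \<open>J\<close> identifies four of these six.\<close>
    have pol: "2 * Q a (J a) b (J b) + 4 * Q a (J b) a (J b) = 0"
      using hol'[OF closed(2)[OF a b]] hol'[OF closed(3)[OF a b]] hol'[OF a] hol'[OF b]
        pair_symmetric[OF v(2,4,1,3)] sh[OF v(2,1)] sh[OF v(2,1), of b "J a"]
        sh[OF v(2,1,1,4)] pair_symmetric[OF v(1,4,2,3)] sh[OF v(2,1), of a "J b"]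
        pair_symmetric[OF v(1,4,1,4)] sh[OF v(2,1,2,3)]
      by (simp add: Jadd Jdiff add_simps diff_simps closed v)
    have "Q a (J a) b (J b) + Q (J a) b a (J b) + Q b a (J a) (J b) = 0"
      by (rule bianchi[OF v(1,3,2,4)])
    moreover have "Q (J a) b a (J b) = - Q a (J b) a (J b)"
      using skew12[OF v(3,2,1,4)] sh[OF v(2,1,1,4)] by simp
    moreover have "Q b a (J a) (J b) = - Q a b a b"
      using inv[OF b a a b] skew12[OF b a a b] by simp
    ultimately show ?thesis using pol by linarith
  qed
  fix a b assume a: "a \<in> V" and b: "b \<in> V"
  have "Q a (J (J b)) a (J (J b)) = Q a b a b"
    using a b by (simp add: JJ minus2 minus4 closed)
  then show "Q a b a b = 0" using key[OF a b] key[OF a J[OF b]] by simp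
qed

end


section \<open>The curvature tensor at a point\<close>

context sasaki
begin

lemma cv_J:
  assumes x: "x \<in> TS p" and y: "y \<in> TS p" and z: "z \<in> TS p"
  shows "cv p x y (J p z) = J p (cv p x y z)"
proof -
  obtain X where X: "VF X" "X p = x" by (rule field_through[OF x])
  obtain Y where Y: "VF Y" "Y p = y" by (rule field_through[OF y])
  obtain Z where Z: "VF Z" "Z p = z" by (rule field_through[OF z])
  have "cv p (X p) (Y p) (JF Z p) = J p (cv p (X p) (Y p) (Z p))"
    by (simp only: cv_fields X(1) Y(1) Z(1) vf_JF Rf_JF) (simp only: JF_apply)
  then show ?thesis by (simp only: JF_apply X(2) Y(2) Z(2))
qed

lemma cv_xi:
  assumes x: "x \<in> TS p" and y: "y \<in> TS p"
  shows "cv p x y (\<xi> p) = 0"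
proof -
  obtain X where X: "VF X" "X p = x" by (rule field_through[OF x])
  obtain Y where Y: "VF Y" "Y p = y" by (rule field_through[OF y])
  have "cv p (X p) (Y p) (\<xi> p) = 0"
    by (simp only: cv_fields X(1) Y(1) vf_xi Rf_xi zero_fun_apply)
  then show ?thesis by (simp only: X(2) Y(2))
qed

lemma Rm_algebraic: "algebraic_curvature (TS p) (Rm p)"
proof
  show "subspace (TS p)" by (rule subspace_tangent)
next
  fix x x' y z u and a b :: real
  assume x: "x \<in> TS p" and x': "x' \<in> TS p" and y: "y \<in> TS p" and z: "z \<in> TS p" and u: "u \<in> TS p"
  obtain X where X: "VF X" "X p = x" by (rule field_through[OF x])
  obtain X' where X': "VF X'" "X' p = x'" by (rule field_through[OF x'])
  obtain Y where Y: "VF Y" "Y p = y" by (rule field_through[OF y])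
  obtain Z where Z: "VF Z" "Z p = z" by (rule field_through[OF z])
  let ?aX = "(\<lambda>q. a) \<odot> X" and ?bX = "(\<lambda>q. b) \<odot> X'"
  have v: "VF ?aX" "VF ?bX" "VF (?aX + ?bX)" by (intro vf_intros smooth_const X X')+
  have "Rf (?aX + ?bX) Y Z p = a *\<^sub>R Rf X Y Z p + b *\<^sub>R Rf X' Y Z p"
    unfolding Rf_add_left[OF v(1,2) Y(1) Z(1)] Rf_fmul_left[OF X(1) Y(1) Z(1) smooth_const]
      Rf_fmul_left[OF X'(1) Y(1) Z(1) smooth_const] by (simp only: plus_fun_apply fmul_apply)
  then have "cv p ((?aX + ?bX) p) (Y p) (Z p) = a *\<^sub>R cv p (X p) (Y p) (Z p) + b *\<^sub>R cv p (X' p) (Y p) (Z p)"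
    unfolding cv_fields[OF v(3) Y(1) Z(1)] cv_fields[OF X(1) Y(1) Z(1)] cv_fields[OF X'(1) Y(1) Z(1)] .
  then have "cv p (a *\<^sub>R x + b *\<^sub>R x') y z = a *\<^sub>R cv p x y z + b *\<^sub>R cv p x' y z"
    by (simp only: plus_fun_apply fmul_apply X(2) X'(2) Y(2) Z(2))
  then show "Rm p (a *\<^sub>R x + b *\<^sub>R x') y z u = a * Rm p x y z u + b * Rm p x' y z u"
    unfolding Rm_def by (simp only: g_lin_left cv_tan x x' y z u)
next
  fix x y z u
  assume x: "x \<in> TS p" and y: "y \<in> TS p" and z: "z \<in> TS p" and u: "u \<in> TS p"
  obtain X where X: "VF X" "X p = x" by (rule field_through[OF x])
  obtain Y where Y: "VF Y" "Y p = y" by (rule field_through[OF y])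
  obtain Z where Z: "VF Z" "Z p = z" by (rule field_through[OF z])
  obtain U where U: "VF U" "U p = u" by (rule field_through[OF u])
  have cv3: "cv p (A p) (B p) (C p) = Rf A B C p" if "VF A" "VF B" "VF C" for A B C
    by (rule cv_fields[OF that])
  have neg: "g p (- a) b = - g p a b" if "a \<in> TS p" "b \<in> TS p" for a b
    using g_lin_left[OF that(1,1,2), of "-1" 0] by simp
  have ad: "g p (a + b) c = g p a c + g p b c" if "a \<in> TS p" "b \<in> TS p" "c \<in> TS p" for a b c
    using g_lin_left[OF that, of 1 1] by simp
  have "Rf X Y Z p = - Rf Y X Z p" using Rf_commute[OF X(1) Y(1) Z(1)] by simp
  then have "cv p x y z = - cv p y x z"
    using cv3[OF X(1) Y(1) Z(1)] cv3[OF Y(1) X(1) Z(1)] by (simp only: X(2) Y(2) Z(2))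
  then show "Rm p x y z u = - Rm p y x z u"
    unfolding Rm_def by (simp only: neg cv_tan x y z u)
  have "g p (cv p (X p) (Y p) (Z p)) (U p) = - g p (cv p (X p) (Y p) (U p)) (Z p)"
    using Rf_metric[OF X(1) Y(1) Z(1) U(1)] by (simp only: cv3 X(1) Y(1) Z(1) U(1))
  then show "Rm p x y z u = - Rm p x y u z"
    unfolding Rm_def by (simp only: X(2) Y(2) Z(2) U(2))
  have "Rf X Y Z p + Rf Y Z X p + Rf Z X Y p = 0"
    using fun_cong[OF Rf_bianchi[OF X(1) Y(1) Z(1)], of p] by (simp only: plus_fun_apply zero_fun_apply)
  then have s: "cv p x y z + cv p y z x + cv p z x y = 0"
    using cv3[OF X(1) Y(1) Z(1)] cv3[OF Y(1) Z(1) X(1)] cv3[OF Z(1) X(1) Y(1)]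
    by (simp only: X(2) Y(2) Z(2))
  have "Rm p x y z u + Rm p y z x u + Rm p z x y u = g p (cv p x y z + cv p y z x + cv p z x y) u"
    unfolding Rm_def by (simp only: ad tan_closed cv_tan x y z u)
  also have "\<dots> = 0"
    unfolding s using g_lin_left[OF u u u, of 0 0] by simp
  finally show "Rm p x y z u + Rm p y z x u + Rm p z x y u = 0" .
qed

lemma Rm_J:
  assumes "x \<in> TS p" "y \<in> TS p" and z: "z \<in> Hor M p" and u: "u \<in> Hor M p"
  shows "Rm p x y (J p z) (J p u) = Rm p x y z u"
proof -
  note c = cv_tan[OF assms(1,2) Hor_tan[OF z]]
  have "Rm p x y (J p z) (J p u) = g p (J p (cv p x y z)) (J p u)"
    unfolding Rm_def cv_J[OF assms(1,2) Hor_tan[OF z]] ..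
  also have "\<dots> = g p (cv p x y z) u"
    using u by (simp add: g_eq c J_tan Hor_tan Om_J th_J Hor_th)
  finally show ?thesis unfolding Rm_def .
qed

text \<open>
  The Reeb vector gives zero in the third argument because it is parallel, in the fourth by skewness, and in the first
  two by symmetry under exchange of the pairs.
\<close>

lemma Rm_hor:
  assumes x: "x \<in> TS p" and y: "y \<in> TS p" and z: "z \<in> TS p" and u: "u \<in> TS p"
  shows "Rm p x y z u = Rm p (hor p x) (hor p y) (hor p z) (hor p u)"
proof -
  interpret algebraic_curvature "TS p" "Rm p" by (rule Rm_algebraic)
  have xi3: "Rm p a b (\<xi> p) c = 0" if "a \<in> TS p" "b \<in> TS p" "c \<in> TS p" for a b c
    using g_lin_left[OF that(3,3,3), of 0 0] unfolding Rm_def cv_xi[OF that(1,2)] by simp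
  have xi4: "Rm p a b c (\<xi> p) = 0" if "a \<in> TS p" "b \<in> TS p" "c \<in> TS p" for a b c
    using xi3[OF that] skew34[OF that xi_tan] by simp
  have h3: "Rm p a b (hor p c) d = Rm p a b c d" if "a \<in> TS p" "b \<in> TS p" "c \<in> TS p" "d \<in> TS p" for a b c d
    using lin3[OF that(1-3) xi_tan that(4), of 1 "- th p c"] xi3[OF that(1,2,4)] by (simp add: hor_eq)
  have h4: "Rm p a b c (hor p d) = Rm p a b c d" if "a \<in> TS p" "b \<in> TS p" "c \<in> TS p" "d \<in> TS p" for a b c d
    using lin4[OF that xi_tan, of 1 "- th p d"] xi4[OF that(1-3)] by (simp add: hor_eq)
  have t: "hor p a \<in> TS p" if "a \<in> TS p" for a using Hor_tan[OF hor_Hor[OF that]] .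
  have "Rm p (hor p x) (hor p y) (hor p z) (hor p u) = Rm p (hor p x) (hor p y) z u"
    by (simp only: h3 h4 t x y z u)
  also have "\<dots> = Rm p z u (hor p x) (hor p y)" by (intro pair_symmetric t x y z u)
  also have "\<dots> = Rm p z u x y" by (simp only: h3 h4 t x y z u)
  also have "\<dots> = Rm p x y z u" by (intro pair_symmetric x y z u)
  finally show ?thesis by (rule sym)
qed

lemma g_pos_Hor: "x \<in> Hor M p \<Longrightarrow> x \<noteq> 0 \<Longrightarrow> g p x x > 0"
  using levi_pos unfolding levi_positive_def webster_def by (simp add: hor_id Hor_th zero_fun_def)

definition hol_plane :: "'a \<Rightarrow> 'a tvec \<Rightarrow> 'a tvec set" where
  "hol_plane p x = {\<lambda>f. a * x f + b * J p x f | a b. True}"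

lemma hol_plane_eq: "hol_plane p x = {a *\<^sub>R x + b *\<^sub>R J p x | a b. True}"
  by (simp add: hol_plane_def plus_fun_def scaleR_fun_def)

lemma g_hol_plane:
  assumes x: "x \<in> Hor M p" and n: "g p x x = 1"
  shows "g p (a *\<^sub>R x + b *\<^sub>R J p x) (c *\<^sub>R x + d *\<^sub>R J p x) = a * c + b * d"
proof -
  note t = Hor_tan[OF x] J_tan[OF Hor_tan[OF x]]
  have "g p (J p x) x = 0" using g_sym[OF t(2,1)] g_x_Jx[OF x] by simp
  then show ?thesis
    by (simp add: g_lin_left g_lin_right tan_closed t g_J[OF x x] g_x_Jx[OF x] n algebra_simps)
qed

lemma hol_plane_J_plane:
  assumes x: "x \<in> Hor M p" and n: "g p x x = 1"
  shows "J_plane M p (hol_plane p x)"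
  unfolding J_plane_def
proof (intro conjI)
  show sub: "hol_plane p x \<subseteq> Hor M p"
    unfolding hol_plane_eq using x J_Hor[OF Hor_tan[OF x]] by (auto intro!: Hor_closed)
  show "Jb M p ` hol_plane p x \<subseteq> hol_plane p x"
  proof
    fix v assume "v \<in> Jb M p ` hol_plane p x"
    then obtain a b where v: "v = Jb M p (a *\<^sub>R x + b *\<^sub>R J p x)" unfolding hol_plane_eq by blast
    have "v = J p (a *\<^sub>R x + b *\<^sub>R J p x)"
      unfolding v by (rule J_Jb[symmetric]) (intro Hor_closed x J_Hor Hor_tan)
    also have "\<dots> = (- b) *\<^sub>R x + a *\<^sub>R J p x"
      using x by (simp add: J_lin Hor_tan J_tan J_J Hor_th)
    finally show "v \<in> hol_plane p x" unfolding hol_plane_eq by blast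
  qed
  show "\<exists>xa y. hol_plane p x = {\<lambda>f. a * xa f + b * y f |a b. True} \<and>
      (\<forall>a b. (\<lambda>f. a * xa f + b * y f) = (\<lambda>f. 0) \<longrightarrow> a = 0 \<and> b = 0)"
  proof (intro exI conjI allI impI)
    show "hol_plane p x = {\<lambda>f. a * x f + b * J p x f |a b. True}" by (rule hol_plane_def)
  next
    fix a b assume "(\<lambda>f. a * x f + b * J p x f) = (\<lambda>f. 0)"
    then have "a *\<^sub>R x + b *\<^sub>R J p x = 0" by (simp add: fun_eq_iff)
    then have "a * a + b * b = g p 0 0"
      using g_hol_plane[OF x n, of a b a b] by simp
    also have "\<dots> = 0" using g_lin_left[OF Hor_tan[OF x] Hor_tan[OF x] tan_closed(1), of 0 0] by simp
    finally show "a = 0" "b = 0" by (simp_all add: sum_squares_eq_zero_iff)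
  qed
qed

text \<open>
  Any orthonormal basis of the plane arises from \<open>x, Jx\<close> by an orthogonal matrix, whose determinant has
  square \<open>1\<close>.
\<close>

lemma psh_sect_curv_hol_plane:
  assumes x: "x \<in> Hor M p" and n: "g p x x = 1"
  shows "psh_sect_curv M \<xi> D p (hol_plane p x) = Rm p x (J p x) (J p x) x"
  unfolding psh_sect_curv_def
proof (rule the_equality)
  interpret algebraic_curvature "TS p" "Rm p" by (rule Rm_algebraic)
  note t = Hor_tan[OF x] J_tan[OF Hor_tan[OF x]]
  show "\<forall>e1 e2. orthonormal_basis M \<xi> p (hol_plane p x) e1 e2 \<longrightarrow>
      Rm p x (J p x) (J p x) x = g p (cv p e1 e2 e2) e1"
  proof (intro allI impI)
    fix e1 e2 assume o: "orthonormal_basis M \<xi> p (hol_plane p x) e1 e2"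
    have P: "hol_plane p x = {a *\<^sub>R e1 + b *\<^sub>R e2 | a b. True}"
      using o unfolding orthonormal_basis_def by (simp add: plus_fun_def scaleR_fun_def)
    have "1 *\<^sub>R e1 + 0 *\<^sub>R e2 \<in> hol_plane p x" "0 *\<^sub>R e1 + 1 *\<^sub>R e2 \<in> hol_plane p x"
      unfolding P by blast+
    then obtain a b c d where e: "e1 = a *\<^sub>R x + b *\<^sub>R J p x" "e2 = c *\<^sub>R x + d *\<^sub>R J p x"
      unfolding hol_plane_eq by auto
    have r: "a * a + b * b = 1" "c * c + d * d = 1" "a * c + b * d = 0"
      using o unfolding orthonormal_basis_def e by (simp_all add: g_hol_plane[OF x n])
    \<comment> \<open>By the identity of Lagrange the square of the determinant is the Gram determinant of the basis.\<close>
    have "(a * d - b * c)\<^sup>2 = (a * a + b * b) * (c * c + d * d) - (a * c + b * d)\<^sup>2"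
      by (simp add: power2_eq_square algebra_simps)
    then have "(a * d - b * c)\<^sup>2 = 1" using r by simp
    then show "Rm p x (J p x) (J p x) x = g p (cv p e1 e2 e2) e1"
      using plane_transform[OF t, of a b c d] unfolding Rm_def e by simp
  qed
  fix k assume k: "\<forall>e1 e2. orthonormal_basis M \<xi> p (hol_plane p x) e1 e2 \<longrightarrow>
      k = g p (cv p e1 e2 e2) e1"
  have "orthonormal_basis M \<xi> p (hol_plane p x) x (J p x)"
    unfolding orthonormal_basis_def hol_plane_def
    using n g_J[OF x x] g_x_Jx[OF x] by simp
  then show "k = Rm p x (J p x) (J p x) x" using k unfolding Rm_def by blast
qed

end

section \<open>Pseudo-Hermitian isometries of tangent spaces\<close>

locale sasaki_pair =
  L: sasaki m M \<xi> D + R: sasaki m M' \<xi>' D'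
  for m :: nat
    and M :: "('a::{t2_space, second_countable_topology}, 'n::finite) psh"
    and M' :: "('b::{t2_space, second_countable_topology}, 'n) psh"
    and \<xi> :: "'a vfield" and \<xi>' :: "'b vfield"
    and D :: "'a connection" and D' :: "'b connection" +
  fixes p :: 'a and p' :: 'b and \<Phi> :: "'a tvec \<Rightarrow> 'b tvec"
  assumes iso: "psh_iso_at M \<xi> p M' \<xi>' p' \<Phi>"
begin

lemma Phi_lin: "x \<in> L.TS p \<Longrightarrow> y \<in> L.TS p \<Longrightarrow> \<Phi> (a *\<^sub>R x + b *\<^sub>R y) = a *\<^sub>R \<Phi> x + b *\<^sub>R \<Phi> y"
proof -
  assume "x \<in> L.TS p" "y \<in> L.TS p"
  then have "\<Phi> (\<lambda>f. a * x f + b * y f) = (\<lambda>f. a * \<Phi> x f + b * \<Phi> y f)"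
    using iso unfolding psh_iso_at_def by blast
  then show ?thesis by (simp add: plus_fun_def scaleR_fun_def)
qed

lemma Phi_bij: "bij_betw \<Phi> (L.TS p) (R.TS p')"
  and Phi_th: "x \<in> L.TS p \<Longrightarrow> R.th p' (\<Phi> x) = L.th p x"
  and Phi_J: "x \<in> L.TS p \<Longrightarrow> R.J p' (\<Phi> x) = \<Phi> (L.J p x)"
  and Phi_levi: "x \<in> Hor M p \<Longrightarrow> y \<in> Hor M p \<Longrightarrow> levi M' p' (\<Phi> x) (\<Phi> y) = levi M p x y"
  using iso unfolding psh_iso_at_def by auto

lemma Phi_tan: "x \<in> L.TS p \<Longrightarrow> \<Phi> x \<in> R.TS p'"
  using Phi_bij by (rule bij_betwE[THEN bspec])

lemma Phi_Hor: "x \<in> Hor M p \<Longrightarrow> \<Phi> x \<in> Hor M' p'"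
  by (simp add: L.Hor_iff R.Hor_iff Phi_tan Phi_th)

lemma Phi_zero: "\<Phi> 0 = 0"
  using Phi_lin[OF L.tan_closed(1) L.tan_closed(1), of 0 0] by simp

text \<open>
  The vector \<open>\<Phi> (\<xi> p)\<close> is killed by \<open>J\<close>, so it is a multiple of the Reeb
  vector, and \<open>\<theta>\<close> has the value \<open>1\<close> on it.
\<close>

lemma Phi_xi: "\<Phi> (\<xi> p) = \<xi>' p'"
proof -
  let ?v = "\<Phi> (\<xi> p)"
  have v: "?v \<in> R.TS p'" by (rule Phi_tan[OF L.xi_tan])
  have "R.J p' (R.J p' ?v) = 0"
    by (simp add: Phi_J L.xi_tan L.J_xi Phi_zero R.J_zero)
  then have "R.th p' ?v *\<^sub>R \<xi>' p' - ?v = 0" unfolding R.J_J[OF v] .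
  then show ?thesis by (simp add: Phi_th L.xi_tan L.th_xi)
qed

lemma Phi_hor: "x \<in> L.TS p \<Longrightarrow> \<Phi> (L.hor p x) = R.hor p' (\<Phi> x)"
  using Phi_lin[OF _ L.xi_tan, of x 1 "- L.th p x"]
  by (simp add: L.hor_eq R.hor_eq Phi_xi Phi_th)

lemma Phi_g: "x \<in> L.TS p \<Longrightarrow> y \<in> L.TS p \<Longrightarrow> R.g p' (\<Phi> x) (\<Phi> y) = L.g p x y"
  unfolding webster_def by (simp add: Phi_levi L.hor_Hor Phi_th flip: Phi_hor)

lemma Phi_hol_plane: "x \<in> Hor M p \<Longrightarrow> \<Phi> ` L.hol_plane p x = R.hol_plane p' (\<Phi> x)"
proof -
  assume x: "x \<in> Hor M p"
  have "\<Phi> (a *\<^sub>R x + b *\<^sub>R L.J p x) = a *\<^sub>R \<Phi> x + b *\<^sub>R R.J p' (\<Phi> x)" for a b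
    using Phi_lin[OF L.Hor_tan[OF x] L.J_tan[OF L.Hor_tan[OF x]]] by (simp add: Phi_J L.Hor_tan[OF x])
  then show ?thesis
    unfolding L.hol_plane_eq R.hol_plane_eq by (auto simp: image_iff) metis+
qed

text \<open>
  The tensor that is to vanish. It is studied on the contact space, where \<open>J\<close> is a complex structure.
\<close>

definition Rdiff :: "'a tvec \<Rightarrow> 'a tvec \<Rightarrow> 'a tvec \<Rightarrow> 'a tvec \<Rightarrow> real" where
  "Rdiff x y z u = R.Rm p' (\<Phi> x) (\<Phi> y) (\<Phi> z) (\<Phi> u) - L.Rm p x y z u"

lemma Rdiff_algebraic: "algebraic_curvature (Hor M p) Rdiff"
proof
  interpret LA: algebraic_curvature "L.TS p" "L.Rm p" by (rule L.Rm_algebraic)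
  interpret RA: algebraic_curvature "R.TS p'" "R.Rm p'" by (rule R.Rm_algebraic)
  show "subspace (Hor M p)" by (intro subspaceI L.Hor_closed)
  fix x y z u assume h: "x \<in> Hor M p" "y \<in> Hor M p" "z \<in> Hor M p" "u \<in> Hor M p"
  note t = h[THEN L.Hor_tan] and t' = h[THEN L.Hor_tan, THEN Phi_tan]
  show "Rdiff (a *\<^sub>R x + b *\<^sub>R x') y z u = a * Rdiff x y z u + b * Rdiff x' y z u"
    if "x' \<in> Hor M p" for a b x'
    using L.Hor_tan[OF that] t
    by (simp add: Rdiff_def Phi_lin LA.lin1 RA.lin1 Phi_tan algebra_simps)
  show "Rdiff x y z u = - Rdiff y x z u"
    using LA.skew12[OF t] RA.skew12[OF t'] by (simp add: Rdiff_def)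
  show "Rdiff x y z u = - Rdiff x y u z"
    using LA.skew34[OF t] RA.skew34[OF t'] by (simp add: Rdiff_def)
  show "Rdiff x y z u + Rdiff y z x u + Rdiff z x y u = 0"
    using LA.bianchi[OF t] RA.bianchi[OF t'] by (simp add: Rdiff_def)
qed

text \<open>
  The hypothesis makes \<open>Rdiff\<close> vanish on \<open>(x, Jx, Jx, x)\<close> for unit vectors and, by
  homogeneity, for all vectors of the contact space, so \<open>Rdiff\<close> is zero there. Both curvature tensors
  factor through the projection to the contact space, so they agree on all tangent vectors; pairing the difference of
  the two vectors with itself gives the equality of vectors.
\<close>

lemma curvature_determined:
  assumes sect: "\<And>P. J_plane M p P \<Longrightarrow>
      psh_sect_curv M' \<xi>' D' p' (\<Phi> ` P) = psh_sect_curv M \<xi> D p P"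
    and x: "x \<in> L.TS p" and y: "y \<in> L.TS p" and z: "z \<in> L.TS p"
  shows "\<Phi> (L.cv p x y z) = R.cv p' (\<Phi> x) (\<Phi> y) (\<Phi> z)"
proof -
  interpret A: algebraic_curvature "Hor M p" Rdiff by (rule Rdiff_algebraic)
  have unit: "Rdiff x (L.J p x) (L.J p x) x = 0" if x: "x \<in> Hor M p" and n: "L.g p x x = 1" for x
  proof -
    have n': "R.g p' (\<Phi> x) (\<Phi> x) = 1" using Phi_g[OF L.Hor_tan[OF x] L.Hor_tan[OF x]] n by simp
    have "R.Rm p' (\<Phi> x) (R.J p' (\<Phi> x)) (R.J p' (\<Phi> x)) (\<Phi> x) = L.Rm p x (L.J p x) (L.J p x) x"
      using sect[OF L.hol_plane_J_plane[OF x n]]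
      unfolding Phi_hol_plane[OF x] L.psh_sect_curv_hol_plane[OF x n]
        R.psh_sect_curv_hol_plane[OF Phi_Hor[OF x] n'] .
    then show ?thesis by (simp add: Rdiff_def Phi_J L.Hor_tan[OF x])
  qed
  have hol: "Rdiff x (L.J p x) (L.J p x) x = 0" if x: "x \<in> Hor M p" for x
  proof (cases "x = 0")
    case True
    then show ?thesis using A.diag[of 0 0 0] A.closed(1) L.J_zero by simp
  next
    case False
    define r where "r = sqrt (L.g p x x)"
    have r: "r > 0" "r * r = L.g p x x" using L.g_pos_Hor[OF x False] by (simp_all add: r_def)
    define v where "v = (1 / r) *\<^sub>R x"
    have v: "v \<in> Hor M p" unfolding v_def by (rule L.Hor_closed(3)[OF x])
    note tx = L.Hor_tan[OF x]
    have xv: "x = r *\<^sub>R v" using r(1) by (simp add: v_def)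
    then have Jx: "L.J p x = r *\<^sub>R L.J p v" using L.J_scale[OF L.Hor_tan[OF v]] by simp
    have "r * r * L.g p v v = r * r"
      using L.g_lin_left[OF L.Hor_tan[OF v] L.Hor_tan[OF v] tx, of r 0]
        L.g_lin_right[OF L.Hor_tan[OF v] L.Hor_tan[OF v] L.Hor_tan[OF v], of r 0] r(2) xv by simp
    then have "L.g p v v = 1" using r(1) by simp
    then have "Rdiff v (L.J p v) (L.J p v) v = 0" by (rule unit[OF v])
    then show ?thesis
      using A.plane_transform[OF v L.J_Hor[OF L.Hor_tan[OF v]], of r 0 0 r] xv Jx by simp
  qed
  have inv: "Rdiff x y (L.J p z) (L.J p u) = Rdiff x y z u"
    if "x \<in> Hor M p" "y \<in> Hor M p" "z \<in> Hor M p" "u \<in> Hor M p" for x y z u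
    using that by (simp add: Rdiff_def L.Rm_J R.Rm_J L.Hor_tan Phi_tan Phi_Hor flip: Phi_J)
  have zeroH: "Rdiff x y z u = 0"
    if h: "x \<in> Hor M p" "y \<in> Hor M p" "z \<in> Hor M p" "u \<in> Hor M p" for x y z u
    by (rule A.vanishes_if_holomorphic_sectional_vanishes[of "L.J p", OF _ _ _ _ inv hol h])
      (simp_all add: L.J_Hor L.Hor_tan L.J_J L.Hor_th L.J_add L.J_diff)
  have zero: "R.Rm p' (\<Phi> x) (\<Phi> y) (\<Phi> z) (\<Phi> u) = L.Rm p x y z u"
    if u: "u \<in> L.TS p" for u
    using zeroH[of "L.hor p x" "L.hor p y" "L.hor p z" "L.hor p u"] x y z u
      L.Rm_hor[OF x y z u] R.Rm_hor[OF Phi_tan[OF x] Phi_tan[OF y] Phi_tan[OF z] Phi_tan[OF u]]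
    by (simp add: Rdiff_def L.hor_Hor Phi_hor)
  let ?c = "L.cv p x y z" and ?c' = "R.cv p' (\<Phi> x) (\<Phi> y) (\<Phi> z)"
  have c: "?c \<in> L.TS p" by (rule L.cv_tan[OF x y z])
  have c': "?c' \<in> R.TS p'" by (intro R.cv_tan Phi_tan x y z)
  have v: "\<Phi> ?c - ?c' \<in> R.TS p'" by (intro R.tan_closed Phi_tan c c')
  then obtain u where u: "u \<in> L.TS p" "\<Phi> u = \<Phi> ?c - ?c'"
    using Phi_bij unfolding bij_betw_def by (metis imageE)
  have "R.g p' (\<Phi> ?c - ?c') (\<Phi> u) = R.g p' (\<Phi> ?c) (\<Phi> u) - R.g p' ?c' (\<Phi> u)"
    using R.g_lin_left[OF Phi_tan[OF c] c' Phi_tan[OF u(1)], of 1 "-1"] by simp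
  also have "\<dots> = 0"
    using zero[OF u(1)] Phi_g[OF c u(1)] unfolding L.Rm_def R.Rm_def by simp
  finally have "\<Phi> ?c - ?c' = 0"
    unfolding u(2) by (rule R.g_definite[OF v])
  then show ?thesis by simp
qed

end

theorem corollary6:
  fixes m :: nat
    and M :: "('a::{t2_space, second_countable_topology}, 'n::finite) psh"
    and M' :: "('b::{t2_space, second_countable_topology}, 'n) psh"
    and \<xi> :: "'a vfield" and \<xi>' :: "'b vfield"
    and D :: "'a connection" and D' :: "'b connection"
    and p :: 'a and p' :: 'b
    and \<Phi> :: "'a tvec \<Rightarrow> 'b tvec"
  assumes "sasakian m M \<xi> D" and "sasakian m M' \<xi>' D'"
    and "psh_iso_at M \<xi> p M' \<xi>' p' \<Phi>"
    and "\<And>P. J_plane M p P \<Longrightarrow>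
           psh_sect_curv M' \<xi>' D' p' (\<Phi> ` P) = psh_sect_curv M \<xi> D p P"
  shows "\<forall>x\<in>tangent M p. \<forall>y\<in>tangent M p. \<forall>z\<in>tangent M p.
           \<Phi> (curv M D p x y z) = curv M' D' p' (\<Phi> x) (\<Phi> y) (\<Phi> z)"
proof -
  interpret sasaki_pair m M M' \<xi> \<xi>' D D' p p' \<Phi>
    using assms(1-3) by unfold_locales
  show ?thesis using curvature_determined[OF assms(4)] by blast
qed

end
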